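(* Let $\mathfrak g=\mathfrak{gl}(1|1)$ over $\mathbb C$ and $\widehat{\mathfrak g}_-=t^{-1}\mathfrak g[t^{-1}]$. Set $E_{ij}(z)=\sum_{r=0}^\infty E_{ij}[-r-1]z^r$ for $i,j\in\{1,2\}$, and for $k\geqslant1$ consider the power series in $z$ with coefficients in the symmetric algebra $\mathrm S(\widehat{\mathfrak g}_-)$: (h) $E_{11}(z)^{k-1}\big(E_{11}(z)+E_{22}(z)\big)+(k-1)E_{11}(z)^{k-2}E_{21}(z)E_{12}(z)$; (b) $E_{22}(z)^{k-1}\big(E_{11}(z)+E_{22}(z)\big)-(k-1)E_{22}(z)^{k-2}E_{21}(z)E_{12}(z)$; (s) $\mathrm{str}\begin{bmatrix}E_{11}(z)&E_{12}(z)\\-E_{21}(z)&-E_{22}(z)\end{bmatrix}^k$. Then for each of the three types (h), (b), (s), the coefficients of the series of this type (for all $k\geqslant1$) generate the algebra of invariants $\mathrm S(\widehat{\mathfrak g}_-)^{\mathfrak g[t]}$.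
   Context: The Lie superalgebra $\mathfrak g=\mathfrak{gl}(1|1)$ has basis $E_{ij}$, $i,j\in\{1,2\}$; with $\bar 1=0$, $\bar 2=1$, the element $E_{ij}$ has parity $\bar\imath+\bar\jmath$ mod 2. Write $E_{ij}[r]=E_{ij}t^r$; in $\mathfrak g[t,t^{-1}]$, $$[E_{ij}[r],E_{kl}[s]]=\delta_{kj}E_{il}[r+s]-\delta_{il}E_{kj}[r+s](-1)^{(\bar\imath+\bar\jmath)(\bar k+\bar l)}.$$ The space $\widehat{\mathfrak g}_-=t^{-1}\mathfrak g[t^{-1}]$ is identified with the quotient $\mathfrak g[t,t^{-1}]/\mathfrak g[t]$ and thus is a $\mathfrak g[t]$-module under the adjoint action (so $E_{ij}[r]$ with $r\ge0$ acts on $E_{kl}[s]$ with $s<0$ by the bracket above, where all terms with $r+s\geqslant0$ are set to zero). The action is extended to the (super)symmetric algebra $\mathrm S(\widehat{\mathfrak g}_-)$ (even generators commute with everything, odd generators anticommute with each other) by superderivations, and $$\mathrm S(\widehat{\mathfrak g}_-)^{\mathfrak g[t]}=\{P\in\mathrm S(\widehat{\mathfrak g}_-)\mid \mathfrak g[t]\,P=0\}.$$ Matrix powers are taken with the usual matrix product, and $\mathrm{str}\,X=X_{11}-X_{22}$ for a $2\times2$ matrix $X$. For $k=1$ the terms with coefficient $k-1$ are zero. *)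

theory Defs
  imports "HOL-Analysis.Analysis" "HOL-Library.Poly_Mapping"
    "HOL-Computational_Algebra.Formal_Power_Series"
begin

section \<open>The Grassmann algebra of a commutative ring\<close>

text \<open>An element is stored by its coefficients with respect to the basis of ordered products
  \<open>\<theta>\<^sub>A = \<theta>(a\<^sub>1) \<cdots> \<theta>(a\<^sub>k)\<close>, where \<open>A = {a\<^sub>1 < \<dots> < a\<^sub>k}\<close> runs over the finite sets of odd generators.\<close>

typedef (overloaded) ('r, 'o) grassmann =
  "{f :: 'o set \<Rightarrow> 'r::zero. finite {A. f A \<noteq> 0} \<and> (\<forall>A. f A \<noteq> 0 \<longrightarrow> finite A)}"
  morphisms gcoeff Abs_grassmann
  by (rule exI[of _ "\<lambda>_. 0"]) auto

setup_lifting type_definition_grassmann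

lemma grassmann_eqI: "(\<And>A. gcoeff f A = gcoeff g A) \<Longrightarrow> f = g"
  by (simp add: gcoeff_inject[symmetric] fun_eq_iff)

lemma finite_gcoeff: "finite {A. gcoeff f A \<noteq> 0}"
  using gcoeff[of f] by auto

lemma gcoeff_infinite: "infinite A \<Longrightarrow> gcoeff f A = 0"
  using gcoeff[of f] by auto

text \<open>The sign in \<open>\<theta>\<^sub>A \<theta>\<^sub>B = \<plusminus> \<theta>\<^bsub>A \<union> B\<^esub>\<close> for disjoint \<open>A\<close> and \<open>B\<close>:
  one factor \<open>-1\<close> for every pair that has to be interchanged.\<close>

definition shuffle_sign :: "'o::linorder set \<Rightarrow> 'o set \<Rightarrow> 'r::comm_ring_1" where
  "shuffle_sign A B = (\<Prod>a\<in>A. \<Prod>b\<in>B. if b < a then - 1 else 1)"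

lemma shuffle_sign_empty [simp]: "shuffle_sign {} B = 1" "shuffle_sign A {} = 1"
  by (simp_all add: shuffle_sign_def)

lemma shuffle_sign_Un1:
  "finite A \<Longrightarrow> finite B \<Longrightarrow> A \<inter> B = {} \<Longrightarrow>
    shuffle_sign (A \<union> B) C = shuffle_sign A C * (shuffle_sign B C :: 'r::comm_ring_1)"
  by (simp add: shuffle_sign_def prod.union_disjoint)

lemma shuffle_sign_Un2:
  "finite B \<Longrightarrow> finite C \<Longrightarrow> B \<inter> C = {} \<Longrightarrow>
    shuffle_sign A (B \<union> C) = shuffle_sign A B * (shuffle_sign A C :: 'r::comm_ring_1)"
  by (simp add: shuffle_sign_def prod.union_disjoint prod.distrib)

lemma shuffle_sign_commute:
  assumes "finite A" "finite B" "A \<inter> B = {}"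
  shows "shuffle_sign A B = (- 1) ^ (card A * card B) * (shuffle_sign B A :: 'r::comm_ring_1)"
proof -
  have "shuffle_sign A B = (\<Prod>a\<in>A. \<Prod>b\<in>B. (- 1) * (if a < b then - 1 else 1 :: 'r))"
    unfolding shuffle_sign_def using assms(3) by (intro prod.cong refl) auto
  also have "\<dots> = (- 1) ^ (card A * card B) * (\<Prod>a\<in>A. \<Prod>b\<in>B. if a < b then - 1 else 1)"
    by (simp only: prod.distrib prod_constant power_mult[symmetric]) (simp add: mult.commute)
  also have "(\<Prod>a\<in>A. \<Prod>b\<in>B. if a < b then - 1 else 1 :: 'r) = shuffle_sign B A"
    unfolding shuffle_sign_def by (rule prod.swap)
  finally show ?thesis .
qed

lemma shuffle_sign_square [simp]: "shuffle_sign A B * shuffle_sign A B = (1 :: 'r::comm_ring_1)"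
  unfolding shuffle_sign_def prod.distrib[symmetric] by (intro prod.neutral ballI) auto

instantiation grassmann :: (ab_group_add, type) ab_group_add
begin

lift_definition zero_grassmann :: "('a, 'b) grassmann" is "\<lambda>_. 0" by simp

lift_definition plus_grassmann :: "('a, 'b) grassmann \<Rightarrow> ('a, 'b) grassmann \<Rightarrow> ('a, 'b) grassmann"
  is "\<lambda>f g A. f A + g A"
proof -
  fix f g :: "'b set \<Rightarrow> 'a"
  assume f: "finite {A. f A \<noteq> 0} \<and> (\<forall>A. f A \<noteq> 0 \<longrightarrow> finite A)"
    and g: "finite {A. g A \<noteq> 0} \<and> (\<forall>A. g A \<noteq> 0 \<longrightarrow> finite A)"
  have "finite {A. f A + g A \<noteq> 0}"
    by (rule finite_subset[of _ "{A. f A \<noteq> 0} \<union> {A. g A \<noteq> 0}"]) (use f g in auto)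
  moreover have "finite A" if "f A + g A \<noteq> 0" for A
    using that f g by (cases "f A = 0") auto
  ultimately show "finite {A. f A + g A \<noteq> 0} \<and> (\<forall>A. f A + g A \<noteq> 0 \<longrightarrow> finite A)"
    by blast
qed

lift_definition uminus_grassmann :: "('a, 'b) grassmann \<Rightarrow> ('a, 'b) grassmann"
  is "\<lambda>f A. - f A" by simp

definition minus_grassmann :: "('a, 'b) grassmann \<Rightarrow> ('a, 'b) grassmann \<Rightarrow> ('a, 'b) grassmann"
  where "f - g = f + - (g :: ('a, 'b) grassmann)"

instance
proof
  fix f g h :: "('a, 'b) grassmann"
  show "f + g + h = f + (g + h)" "f + g = g + f" "0 + f = f" "- f + f = 0"
    by (rule grassmann_eqI; simp add: plus_grassmann.rep_eq zero_grassmann.rep_eq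
        uminus_grassmann.rep_eq add_ac)+
qed (rule minus_grassmann_def)

end

lemmas gcoeff_zero [simp] = zero_grassmann.rep_eq[THEN fun_cong]
  and gcoeff_add [simp] = plus_grassmann.rep_eq[THEN fun_cong]
  and gcoeff_uminus [simp] = uminus_grassmann.rep_eq[THEN fun_cong]

lemma gcoeff_minus [simp]: "gcoeff (f - g) A = gcoeff f A - gcoeff g A"
  by (subst minus_grassmann_def) (simp only: gcoeff_add gcoeff_uminus diff_conv_add_uminus)

lemma gcoeff_sum: "gcoeff (sum f X) A = (\<Sum>x\<in>X. gcoeff (f x) A)"
  by (induction X rule: infinite_finite_induct) simp_all

lift_definition gmonom :: "'o set \<Rightarrow> 'r::zero \<Rightarrow> ('r, 'o) grassmann"
  is "\<lambda>A c B. if finite A \<and> B = A then c else 0"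
proof -
  fix A :: "'o set" and c :: 'r
  have "finite {B. (if finite A \<and> B = A then c else 0) \<noteq> 0}"
    by (rule finite_subset[of _ "{A}"]) auto
  then show "finite {B. (if finite A \<and> B = A then c else 0) \<noteq> 0} \<and>
      (\<forall>B. (if finite A \<and> B = A then c else 0) \<noteq> 0 \<longrightarrow> finite B)"
    by simp
qed

lemma gcoeff_gmonom: "gcoeff (gmonom A c) B = (if finite A \<and> B = A then c else 0)"
  by (simp add: gmonom.rep_eq)

definition gconst :: "'r::zero \<Rightarrow> ('r, 'o) grassmann" where
  "gconst c = gmonom {} c"

definition theta :: "'o \<Rightarrow> ('r::zero_neq_one, 'o) grassmann" where
  "theta x = gmonom {x} 1"

instantiation grassmann :: (comm_ring_1, linorder) ring_1
begin

definition one_grassmann :: "('a, 'b) grassmann" where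
  "1 = gconst 1"

lift_definition times_grassmann :: "('a, 'b) grassmann \<Rightarrow> ('a, 'b) grassmann \<Rightarrow> ('a, 'b) grassmann"
  is "\<lambda>f g C. \<Sum>A\<in>Pow C. shuffle_sign A (C - A) * f A * g (C - A)"
proof -
  fix f g :: "'b set \<Rightarrow> 'a"
  assume f: "finite {A. f A \<noteq> 0} \<and> (\<forall>A. f A \<noteq> 0 \<longrightarrow> finite A)"
    and g: "finite {A. g A \<noteq> 0} \<and> (\<forall>A. g A \<noteq> 0 \<longrightarrow> finite A)"
  let ?h = "\<lambda>C. \<Sum>A\<in>Pow C. shuffle_sign A (C - A) * f A * g (C - A)"
  have "\<exists>A B. f A \<noteq> 0 \<and> g B \<noteq> 0 \<and> C = A \<union> B" if "?h C \<noteq> 0" for C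
  proof -
    obtain A where "A \<in> Pow C" "shuffle_sign A (C - A) * f A * g (C - A) \<noteq> 0"
      using \<open>?h C \<noteq> 0\<close> by (rule sum.not_neutral_contains_not_neutral)
    then show ?thesis by (intro exI[of _ A] exI[of _ "C - A"]) auto
  qed
  then have *: "{C. ?h C \<noteq> 0} \<subseteq> (\<lambda>(A, B). A \<union> B) ` ({A. f A \<noteq> 0} \<times> {B. g B \<noteq> 0})"
    by fast
  have "finite {C. ?h C \<noteq> 0}"
    by (rule finite_subset[OF *]) (use f g in simp)
  moreover have "\<forall>C. ?h C \<noteq> 0 \<longrightarrow> finite C"
    by (metis (no_types, lifting) finite_Pow_iff sum.infinite)
  ultimately show "finite {C. ?h C \<noteq> 0} \<and> (\<forall>C. ?h C \<noteq> 0 \<longrightarrow> finite C)" by blast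
qed

instance
proof
  fix f g h :: "('a, 'b) grassmann"
  show "f * g * h = f * (g * h)"
  proof (rule grassmann_eqI)
    fix C
    show "gcoeff (f * g * h) C = gcoeff (f * (g * h)) C"
    proof (cases "finite C")
      case True
      have fin: "finite X" if "X \<subseteq> C" for X
        using that True finite_subset by blast
      have "gcoeff (f * g * h) C = (\<Sum>B\<in>Pow C. \<Sum>A\<in>Pow B.
          shuffle_sign B (C - B) * (shuffle_sign A (B - A) * gcoeff f A * gcoeff g (B - A)) * gcoeff h (C - B))"
        by (simp add: times_grassmann.rep_eq sum_distrib_left sum_distrib_right)
      also have "\<dots> = (\<Sum>(B, A)\<in>(SIGMA B:Pow C. Pow B).
          shuffle_sign B (C - B) * (shuffle_sign A (B - A) * gcoeff f A * gcoeff g (B - A)) * gcoeff h (C - B))"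
        using True fin by (subst sum.Sigma) auto
      also have "\<dots> = (\<Sum>(A, D)\<in>(SIGMA A:Pow C. Pow (C - A)).
          shuffle_sign A (C - A) * gcoeff f A * (shuffle_sign D (C - A - D) * gcoeff g D * gcoeff h (C - A - D)))"
      proof (rule sum.reindex_bij_witness[where i = "\<lambda>(A, D). (A \<union> D, A)" and j = "\<lambda>(B, A). (A, B - A)"])
        fix p assume "p \<in> (SIGMA B:Pow C. Pow B)"
        then obtain A B where p: "p = (B, A)" "A \<subseteq> B" "B \<subseteq> C" by auto
        define D E where "D = B - A" and "E = C - B"
        have BC: "B = A \<union> D" "C = A \<union> D \<union> E" "A \<inter> D = {}" "(A \<union> D) \<inter> E = {}"
          using p by (auto simp: D_def E_def)
        have [simp]: "finite A" "finite D" "finite E" using True BC(2) by auto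
        have e: "C - B = E" "C - A = D \<union> E" "B - A = D" "C - A - D = E" "D \<union> E - D = E"
          using BC by auto
        have s1: "shuffle_sign B E = shuffle_sign A E * (shuffle_sign D E :: 'a)"
          unfolding BC(1) by (rule shuffle_sign_Un1) (use BC in auto)
        have s2: "shuffle_sign A (D \<union> E) = shuffle_sign A D * (shuffle_sign A E :: 'a)"
          by (rule shuffle_sign_Un2) (use BC in auto)
        show "(case case p of (B, A) \<Rightarrow> (A, B - A) of (A, D) \<Rightarrow>
             shuffle_sign A (C - A) * gcoeff f A * (shuffle_sign D (C - A - D) * gcoeff g D * gcoeff h (C - A - D)))
          = (case p of (B, A) \<Rightarrow>
             shuffle_sign B (C - B) * (shuffle_sign A (B - A) * gcoeff f A * gcoeff g (B - A)) * gcoeff h (C - B))"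
          by (simp add: p(1) e s1 s2 mult_ac)
      qed auto
      also have "\<dots> = (\<Sum>A\<in>Pow C. \<Sum>D\<in>Pow (C - A).
          shuffle_sign A (C - A) * gcoeff f A * (shuffle_sign D (C - A - D) * gcoeff g D * gcoeff h (C - A - D)))"
        using True fin by (subst sum.Sigma) auto
      also have "\<dots> = gcoeff (f * (g * h)) C"
        by (simp add: times_grassmann.rep_eq sum_distrib_left)
      finally show ?thesis .
    qed (simp add: gcoeff_infinite)
  qed
  show "1 * f = f"
  proof (rule grassmann_eqI)
    fix C
    show "gcoeff (1 * f) C = gcoeff f C"
    proof (cases "finite C")
      case True
      have "gcoeff (1 * f) C = (\<Sum>A\<in>Pow C. if A = {} then gcoeff f C else 0)"
        unfolding times_grassmann.rep_eq
        by (intro sum.cong refl) (auto simp: one_grassmann_def gconst_def gcoeff_gmonom)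
      also have "\<dots> = gcoeff f C" using True by (subst sum.delta) auto
      finally show ?thesis .
    qed (simp add: gcoeff_infinite)
  qed
  show "f * 1 = f"
  proof (rule grassmann_eqI)
    fix C
    show "gcoeff (f * 1) C = gcoeff f C"
    proof (cases "finite C")
      case True
      have "gcoeff (f * 1) C = (\<Sum>A\<in>Pow C. if A = C then gcoeff f C else 0)"
        unfolding times_grassmann.rep_eq
        by (intro sum.cong refl) (auto simp: one_grassmann_def gconst_def gcoeff_gmonom)
      also have "\<dots> = gcoeff f C" using True by (subst sum.delta) auto
      finally show ?thesis .
    qed (simp add: gcoeff_infinite)
  qed
  show "(f + g) * h = f * h + g * h"
    by (rule grassmann_eqI) (simp add: times_grassmann.rep_eq algebra_simps sum.distrib)
  show "f * (g + h) = f * g + f * h"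
    by (rule grassmann_eqI) (simp add: times_grassmann.rep_eq algebra_simps sum.distrib)
  have "gcoeff (0::('a, 'b) grassmann) {} \<noteq> gcoeff 1 {}"
    by (simp add: one_grassmann_def gconst_def gcoeff_gmonom)
  then show "(0::('a, 'b) grassmann) \<noteq> 1" by metis
qed

end

lemma gcoeff_mult:
  "gcoeff (f * g) C = (\<Sum>A\<in>Pow C. shuffle_sign A (C - A) * gcoeff f A * gcoeff g (C - A))"
  by (simp add: times_grassmann.rep_eq)

lemma gmonom_mult:
  fixes a b :: "'r::comm_ring_1"
  assumes "finite A" "finite B"
  shows "gmonom A a * gmonom B b =
    (if A \<inter> B = {} then gmonom (A \<union> B) (shuffle_sign A B * a * b) else 0)"
proof (rule grassmann_eqI)
  fix C
  have "gcoeff (gmonom A a * gmonom B b) C =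
      (\<Sum>X\<in>Pow C. if X = A then (if C - A = B then shuffle_sign A B * a * b else 0) else 0)"
    unfolding gcoeff_mult by (intro sum.cong refl) (auto simp: gcoeff_gmonom assms)
  also have "\<dots> = (if finite C \<and> A \<subseteq> C \<and> C - A = B then shuffle_sign A B * a * b else 0)"
    by (cases "finite C") (auto simp: sum.delta)
  also have "\<dots> = gcoeff (if A \<inter> B = {} then gmonom (A \<union> B) (shuffle_sign A B * a * b) else 0) C"
    using assms by (auto simp: gcoeff_gmonom)
  finally show "gcoeff (gmonom A a * gmonom B b) C =
    gcoeff (if A \<inter> B = {} then gmonom (A \<union> B) (shuffle_sign A B * a * b) else 0) C" .
qed

lemma gconst_mult_gmonom: "finite A \<Longrightarrow> gconst (c :: 'r::comm_ring_1) * gmonom A d = gmonom A (c * d)"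
  by (simp add: gconst_def gmonom_mult)

lemma gcoeff_gconst_mult [simp]: "gcoeff (gconst (c :: 'r::comm_ring_1) * f) A = c * gcoeff f A"
proof (cases "finite A")
  case True
  have "gcoeff (gconst c * f) A = (\<Sum>B\<in>Pow A. if B = {} then c * gcoeff f A else 0)"
    unfolding gcoeff_mult by (intro sum.cong refl) (auto simp: gconst_def gcoeff_gmonom)
  also have "\<dots> = c * gcoeff f A" using True by (subst sum.delta) auto
  finally show ?thesis .
qed (simp add: gcoeff_infinite)

lemma gconst_add: "gconst (c + d :: 'r::comm_ring_1) = gconst c + gconst d"
  and gconst_mult: "gconst (c * d :: 'r) = gconst c * gconst d"
  by (rule grassmann_eqI; simp add: gconst_def gcoeff_gmonom gmonom_mult)+

definition homogeneous :: "nat \<Rightarrow> ('r::zero, 'o) grassmann \<Rightarrow> bool" where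
  "homogeneous p f \<longleftrightarrow> (\<forall>A. gcoeff f A \<noteq> 0 \<longrightarrow> even (card A + p))"

lemma supercommute:
  fixes f g :: "('r::comm_ring_1, 'o::linorder) grassmann"
  assumes "homogeneous p f" "homogeneous q g"
  shows "f * g = (- 1) ^ (p * q) * (g * f)"
proof (rule grassmann_eqI)
  fix C
  have m: "(- 1) ^ n * h = gconst ((- 1) ^ n) * h" for n and h :: "('r, 'o) grassmann"
  proof -
    have "gconst (- 1) = (- 1 :: ('r, 'o) grassmann)"
      by (rule grassmann_eqI) (simp add: one_grassmann_def gconst_def gcoeff_gmonom)
    then have "gconst ((- 1) ^ n) = (- 1 :: ('r, 'o) grassmann) ^ n"
      by (induction n) (simp_all only: power_Suc power_0 gconst_mult one_grassmann_def[symmetric])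
    then show ?thesis by simp
  qed
  show "gcoeff (f * g) C = gcoeff ((- 1) ^ (p * q) * (g * f)) C"
  proof (cases "finite C")
    case True
    have "gcoeff (f * g) C = (\<Sum>A\<in>Pow C. shuffle_sign (C - A) A * gcoeff f (C - A) * gcoeff g A)"
      unfolding gcoeff_mult
      by (rule sum.reindex_bij_witness[where i = "\<lambda>A. C - A" and j = "\<lambda>A. C - A"])
         (auto simp: double_diff)
    also have "\<dots> = (\<Sum>A\<in>Pow C. (- 1) ^ (p * q) * (shuffle_sign A (C - A) * gcoeff g A * gcoeff f (C - A)))"
    proof (intro sum.cong refl)
      fix A assume "A \<in> Pow C"
      then have fin: "finite A" "finite (C - A)" using True finite_subset by auto
      show "shuffle_sign (C - A) A * gcoeff f (C - A) * gcoeff g A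
        = (- 1) ^ (p * q) * (shuffle_sign A (C - A) * gcoeff g A * gcoeff f (C - A))"
      proof (cases "gcoeff f (C - A) = 0 \<or> gcoeff g A = 0")
        case False
        then have "even (card (C - A) + p)" "even (card A + q)"
          using assms by (auto simp: homogeneous_def)
        then have "(- 1 :: 'r) ^ (card (C - A) * card A) = (- 1) ^ (p * q)"
          by (auto simp: minus_one_power_iff)
        then show ?thesis
          by (subst shuffle_sign_commute[OF fin(2,1)]) (auto simp: mult_ac)
      qed auto
    qed
    also have "\<dots> = (- 1) ^ (p * q) * gcoeff (g * f) C"
      by (simp only: gcoeff_mult sum_distrib_left)
    also have "\<dots> = gcoeff ((- 1) ^ (p * q) * (g * f)) C"
      by (simp only: m gcoeff_gconst_mult)
    finally show ?thesis .
  qed (simp add: gcoeff_infinite)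
qed

lemma homogeneous_theta: "homogeneous 1 (theta x)"
  by (simp add: homogeneous_def theta_def gcoeff_gmonom)

lemma theta_anticommute:
  "theta x * theta y = - (theta y * (theta x :: ('r::comm_ring_1, 'o::linorder) grassmann))"
  by (subst supercommute[OF homogeneous_theta homogeneous_theta]) (simp only: mult_1 power_one_right mult_minus_left)

lemma theta_square: "theta x * (theta x :: ('r::comm_ring_1, 'o::linorder) grassmann) = 0"
  by (simp add: theta_def gmonom_mult)

section \<open>The algebra \<open>S(t\<^sup>-\<^sup>1 gl(1|1)[t\<^sup>-\<^sup>1])\<close>\<close>

text \<open>The symmetric algebra of a superspace is the Grassmann algebra in the odd generators over
  the polynomial ring in the even generators. Matrix indices range over the type \<open>2\<close>, whose two
  elements are written \<open>1\<close> and \<open>2\<close>.\<close>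

type_synonym superalg = "((nat \<Rightarrow>\<^sub>0 nat) \<Rightarrow>\<^sub>0 complex, nat) grassmann"

definition cst :: "complex \<Rightarrow> superalg" where
  "cst c = gconst (Poly_Mapping.single 0 c)"

definition par :: "2 \<Rightarrow> nat" where
  "par i = (if i = 1 then 0 else 1)"

text \<open>The even generators \<open>E\<^sub>i\<^sub>i[-n-1]\<close> and the odd generators \<open>E\<^sub>i\<^sub>j[-n-1]\<close>, \<open>i \<noteq> j\<close>,
  are both numbered by \<open>2n + par i\<close>.\<close>

definition label :: "2 \<Rightarrow> nat \<Rightarrow> nat" where
  "label i n = 2 * n + par i"

text \<open>\<open>E i j m\<close> is the class of \<open>E\<^sub>i\<^sub>j[m]\<close> in \<open>g[t,t\<^sup>-\<^sup>1] / g[t]\<close>.\<close>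

definition E :: "2 \<Rightarrow> 2 \<Rightarrow> int \<Rightarrow> superalg" where
  "E i j m =
    (if m \<ge> 0 then 0
     else if i = j then gconst (Poly_Mapping.single (Poly_Mapping.single (label i (nat (- m - 1))) 1) 1)
     else theta (label i (nat (- m - 1))))"

text \<open>The class of \<open>[E\<^sub>i\<^sub>j[r], E\<^sub>k\<^sub>l[s]]\<close>; terms with \<open>r + s \<ge> 0\<close> vanish by definition of \<open>E\<close>.\<close>

definition ad_E :: "2 \<Rightarrow> 2 \<Rightarrow> int \<Rightarrow> 2 \<Rightarrow> 2 \<Rightarrow> int \<Rightarrow> superalg" where
  "ad_E i j r k l s =
    (if k = j then E i l (r + s) else 0)
    - (if i = l then (- 1) ^ ((par i + par j) * (par k + par l)) * E k j (r + s) else 0)"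

definition superderivation :: "nat \<Rightarrow> (superalg \<Rightarrow> superalg) \<Rightarrow> bool" where
  "superderivation p D \<longleftrightarrow>
    (\<forall>x y. D (x + y) = D x + D y) \<and>
    (\<forall>c x. D (cst c * x) = cst c * D x) \<and>
    (\<forall>q x y. homogeneous q x \<longrightarrow> D (x * y) = D x * y + (- 1) ^ (p * q) * (x * D y))"

text \<open>The action of \<open>E\<^sub>i\<^sub>j[r]\<close> for \<open>r \<ge> 0\<close>; it is well defined by \<open>ex1_act\<close> below.\<close>

definition act :: "2 \<Rightarrow> 2 \<Rightarrow> int \<Rightarrow> superalg \<Rightarrow> superalg" where
  "act i j r = (THE D. superderivation (par i + par j) D \<and>
     (\<forall>k l s. s < 0 \<longrightarrow> D (E k l s) = ad_E i j r k l s))"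

text \<open>Since the \<open>E\<^sub>i\<^sub>j[r]\<close> with \<open>r \<ge> 0\<close> form a basis of \<open>g[t]\<close>, it suffices that they annihilate \<open>P\<close>.\<close>

definition invariants :: "superalg set" where
  "invariants = {P. \<forall>i j r. r \<ge> 0 \<longrightarrow> act i j r P = 0}"

text \<open>The unital complex subalgebra generated by \<open>X\<close>.\<close>

inductive_set algebra_generated :: "superalg set \<Rightarrow> superalg set" for X where
  const: "cst c \<in> algebra_generated X"
| gen: "x \<in> X \<Longrightarrow> x \<in> algebra_generated X"
| add: "x \<in> algebra_generated X \<Longrightarrow> y \<in> algebra_generated X \<Longrightarrow> x + y \<in> algebra_generated X"
| mult: "x \<in> algebra_generated X \<Longrightarrow> y \<in> algebra_generated X \<Longrightarrow> x * y \<in> algebra_generated X"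

definition Ez :: "2 \<Rightarrow> 2 \<Rightarrow> superalg fps" where
  "Ez i j = Abs_fps (\<lambda>r. E i j (- int r - 1))"

definition str :: "'a::ab_group_add ^ 2 ^ 2 \<Rightarrow> 'a" where
  "str X = X $ 1 $ 1 - X $ 2 $ 2"

text \<open>For \<open>k = 1\<close> the truncated exponent \<open>k - 2\<close> is harmless: the coefficient \<open>k - 1\<close> is zero.\<close>

definition series_h :: "nat \<Rightarrow> superalg fps" where
  "series_h k = Ez 1 1 ^ (k - 1) * (Ez 1 1 + Ez 2 2)
     + of_nat (k - 1) * Ez 1 1 ^ (k - 2) * Ez 2 1 * Ez 1 2"

definition series_b :: "nat \<Rightarrow> superalg fps" where
  "series_b k = Ez 2 2 ^ (k - 1) * (Ez 1 1 + Ez 2 2)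
     - of_nat (k - 1) * Ez 2 2 ^ (k - 2) * Ez 2 1 * Ez 1 2"

definition series_s :: "nat \<Rightarrow> superalg fps" where
  "series_s k = str (((**) (vector [vector [Ez 1 1, Ez 1 2],
                                    vector [- Ez 2 1, - Ez 2 2]]) ^^ k) (mat 1))"


subsection \<open>The action is well defined\<close>

lemma shuffle_sign_cases: "shuffle_sign A B = (1::'r::comm_ring_1) \<or> shuffle_sign A B = (- 1::'r)"
proof -
  have *: "(\<Prod>x\<in>X. h x) = 1 \<or> (\<Prod>x\<in>X. h x) = - 1" if "\<And>x. h x = 1 \<or> h x = (- 1::'r)" for X :: "'c set" and h
  proof (induction X rule: infinite_finite_induct)
    case (insert x X)
    then show ?case using that[of x] by auto
  qed simp_all
  show ?thesis unfolding shuffle_sign_def by (intro * ) simp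
qed

lift_definition pdiff :: "nat \<Rightarrow> ((nat \<Rightarrow>\<^sub>0 nat) \<Rightarrow>\<^sub>0 complex) \<Rightarrow> ((nat \<Rightarrow>\<^sub>0 nat) \<Rightarrow>\<^sub>0 complex)"
  is "\<lambda>n p m. of_nat (Poly_Mapping.lookup m n + 1) * p (m + Poly_Mapping.single n 1)"
proof -
  fix n and p :: "(nat \<Rightarrow>\<^sub>0 nat) \<Rightarrow> complex"
  assume "finite {m. p m \<noteq> 0}"
  then have "finite ((\<lambda>m. m + Poly_Mapping.single n 1) -` {m. p m \<noteq> 0})"
    by (rule finite_vimageI) (simp add: inj_def)
  then show "finite {m. of_nat (Poly_Mapping.lookup m n + 1) * p (m + Poly_Mapping.single n 1) \<noteq> 0}"
    by (rule rev_finite_subset) auto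
qed

lemma pdiff_add: "pdiff n (p + q) = pdiff n p + pdiff n q"
  by (rule poly_mapping_eqI) (simp add: pdiff.rep_eq lookup_add algebra_simps)

lemma pdiff_0 [simp]: "pdiff n 0 = 0"
  by (rule poly_mapping_eqI) (simp add: pdiff.rep_eq)

lemma pdiff_uminus: "pdiff n (- p) = - pdiff n p"
  by (rule poly_mapping_eqI) (simp add: pdiff.rep_eq)

lemma pdiff_sum: "pdiff n (sum f X) = (\<Sum>x\<in>X. pdiff n (f x))"
  by (induction X rule: infinite_finite_induct) (simp_all add: pdiff_add)

lemma pdiff_single:
  "pdiff n (Poly_Mapping.single m c) =
    Poly_Mapping.single (m - Poly_Mapping.single n 1) (of_nat (Poly_Mapping.lookup m n) * c)"
proof (rule poly_mapping_eqI)
  fix k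
  show "Poly_Mapping.lookup (pdiff n (Poly_Mapping.single m c)) k =
    Poly_Mapping.lookup (Poly_Mapping.single (m - Poly_Mapping.single n 1) (of_nat (Poly_Mapping.lookup m n) * c)) k"
  proof (cases "Poly_Mapping.lookup m n = 0")
    case True
    then have "m \<noteq> k + Poly_Mapping.single n 1"
      by (auto simp: lookup_add)
    then show ?thesis using True by (simp add: pdiff.rep_eq lookup_single)
  next
    case False
    have "m = k + Poly_Mapping.single n 1 \<longleftrightarrow> m - Poly_Mapping.single n 1 = k"
    proof
      assume "m - Poly_Mapping.single n 1 = k"
      moreover have "m - Poly_Mapping.single n 1 + Poly_Mapping.single n 1 = m"
        by (rule poly_mapping_eqI) (use False in \<open>auto simp: lookup_add lookup_minus lookup_single when_def\<close>)
      ultimately show "m = k + Poly_Mapping.single n 1" by simp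
    qed auto
    moreover have "of_nat (Poly_Mapping.lookup (m - Poly_Mapping.single n 1) n + 1) =
        (of_nat (Poly_Mapping.lookup m n) :: complex)"
      using False by (simp add: lookup_minus)
    ultimately show ?thesis
      by (auto simp: pdiff.rep_eq lookup_single when_def)
  qed
qed

lemma poly_induct:
  assumes "P 0" "\<And>p q. P p \<Longrightarrow> P q \<Longrightarrow> P (p + q)" "\<And>m c. P (Poly_Mapping.single m c)"
  shows "P (p :: 'a \<Rightarrow>\<^sub>0 'b::comm_monoid_add)"
proof (induction p rule: update_induct)
  case const
  show ?case by (rule assms)
next
  case (update f a b)
  have "Poly_Mapping.update a b f = f + Poly_Mapping.single a b"
    using update(1) by (intro poly_mapping_eqI)
      (auto simp: lookup_update lookup_add lookup_single when_def in_keys_iff)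
  then show ?case using assms update by simp
qed

lemma pdiff_single_mult:
  "pdiff n (Poly_Mapping.single k a * Poly_Mapping.single l b) =
    pdiff n (Poly_Mapping.single k a) * Poly_Mapping.single l b +
    Poly_Mapping.single k a * pdiff n (Poly_Mapping.single l b)"
proof -
  let ?e = "Poly_Mapping.single n (1::nat)"
  have 1: "Poly_Mapping.single (k + l - ?e) (of_nat (Poly_Mapping.lookup k n) * c) =
      Poly_Mapping.single ((k - ?e) + l) (of_nat (Poly_Mapping.lookup k n) * c)" for k l and c :: complex
  proof (cases "Poly_Mapping.lookup k n = 0")
    case False
    then have "k + l - ?e = (k - ?e) + l"
      by (intro poly_mapping_eqI) (auto simp: lookup_add lookup_minus lookup_single when_def)
    then show ?thesis by simp
  qed simp
  have "pdiff n (Poly_Mapping.single k a * Poly_Mapping.single l b) =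
    Poly_Mapping.single (k + l - ?e) (of_nat (Poly_Mapping.lookup k n) * (a * b)) +
    Poly_Mapping.single (l + k - ?e) (of_nat (Poly_Mapping.lookup l n) * (a * b))"
    by (simp add: mult_single pdiff_single lookup_add single_add[symmetric] algebra_simps)
  then show ?thesis
    by (simp only: 1) (simp add: pdiff_single mult_single algebra_simps)
qed

lemma pdiff_mult: "pdiff n (p * q) = pdiff n p * q + p * pdiff n q"
proof (induction p rule: poly_induct)
  case (3 m c)
  show ?case
  proof (induction q rule: poly_induct)
    case (3 m c)
    show ?case by (rule pdiff_single_mult)
  qed (simp_all add: algebra_simps pdiff_add)
qed (simp_all add: algebra_simps pdiff_add)

lemma pdiff_shuffle_sign: "pdiff n (shuffle_sign A B * p) = shuffle_sign A B * pdiff n p"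
  using shuffle_sign_cases[of A B, where 'r = "(nat \<Rightarrow>\<^sub>0 nat) \<Rightarrow>\<^sub>0 complex"] by (auto simp: pdiff_uminus)

lift_definition coeff_map :: "('r::zero \<Rightarrow> 's::zero) \<Rightarrow> ('r, 'o) grassmann \<Rightarrow> ('s, 'o) grassmann"
  is "\<lambda>h f A. if f A = 0 then 0 else h (f A)"
proof -
  fix h :: "'r \<Rightarrow> 's" and f :: "'o set \<Rightarrow> 'r"
  assume f: "finite {A. f A \<noteq> 0} \<and> (\<forall>A. f A \<noteq> 0 \<longrightarrow> finite A)"
  have "finite {A. (if f A = 0 then 0 else h (f A)) \<noteq> 0}"
    by (rule finite_subset[of _ "{A. f A \<noteq> 0}"]) (use f in auto)
  then show "finite {A. (if f A = 0 then 0 else h (f A)) \<noteq> 0} \<and>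
      (\<forall>A. (if f A = 0 then 0 else h (f A)) \<noteq> 0 \<longrightarrow> finite A)" using f by auto
qed

definition even_deriv :: "nat \<Rightarrow> superalg \<Rightarrow> superalg" where
  "even_deriv n = coeff_map (pdiff n)"

lemma gcoeff_even_deriv: "gcoeff (even_deriv n f) A = pdiff n (gcoeff f A)"
  by (simp add: even_deriv_def coeff_map.rep_eq)

lift_definition odd_deriv :: "'o::linorder \<Rightarrow> ('r::comm_ring_1, 'o) grassmann \<Rightarrow> ('r, 'o) grassmann"
  is "\<lambda>x f A. if x \<in> A then 0 else shuffle_sign {x} A * f (insert x A)"
proof -
  fix x :: 'o and f :: "'o set \<Rightarrow> 'r"
  assume f: "finite {A. f A \<noteq> 0} \<and> (\<forall>A. f A \<noteq> 0 \<longrightarrow> finite A)"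
  let ?h = "\<lambda>A. if x \<in> A then 0 else shuffle_sign {x} A * f (insert x A)"
  have "A \<in> (\<lambda>B. B - {x}) ` {A. f A \<noteq> 0}" if "?h A \<noteq> 0" for A
    using that by (intro image_eqI[of _ _ "insert x A"]) (auto split: if_splits)
  then have "{A. ?h A \<noteq> 0} \<subseteq> (\<lambda>B. B - {x}) ` {A. f A \<noteq> 0}" by blast
  then have "finite {A. ?h A \<noteq> 0}"
    by (rule finite_subset) (use f in simp)
  moreover have "finite A" if "?h A \<noteq> 0" for A
  proof -
    have "f (insert x A) \<noteq> 0" using that by (auto split: if_splits)
    then show ?thesis using f by (metis finite_insert)
  qed
  ultimately show "finite {A. ?h A \<noteq> 0} \<and> (\<forall>A. ?h A \<noteq> 0 \<longrightarrow> finite A)" by blast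
qed

lemma even_deriv_add: "even_deriv n (f + g) = even_deriv n f + even_deriv n g"
  by (rule grassmann_eqI) (simp add: gcoeff_even_deriv pdiff_add)

lemma odd_deriv_add: "odd_deriv n (f + g) = odd_deriv n f + odd_deriv n g"
  by (rule grassmann_eqI) (simp add: odd_deriv.rep_eq algebra_simps)

lemma even_deriv_mult: "even_deriv n (f * g) = even_deriv n f * g + f * even_deriv n g"
proof (rule grassmann_eqI)
  fix C
  have "gcoeff (even_deriv n (f * g)) C =
      (\<Sum>A\<in>Pow C. shuffle_sign A (C - A) * pdiff n (gcoeff f A * gcoeff g (C - A)))"
    unfolding gcoeff_even_deriv gcoeff_mult pdiff_sum mult.assoc pdiff_shuffle_sign ..
  then show "gcoeff (even_deriv n (f * g)) C = gcoeff (even_deriv n f * g + f * even_deriv n g) C"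
    unfolding gcoeff_add gcoeff_mult gcoeff_even_deriv pdiff_mult mult.assoc
      sum.distrib distrib_left .
qed

lemma gcoeff_minus_one_power_mult [simp]:
  "gcoeff ((- 1) ^ n * f) A = (- 1) ^ n * gcoeff (f :: ('r::comm_ring_1, 'o::linorder) grassmann) A"
  by (induction n) simp_all

lemma odd_deriv_mult:
  fixes f g :: "('r::comm_ring_1, 'o::linorder) grassmann"
  assumes f: "homogeneous q f"
  shows "odd_deriv x (f * g) = odd_deriv x f * g + (- 1) ^ q * (f * odd_deriv x g)"
proof (rule grassmann_eqI)
  fix C
  let ?R = "odd_deriv x f * g + (- 1) ^ q * (f * odd_deriv x g)"
  let ?s = "shuffle_sign :: 'o set \<Rightarrow> 'o set \<Rightarrow> 'r"
  have sq: "(- 1) ^ q * gcoeff f A = (- 1) ^ card A * gcoeff f A" for A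
    using f by (cases "gcoeff f A = 0") (auto simp: homogeneous_def minus_one_power_iff)
  have R: "gcoeff ?R C = (\<Sum>A\<in>Pow C. ?s A (C - A) * gcoeff (odd_deriv x f) A * gcoeff g (C - A))
      + (\<Sum>A\<in>Pow C. ?s A (C - A) * ((- 1) ^ card A * gcoeff f A) * gcoeff (odd_deriv x g) (C - A))"
    unfolding gcoeff_add gcoeff_minus_one_power_mult
    unfolding gcoeff_mult sum_distrib_left sq[symmetric] by (simp add: mult_ac)
  have swap: "?s A {x} = (- 1) ^ card A * ?s {x} A" if "finite A" "x \<notin> A" for A
    using shuffle_sign_commute[of A "{x}"] that by auto
  have sqr: "?s X Y * (?s X Y * z) = z" for X Y z
    by (simp add: mult.assoc[symmetric])
  have msq: "(- 1) ^ n * ((- 1) ^ n * (z :: 'r)) = z" for n z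
    by (simp add: mult.assoc[symmetric] power_add[symmetric])
  show "gcoeff (odd_deriv x (f * g)) C = gcoeff ?R C"
  proof (cases "finite C")
    case fin: True
    have fs: "finite A" if "A \<subseteq> C" for A using that fin finite_subset by blast
    show ?thesis
    proof (cases "x \<in> C")
      case False
      have "gcoeff (odd_deriv x (f * g)) C =
          (\<Sum>A\<in>Pow (insert x C). ?s {x} C * (?s A (insert x C - A) * gcoeff f A * gcoeff g (insert x C - A)))"
        using False by (simp add: odd_deriv.rep_eq gcoeff_mult sum_distrib_left)
      also have "\<dots> = (\<Sum>A\<in>Pow C. ?s {x} C * (?s A (insert x C - A) * gcoeff f A * gcoeff g (insert x C - A)))
         + (\<Sum>A\<in>insert x ` Pow C. ?s {x} C * (?s A (insert x C - A) * gcoeff f A * gcoeff g (insert x C - A)))"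
        unfolding Pow_insert by (rule sum.union_disjoint) (use fin False in auto)
      also have "(\<Sum>A\<in>insert x ` Pow C. ?s {x} C * (?s A (insert x C - A) * gcoeff f A * gcoeff g (insert x C - A)))
        = (\<Sum>A\<in>Pow C. ?s A (C - A) * gcoeff (odd_deriv x f) A * gcoeff g (C - A))"
      proof (rule sum.reindex_cong[of "insert x"])
        show "inj_on (insert x) (Pow C)" using False by (auto simp: inj_on_def)
        fix A assume "A \<in> Pow C"
        then have A: "A \<subseteq> C" "x \<notin> A" using False by auto
        have e: "insert x C - insert x A = C - A" using A False by auto
        have 1: "?s {x} C = ?s {x} A * ?s {x} (C - A)"
          using shuffle_sign_Un2[of A "C - A" "{x}"] A fs[of A] fin by (simp add: Un_absorb1)
        have 2: "?s (insert x A) (C - A) = ?s {x} (C - A) * ?s A (C - A)"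
          using shuffle_sign_Un1[of "{x}" A "C - A"] A fs[of A] by simp
        show "?s {x} C * (?s (insert x A) (insert x C - insert x A) * gcoeff f (insert x A) * gcoeff g (insert x C - insert x A))
          = ?s A (C - A) * gcoeff (odd_deriv x f) A * gcoeff g (C - A)"
          unfolding e 1 2 using A by (simp add: odd_deriv.rep_eq mult_ac sqr)
      qed simp
      also have "(\<Sum>A\<in>Pow C. ?s {x} C * (?s A (insert x C - A) * gcoeff f A * gcoeff g (insert x C - A)))
        = (\<Sum>A\<in>Pow C. ?s A (C - A) * ((- 1) ^ card A * gcoeff f A) * gcoeff (odd_deriv x g) (C - A))"
      proof (intro sum.cong refl)
        fix A assume "A \<in> Pow C"
        then have A: "A \<subseteq> C" "x \<notin> A" using False by auto
        have e: "insert x C - A = insert x (C - A)" using A by auto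
        have 1: "?s {x} C = ?s {x} A * ?s {x} (C - A)"
          using shuffle_sign_Un2[of A "C - A" "{x}"] A fs[of A] fin by (simp add: Un_absorb1)
        have 2: "?s A (insert x (C - A)) = (- 1) ^ card A * ?s {x} A * ?s A (C - A)"
          using shuffle_sign_Un2[of "{x}" "C - A" A, where 'r = 'r] A fs[of A] fin False swap[of A] by simp
        show "?s {x} C * (?s A (insert x C - A) * gcoeff f A * gcoeff g (insert x C - A))
          = ?s A (C - A) * ((- 1) ^ card A * gcoeff f A) * gcoeff (odd_deriv x g) (C - A)"
          unfolding e 1 2 using A False by (simp add: odd_deriv.rep_eq mult_ac sqr)
      qed
      finally show ?thesis unfolding R by (simp only: add.commute)
    next
      case True
      define B where "B = C - {x}"
      have B: "C = insert x B" "x \<notin> B" "finite B" using True fin by (auto simp: B_def)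
      have fsB: "finite A" if "A \<subseteq> B" for A using that B finite_subset by blast
      have PC: "sum h (Pow C) = sum h (Pow B) + (\<Sum>A\<in>Pow B. h (insert x A))"
        for h :: "'o set \<Rightarrow> 'r"
      proof -
        have "sum h (Pow C) = sum h (Pow B) + sum h (insert x ` Pow B)"
          unfolding B(1) Pow_insert by (rule sum.union_disjoint) (use B in auto)
        also have "sum h (insert x ` Pow B) = (\<Sum>A\<in>Pow B. h (insert x A))"
          by (rule sum.reindex_cong[of "insert x"]) (use B in \<open>auto simp: inj_on_def\<close>)
        finally show ?thesis .
      qed
      have "gcoeff ?R C = (\<Sum>A\<in>Pow B. ?s A (C - A) * gcoeff (odd_deriv x f) A * gcoeff g (C - A))
        + (\<Sum>A\<in>Pow B. ?s (insert x A) (C - insert x A) * ((- 1) ^ card (insert x A) * gcoeff f (insert x A)) *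
              gcoeff (odd_deriv x g) (C - insert x A))"
      proof -
        have 1: "(\<Sum>A\<in>Pow B. ?s (insert x A) (C - insert x A) * gcoeff (odd_deriv x f) (insert x A) * gcoeff g (C - insert x A)) = 0"
          by (intro sum.neutral) (simp add: odd_deriv.rep_eq)
        have 2: "(\<Sum>A\<in>Pow B. ?s A (C - A) * ((- 1) ^ card A * gcoeff f A) * gcoeff (odd_deriv x g) (C - A)) = 0"
          by (intro sum.neutral) (use B in \<open>auto simp: odd_deriv.rep_eq\<close>)
        show ?thesis unfolding R PC 1 2 by simp
      qed
      also have "\<dots> = 0"
        unfolding sum.distrib[symmetric]
      proof (intro sum.neutral ballI)
        fix A assume "A \<in> Pow B"
        then have A: "A \<subseteq> B" "x \<notin> A" "finite A" using B fsB by auto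
        have e: "C - A = insert x (B - A)" "C - insert x A = B - A" using A B by auto
        have 1: "?s A (insert x (B - A)) = (- 1) ^ card A * ?s {x} A * ?s A (B - A)"
          using shuffle_sign_Un2[of "{x}" "B - A" A, where 'r = 'r] A B swap[of A] by simp
        have 2: "?s (insert x A) (B - A) = ?s {x} (B - A) * ?s A (B - A)"
          using shuffle_sign_Un1[of "{x}" A "B - A"] A by simp
        show "?s A (C - A) * gcoeff (odd_deriv x f) A * gcoeff g (C - A) +
          ?s (insert x A) (C - insert x A) * ((- 1) ^ card (insert x A) * gcoeff f (insert x A)) *
              gcoeff (odd_deriv x g) (C - insert x A) = 0"
          unfolding e 1 2 using A B by (simp add: odd_deriv.rep_eq mult_ac sqr)
      qed
      finally show ?thesis using True by (simp add: odd_deriv.rep_eq)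
    qed
  qed (simp add: gcoeff_infinite)
qed

lemma homogeneous_0 [simp]: "homogeneous p 0"
  by (simp add: homogeneous_def)

lemma homogeneous_diff: "homogeneous p f \<Longrightarrow> homogeneous p g \<Longrightarrow> homogeneous p (f - g)"
  by (metis (no_types, lifting) homogeneous_def gcoeff_minus diff_0_right)

lemma homogeneous_sign:
  "homogeneous p f \<Longrightarrow> homogeneous p ((- 1) ^ n * (f :: ('r::comm_ring_1, 'o::linorder) grassmann))"
  unfolding homogeneous_def by (metis gcoeff_minus_one_power_mult mult_zero_right)

lemma homogeneous_cong: "even (p + q) \<Longrightarrow> homogeneous p f \<Longrightarrow> homogeneous q f"
  by (auto simp: homogeneous_def)

lemma homogeneous_cst: "homogeneous 0 (cst c)"
  by (simp add: homogeneous_def cst_def gconst_def gcoeff_gmonom)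

lemma par_cases: "i = 1 \<and> par i = 0 \<or> i = 2 \<and> par i = 1"
  using exhaust_2[of i] by (auto simp: par_def)

lemma homogeneous_E: "homogeneous (par i + par j) (E i j m)"
  using par_cases[of i] par_cases[of j]
  by (auto simp: E_def homogeneous_def gconst_def theta_def gcoeff_gmonom)

lemma homogeneous_ad_E: "homogeneous (par i + par j + (par k + par l)) (ad_E i j r k l s)"
  unfolding ad_E_def
proof (intro homogeneous_diff)
  show "homogeneous (par i + par j + (par k + par l)) (if k = j then E i l (r + s) else 0)"
  proof (cases "k = j")
    case True
    have "even (par i + par l + (par i + par j + (par j + par l)))" by simp argo
    then show ?thesis using True homogeneous_cong[OF _ homogeneous_E] by simp
  qed simp
  show "homogeneous (par i + par j + (par k + par l))
    (if i = l then (- 1) ^ ((par i + par j) * (par k + par l)) * E k j (r + s) else 0)"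
  proof (cases "i = l")
    case True
    have "even (par k + par j + (par l + par j + (par k + par l)))" by simp argo
    then show ?thesis using True homogeneous_cong[OF _ homogeneous_sign[OF homogeneous_E]] by simp
  qed simp
qed

lemma finite_even_deriv: "finite {n. even_deriv n f \<noteq> 0}"
proof (rule finite_subset)
  show "{n. even_deriv n f \<noteq> 0} \<subseteq>
    (\<Union>A\<in>{A. gcoeff f A \<noteq> 0}. \<Union>m\<in>Poly_Mapping.keys (gcoeff f A). Poly_Mapping.keys m)"
  proof
    fix n assume "n \<in> {n. even_deriv n f \<noteq> 0}"
    then obtain A where A: "pdiff n (gcoeff f A) \<noteq> 0"
      using grassmann_eqI[of "even_deriv n f" 0] by (auto simp: gcoeff_even_deriv)
    then obtain m where "Poly_Mapping.lookup (pdiff n (gcoeff f A)) m \<noteq> 0"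
      using poly_mapping_eqI[of "pdiff n (gcoeff f A)" 0] by auto
    then have "m + Poly_Mapping.single n 1 \<in> Poly_Mapping.keys (gcoeff f A)"
      by (simp add: pdiff.rep_eq in_keys_iff)
    moreover have "n \<in> Poly_Mapping.keys (m + Poly_Mapping.single n 1)"
      by (simp add: in_keys_iff lookup_add)
    moreover have "gcoeff f A \<noteq> 0" using A by auto
    ultimately show "n \<in> (\<Union>A\<in>{A. gcoeff f A \<noteq> 0}. \<Union>m\<in>Poly_Mapping.keys (gcoeff f A). Poly_Mapping.keys m)"
      by blast
  qed
qed (simp add: finite_gcoeff)

lemma finite_odd_deriv: "finite {n. odd_deriv n f \<noteq> 0}"
proof (rule finite_subset)
  show "{n. odd_deriv n f \<noteq> 0} \<subseteq> \<Union> {A. gcoeff f A \<noteq> 0}"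
  proof
    fix n assume "n \<in> {n. odd_deriv n f \<noteq> 0}"
    then obtain A where "gcoeff (odd_deriv n f) A \<noteq> 0"
      using grassmann_eqI[of "odd_deriv n f" 0] by auto
    then have "gcoeff f (insert n A) \<noteq> 0"
      by (auto simp: odd_deriv.rep_eq split: if_splits)
    then show "n \<in> \<Union> {A. gcoeff f A \<noteq> 0}" by blast
  qed
qed (use finite_gcoeff gcoeff_infinite in blast)

definition derivation_of :: "(nat \<Rightarrow> superalg) \<Rightarrow> (nat \<Rightarrow> superalg) \<Rightarrow> superalg \<Rightarrow> superalg" where
  "derivation_of u v f =
    (\<Sum>n | even_deriv n f \<noteq> 0 \<or> odd_deriv n f \<noteq> 0. u n * even_deriv n f + v n * odd_deriv n f)"

lemma finite_deriv: "finite {n. even_deriv n f \<noteq> 0 \<or> odd_deriv n f \<noteq> 0}"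
  unfolding Collect_disj_eq using finite_even_deriv[of f] finite_odd_deriv[of f] by (rule finite_UnI)

lemma derivation_of_eq:
  assumes "finite N" "{n. even_deriv n f \<noteq> 0 \<or> odd_deriv n f \<noteq> 0} \<subseteq> N"
  shows "derivation_of u v f = (\<Sum>n\<in>N. u n * even_deriv n f + v n * odd_deriv n f)"
  unfolding derivation_of_def by (rule sum.mono_neutral_left) (use assms in auto)

lemma derivation_of_add: "derivation_of u v (f + g) = derivation_of u v f + derivation_of u v g"
proof -
  define N where "N = {n. even_deriv n f \<noteq> 0 \<or> odd_deriv n f \<noteq> 0} \<union> {n. even_deriv n g \<noteq> 0 \<or> odd_deriv n g \<noteq> 0}"
  have N: "finite N" unfolding N_def using finite_deriv by blast
  have s: "{n. even_deriv n f \<noteq> 0 \<or> odd_deriv n f \<noteq> 0} \<subseteq> N" "{n. even_deriv n g \<noteq> 0 \<or> odd_deriv n g \<noteq> 0} \<subseteq> N"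
    "{n. even_deriv n (f + g) \<noteq> 0 \<or> odd_deriv n (f + g) \<noteq> 0} \<subseteq> N"
    by (auto simp: N_def even_deriv_add odd_deriv_add)
  show ?thesis
    unfolding derivation_of_eq[OF N s(1)] derivation_of_eq[OF N s(2)] derivation_of_eq[OF N s(3)]
      even_deriv_add odd_deriv_add sum.distrib[symmetric]
    by (intro sum.cong refl) (simp add: algebra_simps)
qed

lemma derivation_of_mult:
  assumes u: "\<And>n. homogeneous p (u n)" and v: "\<And>n. homogeneous (Suc p) (v n)"
    and f: "homogeneous q f"
  shows "derivation_of u v (f * g) =
    derivation_of u v f * g + (- 1) ^ (p * q) * (f * derivation_of u v g)"
proof -
  define N where "N = {n. even_deriv n f \<noteq> 0 \<or> odd_deriv n f \<noteq> 0} \<union> {n. even_deriv n g \<noteq> 0 \<or> odd_deriv n g \<noteq> 0}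
    \<union> {n. even_deriv n (f * g) \<noteq> 0 \<or> odd_deriv n (f * g) \<noteq> 0}"
  have N: "finite N" unfolding N_def using finite_deriv by blast
  have s: "{n. even_deriv n f \<noteq> 0 \<or> odd_deriv n f \<noteq> 0} \<subseteq> N" "{n. even_deriv n g \<noteq> 0 \<or> odd_deriv n g \<noteq> 0} \<subseteq> N"
    "{n. even_deriv n (f * g) \<noteq> 0 \<or> odd_deriv n (f * g) \<noteq> 0} \<subseteq> N"
    by (auto simp: N_def)
  have "u n * even_deriv n (f * g) + v n * odd_deriv n (f * g) =
      (u n * even_deriv n f + v n * odd_deriv n f) * g +
      (- 1) ^ (p * q) * (f * (u n * even_deriv n g + v n * odd_deriv n g))" for n
  proof -
    have 1: "u n * (f * h) = (- 1) ^ (p * q) * (f * (u n * h))" for h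
      using arg_cong[OF supercommute[OF u[of n] f], of "\<lambda>z. z * h"] by (simp only: mult.assoc)
    have 2: "v n * (f * h) = (- 1) ^ (Suc p * q) * (f * (v n * h))" for h
      using arg_cong[OF supercommute[OF v[of n] f], of "\<lambda>z. z * h"] by (simp only: mult.assoc)
    have 3: "v n * ((- 1) ^ q * h) = (- 1) ^ q * (v n * h)" for h
      by (cases "even q") simp_all
    have 4: "(- 1) ^ q * ((- 1) ^ (Suc p * q) * h) = (- 1) ^ (p * q) * h" for h :: superalg
      by (cases "even q") (simp_all add: power_add)
    show ?thesis
      unfolding even_deriv_mult odd_deriv_mult[OF f] distrib_left distrib_right 1 3 2 4
      by (simp add: mult.assoc add_ac)
  qed
  then show ?thesis
    unfolding derivation_of_eq[OF N s(1)] derivation_of_eq[OF N s(2)] derivation_of_eq[OF N s(3)]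
      sum_distrib_left sum_distrib_right sum.distrib[symmetric] by simp
qed

lemma superderivation_derivation_of:
  assumes "\<And>n. homogeneous p (u n)" and "\<And>n. homogeneous (Suc p) (v n)"
  shows "superderivation p (derivation_of u v)"
proof -
  have "even_deriv n (cst c) = 0" for n c
    by (rule grassmann_eqI)
       (simp add: gcoeff_even_deriv cst_def gconst_def gcoeff_gmonom pdiff_single)
  moreover have "odd_deriv n (cst c) = 0" for n c
    by (rule grassmann_eqI) (simp add: odd_deriv.rep_eq cst_def gconst_def gcoeff_gmonom)
  ultimately have "derivation_of u v (cst c) = 0" for c
    by (simp add: derivation_of_def)
  then show ?thesis
    unfolding superderivation_def
    using derivation_of_add derivation_of_mult[OF assms] derivation_of_mult[OF assms homogeneous_cst]
    by (simp del: mult_minus1)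
qed

lemma derivation_of_even:
  "derivation_of u v (gconst (Poly_Mapping.single (Poly_Mapping.single n 1) 1)) = u n"
proof -
  let ?f = "gconst (Poly_Mapping.single (Poly_Mapping.single n 1) 1) :: superalg"
  have e: "even_deriv k ?f = (if k = n then 1 else 0)" for k
    by (rule grassmann_eqI)
       (auto simp: gcoeff_even_deriv one_grassmann_def gconst_def gcoeff_gmonom pdiff_single lookup_single when_def)
  have o: "odd_deriv k ?f = 0" for k
    by (rule grassmann_eqI) (simp add: odd_deriv.rep_eq gconst_def gcoeff_gmonom)
  show ?thesis
    by (subst derivation_of_eq[of "{n}"]) (use e o in auto)
qed

lemma derivation_of_odd: "derivation_of u v (theta n) = v n"
proof -
  let ?f = "theta n :: superalg"
  have e: "even_deriv k ?f = 0" for k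
    using pdiff_single[of k 0 1]
    by (intro grassmann_eqI) (simp add: gcoeff_even_deriv theta_def gcoeff_gmonom)
  have o: "odd_deriv k ?f = (if k = n then 1 else 0)" for k
  proof (rule grassmann_eqI)
    fix A
    have "insert k A = {n} \<and> k \<notin> A \<longleftrightarrow> k = n \<and> A = {}" by auto
    then show "gcoeff (odd_deriv k ?f) A = gcoeff (if k = n then 1 else 0) A"
      by (auto simp: odd_deriv.rep_eq theta_def one_grassmann_def gconst_def gcoeff_gmonom)
  qed
  show ?thesis
    by (subst derivation_of_eq[of "{n}"]) (use e o in auto)
qed

lemma ex_act:
  "\<exists>D. superderivation (par i + par j) D \<and> (\<forall>k l s. s < 0 \<longrightarrow> D (E k l s) = ad_E i j r k l s)"
proof -
  define row :: "nat \<Rightarrow> 2" where "row n = (if even n then 1 else 2)" for n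
  define col :: "nat \<Rightarrow> 2" where "col n = (if even n then 2 else 1)" for n
  define u where "u n = ad_E i j r (row n) (row n) (- int (n div 2) - 1)" for n
  define v where "v n = ad_E i j r (row n) (col n) (- int (n div 2) - 1)" for n
  let ?D = "derivation_of u v"
  have "homogeneous (par i + par j) (u n)" for n
    unfolding u_def by (rule homogeneous_cong[OF _ homogeneous_ad_E]) simp
  moreover have "homogeneous (Suc (par i + par j)) (v n)" for n
    unfolding v_def by (rule homogeneous_cong[OF _ homogeneous_ad_E]) (simp add: row_def col_def par_def)
  ultimately have "superderivation (par i + par j) ?D"
    by (rule superderivation_derivation_of)
  moreover have "?D (E k l s) = ad_E i j r k l s" if "s < 0" for k l s
  proof -
    have lab: "row (label k m) = k" "label k m div 2 = m" for m
      using par_cases[of k] by (auto simp: row_def label_def)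
    have s: "- int (nat (- s - 1)) - 1 = s" using that by simp
    show ?thesis
    proof (cases "k = l")
      case True
      then have "?D (E k l s) = u (label k (nat (- s - 1)))"
        using that derivation_of_even[of u v] by (simp add: E_def)
      then show ?thesis using True[symmetric] s by (simp only: u_def lab)
    next
      case False
      then have "?D (E k l s) = v (label k (nat (- s - 1)))"
        using that by (simp add: E_def derivation_of_odd)
      moreover have "col (label k m) = l" for m
        using False par_cases[of k] par_cases[of l] by (auto simp: col_def label_def)
      ultimately show ?thesis using s by (simp only: v_def lab)
    qed
  qed
  ultimately show ?thesis by (intro exI[of _ ?D] conjI allI impI)
qed

lemma cst_1 [simp]: "cst 1 = 1"
  by (simp add: cst_def one_grassmann_def)

lemma even_gen: "\<exists>i s. s < 0 \<and> gconst (Poly_Mapping.single (Poly_Mapping.single n 1) 1) = E i i s"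
proof (cases "even n")
  case True
  then show ?thesis
    by (intro exI[of _ 1] exI[of _ "- int (n div 2) - 1"]) (simp add: E_def label_def par_def)
next
  case False
  then show ?thesis
    by (intro exI[of _ 2] exI[of _ "- int (n div 2) - 1"]) (simp add: E_def label_def par_def)
qed

lemma odd_gen: "\<exists>i j s. s < 0 \<and> theta n = E i j s"
proof (cases "even n")
  case True
  then show ?thesis
    by (intro exI[of _ 1] exI[of _ 2] exI[of _ "- int (n div 2) - 1"]) (simp add: E_def label_def par_def)
next
  case False
  then show ?thesis
    by (intro exI[of _ 2] exI[of _ 1] exI[of _ "- int (n div 2) - 1"]) (simp add: E_def label_def par_def)
qed

lemma superalg_induct [case_names one add cst gen]:
  assumes one: "P 1"
    and add: "\<And>f g. P f \<Longrightarrow> P g \<Longrightarrow> P (f + g)"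
    and cst: "\<And>c f. P f \<Longrightarrow> P (cst c * f)"
    and gen: "\<And>i j s f. s < 0 \<Longrightarrow> P f \<Longrightarrow> P (E i j s * f)"
  shows "P f"
proof -
  have zero: "P 0"
  proof -
    have "cst 0 * 1 = 0" by (rule grassmann_eqI) (simp add: cst_def gconst_def gcoeff_gmonom)
    then show ?thesis using cst[OF one, of 0] by simp
  qed
  have 1: "gmonom {} (Poly_Mapping.single 0 1) = (1 :: superalg)"
    by (simp add: one_grassmann_def gconst_def)
  have mono_mult: "P (gmonom {} (Poly_Mapping.single m 1) * f)" if "P f" for m f
    using that
  proof (induction m arbitrary: f rule: poly_induct)
    case 1
    then show ?case by (simp only: \<open>gmonom {} (Poly_Mapping.single 0 1) = 1\<close> mult_1)
  next
    case (2 p q)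
    have "gmonom {} (Poly_Mapping.single (p + q) 1) =
      gmonom {} (Poly_Mapping.single p 1) * (gmonom {} (Poly_Mapping.single q 1) :: superalg)"
      by (simp add: gmonom_mult mult_single)
    then show ?case using 2 by (simp add: mult.assoc)
  next
    case (3 n c)
    show ?case
    proof (induction c)
      case 0
      then show ?case using \<open>P f\<close> by (simp only: 1 single_zero mult_1)
    next
      case (Suc c)
      have "gmonom {} (Poly_Mapping.single (Poly_Mapping.single n (Suc c)) 1) =
        gconst (Poly_Mapping.single (Poly_Mapping.single n 1) 1) *
          (gmonom {} (Poly_Mapping.single (Poly_Mapping.single n c) 1) :: superalg)"
        by (simp add: gconst_def gmonom_mult mult_single single_add[symmetric])
      moreover obtain i s where "s < 0" "gconst (Poly_Mapping.single (Poly_Mapping.single n 1) 1) = E i i s"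
        using even_gen by blast
      ultimately show ?case using gen[OF _ Suc] by (simp only: mult.assoc)
    qed
  qed
  have mono: "P (gmonom {} (Poly_Mapping.single m 1))" for m
    using mono_mult[OF one] by simp
  have gm0: "P (gmonom {} c)" for c
  proof (induction c rule: poly_induct)
    case (3 m c)
    have "gmonom {} (Poly_Mapping.single m c) = cst c * gmonom {} (Poly_Mapping.single m 1)"
      by (simp add: cst_def gconst_mult_gmonom mult_single)
    then show ?case using cst mono by simp
  next
    case 1
    have "gmonom {} 0 = (0 :: superalg)" by (rule grassmann_eqI) (simp add: gcoeff_gmonom)
    then show ?case using zero by simp
  next
    case (2 p q)
    have "gmonom {} (p + q) = gmonom {} p + (gmonom {} q :: superalg)"
      by (fold gconst_def) (rule gconst_add)
    with 2 show ?case using add by simp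
  qed
  have gm: "P (gmonom A c)" if "finite A" for A c
    using that
  proof (induction A arbitrary: c rule: finite_induct)
    case empty
    show ?case by (rule gm0)
  next
    case (insert x A)
    let ?s = "shuffle_sign {x} A :: (nat \<Rightarrow>\<^sub>0 nat) \<Rightarrow>\<^sub>0 complex"
    have "theta x * gmonom A (?s * c) = gmonom (insert x A) c"
      using insert by (simp add: theta_def gmonom_mult mult.assoc[symmetric])
    moreover obtain i j s where "s < 0" "theta x = E i j s"
      using odd_gen by blast
    ultimately show ?case using gen[OF _ insert.IH] by metis
  qed
  have "P (\<Sum>A\<in>X. gmonom A (gcoeff f A))" if "finite X" "\<forall>A\<in>X. finite A" for X
    using that by (induction X rule: finite_induct) (auto intro: zero add gm)
  from this[of "{A. gcoeff f A \<noteq> 0}"] have "P (\<Sum>A | gcoeff f A \<noteq> 0. gmonom A (gcoeff f A))"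
    using finite_gcoeff[of f] gcoeff_infinite by blast
  moreover have "f = (\<Sum>A | gcoeff f A \<noteq> 0. gmonom A (gcoeff f A))"
  proof (rule grassmann_eqI)
    fix B
    have "gcoeff (\<Sum>A | gcoeff f A \<noteq> 0. gmonom A (gcoeff f A)) B =
        (\<Sum>A | gcoeff f A \<noteq> 0. if A = B then gcoeff f B else 0)"
      unfolding gcoeff_sum by (intro sum.cong refl) (use gcoeff_infinite in \<open>auto simp: gcoeff_gmonom\<close>)
    also have "\<dots> = gcoeff f B"
      using finite_gcoeff[of f] by simp
    finally show "gcoeff f B = gcoeff (\<Sum>A | gcoeff f A \<noteq> 0. gmonom A (gcoeff f A)) B" ..
  qed
  ultimately show "P f" by simp
qed

theorem ex1_act:
  "\<exists>!D. superderivation (par i + par j) D \<and> (\<forall>k l s. s < 0 \<longrightarrow> D (E k l s) = ad_E i j r k l s)"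
proof (rule ex_ex1I[OF ex_act])
  fix D D'
  assume D: "superderivation (par i + par j) D \<and> (\<forall>k l s. s < 0 \<longrightarrow> D (E k l s) = ad_E i j r k l s)"
    and D': "superderivation (par i + par j) D' \<and> (\<forall>k l s. s < 0 \<longrightarrow> D' (E k l s) = ad_E i j r k l s)"
  have D_one: "H 1 = 0" if "superderivation p H" for H p
  proof -
    have "H (1 * 1) = H 1 * 1 + (- 1) ^ (p * 0) * (1 * H 1)"
      by (intro that[unfolded superderivation_def, THEN conjunct2, THEN conjunct2, rule_format])
         (use homogeneous_cst[of 1] in simp)
    then show ?thesis by simp
  qed
  have genD: "H (E k l s * f) = H (E k l s) * f + (- 1) ^ (p * (par k + par l)) * (E k l s * H f)"
    if "superderivation p H" for H p k l s f
    by (intro that[unfolded superderivation_def, THEN conjunct2, THEN conjunct2, rule_format] homogeneous_E)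
  show "D = D'"
  proof
    fix f
    show "D f = D' f"
    proof (induction f rule: superalg_induct)
      case one
      then show ?case using D_one[OF conjunct1[OF D]] D_one[OF conjunct1[OF D']] by simp
    next
      case (add f g)
      then show ?case using D D' by (simp add: superderivation_def)
    next
      case (cst c f)
      then show ?case using D D' by (simp add: superderivation_def)
    next
      case (gen k l s f)
      then show ?case
        unfolding genD[OF conjunct1[OF D]] genD[OF conjunct1[OF D']] using D D' by simp
    qed
  qed
qed

lemma superderivation_act: "superderivation (par i + par j) (act i j r)"
  using theI'[OF ex1_act[of i j r]] unfolding act_def[symmetric] by (rule conjunct1)

lemma act_E: "s < 0 \<Longrightarrow> act i j r (E k l s) = ad_E i j r k l s"
  using theI'[OF ex1_act[of i j r]] unfolding act_def[symmetric] by simp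

end

theory Submission
  imports Defs
begin

text \<open>Write \<open>x(z) = E\<^sub>1\<^sub>1(z)\<close>, \<open>y(z) = E\<^sub>2\<^sub>2(z)\<close>, \<open>c = x + y\<close>, \<open>\<theta>(z) = E\<^sub>1\<^sub>2(z)\<close>, \<open>\<eta>(z) = E\<^sub>2\<^sub>1(z)\<close>.
Because brackets are truncated at \<open>t\<^sup>0\<close>, the element \<open>E\<^sub>i\<^sub>j[r]\<close> acts on these series as \<open>z\<^sup>r\<close>
times the bracket of \<open>gl(1|1)\<close>. So \<open>E\<^sub>1\<^sub>2[r]\<close> sends \<open>x\<close>, \<open>y\<close>, \<open>\<eta>\<close>, \<open>\<theta>\<close> to
\<open>-z\<^sup>r \<theta>\<close>, \<open>z\<^sup>r \<theta>\<close>, \<open>z\<^sup>r c\<close>, \<open>0\<close>, and symmetrically for \<open>E\<^sub>2\<^sub>1[r]\<close>.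

Invariance. If \<open>a\<close>, \<open>b\<close> are polynomials in \<open>x\<close>, \<open>y\<close> with \<open>(\<partial>\<^sub>x - \<partial>\<^sub>y) a = b c\<close>, then the contributions
of \<open>a\<close> and of \<open>\<eta>\<theta>\<close> cancel and \<open>a + b \<eta> \<theta>\<close> is annihilated by \<open>g[t]\<close>
(\<open>invariant_series\<close>). All three families have this shape.

Reduction to commuting variables. Call the part of \<open>P\<close> without odd generators its body. An
invariant with body \<open>0\<close> is \<open>0\<close> (\<open>invariant_eq_0\<close>): its component of lowest degree in the
odd generators is killed by all \<open>\<Sum>\<^sub>n c\<^sub>n \<partial>/\<partial>\<eta>\<^bsub>n+r\<^esub>\<close> and \<open>\<Sum>\<^sub>n c\<^sub>n \<partial>/\<partial>\<theta>\<^bsub>n+r\<^esub>\<close>, hence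
by all \<open>\<partial>/\<partial>\<eta>\<^sub>n\<close> and \<open>\<partial>/\<partial>\<theta>\<^sub>n\<close>, because \<open>c\<^sub>0\<close> is not a zero divisor. So it
is enough to find, for each invariant, an element of the generated algebra with the same body \<open>p\<close>.
The \<open>\<theta>\<^sub>0\<close>-component of \<open>E\<^sub>1\<^sub>2[r] P = 0\<close> (\<open>body_divisible_gradient\<close>) says that
there are polynomials \<open>R\<^sub>j\<close>, almost all zero, with
\<open>(\<partial>/\<partial>x\<^sub>r - \<partial>/\<partial>y\<^sub>r) p = \<Sum>\<^sub>i c\<^sub>i R\<^bsub>i+r\<^esub>\<close> for all \<open>r\<close>.

The main step (\<open>divisible_gradient_mem\<close>) is that this condition forces \<open>p\<close> into the algebra
\<open>A\<close> generated by the coefficients of \<open>c x\<^sup>k\<close>. In the coordinates \<open>x\<^sub>n, c\<^sub>n\<close> the derivation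
is \<open>\<partial>/\<partial>x\<^sub>r\<close>, and the components \<open>p\<^sub>N\<close> of degree \<open>N\<close> in the \<open>c\<^sub>n\<close> can be treated separately.

\<^item> A solution \<open>p\<^sub>N\<close> is determined by its monomials in \<open>x\<^sub>0, \<dots>, x\<^bsub>N-1\<^esub>\<close> and the \<open>c\<^sub>n\<close>
  (\<open>divisible_gradient_unique\<close>). The substitution \<open>c\<^sub>0 \<mapsto> 0, c\<^bsub>n+1\<^esub> \<mapsto> c\<^sub>n\<close> respects the
  condition and lowers the weight; once it kills \<open>p\<^sub>N\<close>, the quotient \<open>p\<^sub>N / c\<^sub>0\<close> has
  degree \<open>N - 1\<close> and satisfies the condition for all \<open>r \<ge> 1\<close>.

\<^item> Those monomials can be prescribed arbitrarily by elements of \<open>A\<close> (\<open>reachable_single\<close>). The coefficients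
  of \<open>c(z\<^sub>1) \<cdots> c(z\<^sub>N) x(z\<^sub>i) \<cdots> x(z\<^sub>j)\<close> lie in \<open>A\<close>, and modulo \<open>x\<^sub>N, x\<^bsub>N+1\<^esub>, \<dots>\<close>
  the series \<open>x(z)\<close> is a polynomial of degree less than \<open>N\<close>, which divided differences
  recover from its values at \<open>z\<^sub>1, \<dots>, z\<^sub>N\<close> (\<open>interpolation\<close>).

Since elements of \<open>A\<close> satisfy the condition as well, \<open>p\<^sub>N\<close> equals the element of \<open>A\<close> with the same
prescribed monomials. Finally the bodies \<open>x\<^bsup>k-1\<^esup> c\<close>, \<open>y\<^bsup>k-1\<^esup> c\<close> and
\<open>x\<^sup>k - (-y)\<^sup>k\<close> of the three families generate the same algebra \<open>A\<close>.\<close>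

section \<open>Polynomials in the central variables: uniqueness\<close>

text \<open>The sequence \<open>U\<close> is a family of polynomials of degree \<open>N\<close> in variables \<open>c\<^sub>0, c\<^sub>1, \<dots>\<close>, given by their
coefficients at monomials, and the convolution is the coefficient of \<open>\<Sum>\<^sub>i c\<^sub>i U\<^bsub>i+r\<^esub>\<close>. The
last nonzero \<open>U\<^sub>j\<close> with \<open>j \<ge> s\<close> would contribute \<open>c\<^sub>0 U\<^sub>j\<close> to the convolution with \<open>r = j\<close>, and nothing else would.\<close>

lemma convolution_eq_0:
  fixes U :: "nat \<Rightarrow> nat multiset \<Rightarrow> 'a::ab_group_add"
  assumes bound: "\<And>j \<mu>. j \<ge> J \<Longrightarrow> U j \<mu> = 0"
    and conv: "\<And>r \<mu>. r \<ge> s \<Longrightarrow> size \<mu> = Suc N \<Longrightarrow> (\<Sum>i\<in>set_mset \<mu>. U (i + r) (\<mu> - {#i#})) = 0"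
    and "j \<ge> s" "size \<mu> = N"
  shows "U j \<mu> = 0"
  using assms(3,4)
proof (induction "J - j" arbitrary: j \<mu> rule: less_induct)
  case less
  show ?case
  proof (cases "j < J")
    case True
    have "(\<Sum>i\<in>set_mset (add_mset 0 \<mu>). U (i + j) (add_mset 0 \<mu> - {#i#})) =
        U j \<mu> + (\<Sum>i\<in>set_mset \<mu> - {0}. U (i + j) (add_mset 0 \<mu> - {#i#}))"
      by (simp add: sum.insert_remove)
    also have "(\<Sum>i\<in>set_mset \<mu> - {0}. U (i + j) (add_mset 0 \<mu> - {#i#})) = 0"
    proof (intro sum.neutral ballI)
      fix i assume i: "i \<in> set_mset \<mu> - {0}"
      then have "size (add_mset 0 \<mu> - {#i#}) = size (add_mset 0 \<mu>) - 1"
        by (intro size_Diff_singleton) auto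
      then have "size (add_mset 0 \<mu> - {#i#}) = N"
        using less.prems by simp
      then show "U (i + j) (add_mset 0 \<mu> - {#i#}) = 0"
        using i less True by (intro less.hyps) auto
    qed
    finally show ?thesis using conv[of j "add_mset 0 \<mu>"] less.prems by simp
  qed (use bound in simp)
qed

lemma mset_eq_Suc_image: "0 \<notin># \<mu> \<Longrightarrow> \<exists>\<nu>. \<mu> = image_mset Suc \<nu>"
proof (induction \<mu>)
  case (add x \<mu>)
  then obtain \<nu> where "\<mu> = image_mset Suc \<nu>" by auto
  moreover obtain y where "x = Suc y" using add.prems by (cases x) auto
  ultimately have "add_mset x \<mu> = image_mset Suc (add_mset y \<nu>)" by simp
  then show ?case by blast
qed simp

lemma sum_mset_image_Suc: "sum_mset (image_mset Suc \<mu>) = sum_mset \<mu> + size \<mu>"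
  by (induction \<mu>) auto

text \<open>Here \<open>P\<close> collects the coefficients, at \<open>c\<close>-monomials \<open>\<mu>\<close> and \<open>x\<close>-monomials \<open>\<nu>\<close>, of a polynomial with
\<open>\<partial>P/\<partial>x\<^sub>r = \<Sum>\<^sub>i c\<^sub>i R\<^bsub>i+r\<^esub>\<close> for \<open>r \<ge> s\<close>. The offset \<open>s\<close> makes the induction on the \<open>c\<close>-degree \<open>N\<close>
possible: splitting off a factor \<open>c\<^sub>0\<close> lowers \<open>N\<close> by one and raises \<open>s\<close> by one, so the
bound \<open>N + s\<close> for the monomials assumed to be absent stays the same. For \<open>N = 0\<close> the right-hand side is empty and \<open>P\<close>
does not involve any \<open>x\<^sub>r\<close> with \<open>r \<ge> s\<close>.\<close>

lemma convolution_solution_unique: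
  fixes P :: "nat multiset \<Rightarrow> nat multiset \<Rightarrow> 'a::{idom,ring_char_0}"
    and R :: "nat \<Rightarrow> nat multiset \<Rightarrow> nat multiset \<Rightarrow> 'a"
  assumes bound: "\<And>j \<mu> \<nu>. j \<ge> J \<Longrightarrow> R j \<mu> \<nu> = 0"
    and weight: "\<And>\<mu> \<nu>. size \<mu> = N \<Longrightarrow> sum_mset \<mu> > K \<Longrightarrow> P \<mu> \<nu> = 0"
    and low: "\<And>\<mu> \<nu>. size \<mu> = N \<Longrightarrow> (\<forall>x\<in>#\<nu>. x < N + s) \<Longrightarrow> P \<mu> \<nu> = 0"
    and eq: "\<And>r \<mu> \<nu>. r \<ge> s \<Longrightarrow> size \<mu> = N \<Longrightarrow>
      of_nat (Suc (count \<nu> r)) * P \<mu> (add_mset r \<nu>) = (\<Sum>i\<in>set_mset \<mu>. R (i + r) (\<mu> - {#i#}) \<nu>)"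
    and "size \<mu> = N"
  shows "P \<mu> \<nu> = 0"
  using assms
proof (induction N arbitrary: s J K P R \<mu> \<nu>)
  case (0 s J K P R \<mu> \<nu>)
  show ?case
  proof (cases "\<forall>x\<in>#\<nu>. x < s")
    case True
    then show ?thesis using 0(3,5) by simp
  next
    case False
    then obtain r \<nu>' where "r \<ge> s" "\<nu> = add_mset r \<nu>'"
      by (meson not_le mset_add)
    then have "of_nat (Suc (count \<nu>' r)) * P \<mu> \<nu> = 0"
      using 0(4)[of r \<mu> \<nu>'] 0(5) by simp
    then show ?thesis by (simp del: of_nat_Suc)
  qed
next
  case (Suc N s J K P R \<mu> \<nu>)
  from Suc.prems show ?case
  proof (induction K arbitrary: J P R \<mu> \<nu> rule: less_induct)
    case (less K J P R \<mu> \<nu>)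
    \<comment> \<open>The substitution \<open>c\<^sub>0 \<mapsto> 0, c\<^bsub>n+1\<^esub> \<mapsto> c\<^sub>n\<close>. Since the term \<open>i = 0\<close> disappears, the index of \<open>R\<close> moves up by one.\<close>
    define SP where "SP \<mu> = P (image_mset Suc \<mu>)" for \<mu>
    define SR where "SR j \<mu> = R (Suc j) (image_mset Suc \<mu>)" for j \<mu>
    have SR_bound: "SR j \<mu> \<nu> = 0" if "j \<ge> J" for j \<mu> \<nu>
      using that less.prems(1) by (simp add: SR_def)
    have SP_weight: "SP \<mu> \<nu> = 0" if "size \<mu> = Suc N" "sum_mset \<mu> + Suc N > K" for \<mu> \<nu>
      unfolding SP_def using that by (intro less.prems(2)) (simp_all add: sum_mset_image_Suc)
    have SP_eq: "of_nat (Suc (count \<nu> r)) * SP \<mu> (add_mset r \<nu>) = (\<Sum>i\<in>set_mset \<mu>. SR (i + r) (\<mu> - {#i#}) \<nu>)"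
      if "r \<ge> s" "size \<mu> = Suc N" for r \<mu> \<nu>
    proof -
      have "of_nat (Suc (count \<nu> r)) * SP \<mu> (add_mset r \<nu>) =
        (\<Sum>i\<in>Suc ` set_mset \<mu>. R (i + r) (image_mset Suc \<mu> - {#i#}) \<nu>)"
        unfolding SP_def using less.prems(4)[of r "image_mset Suc \<mu>" \<nu>] that by simp
      also have "\<dots> = (\<Sum>i\<in>set_mset \<mu>. SR (i + r) (\<mu> - {#i#}) \<nu>)"
        by (subst sum.reindex) (auto simp: SR_def image_mset_Diff intro!: sum.cong)
      finally show ?thesis .
    qed
    have SP_0: "SP \<mu> \<nu> = 0" if "size \<mu> = Suc N" for \<mu> \<nu>
    proof (cases "K = 0")
      case True
      then show ?thesis using SP_weight[OF that] by simp
    next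
      case False
      show ?thesis
      proof (rule less.IH[of "K - 1" J SR SP])
        show "SP \<mu> \<nu> = 0" if "size \<mu> = Suc N" "K - 1 < sum_mset \<mu>" for \<mu> \<nu>
          using that by (intro SP_weight) auto
        show "SP \<mu> \<nu> = 0" if "size \<mu> = Suc N" "\<forall>x\<in>#\<nu>. x < Suc N + s" for \<mu> \<nu>
          unfolding SP_def using that by (intro less.prems(3)) auto
      qed (use False that SR_bound SP_eq in auto)
    qed
    have "SR j \<mu> \<nu> = 0" if "j \<ge> s" "size \<mu> = N" for j \<mu> \<nu>
    proof (rule convolution_eq_0[of J "\<lambda>j \<mu>. SR j \<mu> \<nu>" s N])
      show "(\<Sum>i\<in>set_mset \<mu>. SR (i + r) (\<mu> - {#i#}) \<nu>) = 0" if "s \<le> r" "size \<mu> = Suc N" for r \<mu>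
        using SP_eq[OF that, of \<nu>] SP_0[OF that(2)] by simp
    qed (use that SR_bound in auto)
    \<comment> \<open>So \<open>R\<^sub>j\<close> is divisible by \<open>c\<^sub>0\<close> for \<open>j > s\<close>; nothing is known about \<open>R\<^sub>s\<close>, which is why \<open>s\<close> has to grow.\<close>
    then have R_0: "R j \<mu> \<nu> = 0" if "j \<ge> Suc s" "size \<mu> = N" "0 \<notin># \<mu>" for j \<mu> \<nu>
      using that mset_eq_Suc_image[of \<mu>] by (cases j) (auto simp: SR_def)
    \<comment> \<open>The quotients by \<open>c\<^sub>0\<close> satisfy the hypotheses in degree \<open>N\<close> with offset \<open>s + 1\<close>.\<close>
    have P_0: "P (add_mset 0 \<mu>) \<nu> = 0" if "size \<mu> = N" for \<mu> \<nu>
    proof (rule Suc.IH[where P = "\<lambda>\<mu>. P (add_mset 0 \<mu>)" and R = "\<lambda>j \<mu>. R j (add_mset 0 \<mu>)" and s = "Suc s" and K = K and J = J])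
      show "of_nat (Suc (count \<nu> r)) * P (add_mset 0 \<mu>) (add_mset r \<nu>) =
          (\<Sum>i\<in>set_mset \<mu>. R (i + r) (add_mset 0 (\<mu> - {#i#})) \<nu>)"
        if r: "r \<ge> Suc s" and \<mu>: "size \<mu> = N" for r \<mu> \<nu>
      proof -
        have "of_nat (Suc (count \<nu> r)) * P (add_mset 0 \<mu>) (add_mset r \<nu>) =
            (\<Sum>i\<in>insert 0 (set_mset \<mu>). R (i + r) (add_mset 0 \<mu> - {#i#}) \<nu>)"
          using less.prems(4)[of r "add_mset 0 \<mu>" \<nu>] r \<mu> by simp
        also have "\<dots> = R r \<mu> \<nu> + (\<Sum>i\<in>set_mset \<mu> - {0}. R (i + r) (add_mset 0 \<mu> - {#i#}) \<nu>)"
          by (simp add: sum.insert_remove)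
        also have "(\<Sum>i\<in>set_mset \<mu> - {0}. R (i + r) (add_mset 0 \<mu> - {#i#}) \<nu>) =
            (\<Sum>i\<in>set_mset \<mu> - {0}. R (i + r) (add_mset 0 (\<mu> - {#i#})) \<nu>)"
          by (intro sum.cong refl) auto
        also have "R r \<mu> \<nu> + \<dots> = (\<Sum>i\<in>set_mset \<mu>. R (i + r) (add_mset 0 (\<mu> - {#i#})) \<nu>)"
        proof (cases "0 \<in># \<mu>")
          case True
          then show ?thesis
            by (subst sum.remove[of "set_mset \<mu>" 0]) auto
        next
          case False
          then show ?thesis using R_0[OF r \<mu>] by simp
        qed
        finally show ?thesis .
      qed
    qed (use that less.prems in auto)
    show ?case
    proof (cases "0 \<in># \<mu>")
      case True
      then obtain \<mu>' where "\<mu> = add_mset 0 \<mu>'" by (meson mset_add)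
      then show ?thesis using P_0 less.prems(5) by simp
    next
      case False
      then show ?thesis using mset_eq_Suc_image[of \<mu>] SP_0 less.prems(5) by (auto simp: SP_def)
    qed
  qed
qed

section \<open>Divided differences of power series in several variables\<close>

text \<open>Functions on exponent vectors \<open>\<alpha>\<close> are read as formal series in variables \<open>z\<^sub>0, z\<^sub>1, \<dots>\<close>; the operator
\<open>shift i j\<close> is multiplication by \<open>z\<^sub>i\<^sup>j\<close>.\<close>

definition shift :: "nat \<Rightarrow> nat \<Rightarrow> ((nat \<Rightarrow> nat) \<Rightarrow> 'v) \<Rightarrow> (nat \<Rightarrow> nat) \<Rightarrow> 'v::zero" where
  "shift i j H \<alpha> = (if j \<le> \<alpha> i then H (\<alpha>(i := \<alpha> i - j)) else 0)"

lemma shift_0 [simp]: "shift i 0 H = H"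
  by (simp add: shift_def fun_eq_iff)

lemma shift_shift: "shift i j (shift i k H) = shift i (j + k) H"
  by (auto simp: shift_def fun_eq_iff add.commute)

lemma shift_commute: "shift i j (shift k l H) = shift k l (shift i j H)"
  by (cases "i = k") (auto simp: shift_def fun_eq_iff shift_shift fun_upd_twist add.commute)

lemma shift_diff: "shift i j (\<lambda>\<alpha>. G \<alpha> - G' \<alpha>) \<alpha> = shift i j G \<alpha> - (shift i j G' \<alpha> :: 'v::group_add)"
  by (simp add: shift_def)

lemma shift_sum:
  "shift i j (\<lambda>\<alpha>. \<Sum>k\<in>A. H k \<alpha>) \<alpha> = (\<Sum>k\<in>A. shift i j (H k) \<alpha> :: 'v::comm_monoid_add)"
  by (simp add: shift_def)

locale add_subgroup =
  fixes W :: "'v::ab_group_add set"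
  assumes zero_mem: "0 \<in> W" and diff_mem: "a \<in> W \<Longrightarrow> b \<in> W \<Longrightarrow> a - b \<in> W"
begin

lemma add_mem: "a \<in> W \<Longrightarrow> b \<in> W \<Longrightarrow> a + b \<in> W"
  using diff_mem[of a "0 - b"] diff_mem[of 0 b] zero_mem by simp

lemma sum_mem: "(\<And>x. x \<in> A \<Longrightarrow> f x \<in> W) \<Longrightarrow> sum f A \<in> W"
  by (induction A rule: infinite_finite_induct) (auto intro: zero_mem add_mem)

lemma shift_mem: "(\<And>\<alpha>. H \<alpha> \<in> W) \<Longrightarrow> shift i j H \<alpha> \<in> W"
  by (simp add: shift_def zero_mem)

text \<open>Comparing coefficients in \<open>(z\<^sub>i - z\<^sub>k) H\<close> shows that two coefficients of \<open>H\<close> agree modulo \<open>W\<close> if one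
exponent vector arises from the other by moving a unit from \<open>k\<close> to \<open>i\<close>; after all units have been moved,
the coefficient is one of \<open>(z\<^sub>i - z\<^sub>k) H\<close> itself.\<close>

lemma divide_difference:
  assumes "i \<noteq> k" and "\<And>\<alpha>. shift i 1 H \<alpha> - shift k 1 H \<alpha> \<in> W"
  shows "H \<alpha> \<in> W"
proof (induction "\<alpha> k" arbitrary: \<alpha>)
  case 0
  then show ?case using assms(2)[of "\<alpha>(i := Suc (\<alpha> i))"] \<open>i \<noteq> k\<close> by (simp add: shift_def)
next
  case (Suc n)
  let ?\<beta> = "\<alpha>(i := Suc (\<alpha> i))"
  have "shift i 1 H ?\<beta> = H \<alpha>" by (simp add: shift_def)
  moreover have "shift k 1 H ?\<beta> \<in> W"
    using Suc.hyps(1)[of "?\<beta>(k := n)"] \<open>i \<noteq> k\<close> Suc.hyps(2)[symmetric] by (simp add: shift_def)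
  ultimately show ?case
    using add_mem[OF assms(2)[of ?\<beta>]] by (metis diff_add_cancel)
qed

text \<open>A polynomial of degree less than \<open>n\<close> with values in \<open>W\<close> at \<open>n\<close> independent points has its coefficients in \<open>W\<close>.
This replaces division by the Vandermonde determinant of \<open>z\<^sub>0, \<dots>, z\<^bsub>n-1\<^esub>\<close> by successive divisions by
differences \<open>z\<^sub>i - z\<^sub>k\<close>.\<close>

lemma interpolation:
  assumes "\<And>i \<alpha>. i < n \<Longrightarrow> (\<Sum>j<n. shift i j (g j) \<alpha>) \<in> W" and "k < n"
  shows "g k \<alpha> \<in> W"
proof -
  have "(\<forall>i<n. \<forall>\<alpha>. (\<Sum>j<n. shift i j (g j) \<alpha>) \<in> W) \<longrightarrow> (\<forall>k<n. \<forall>\<alpha>. g k \<alpha> \<in> W)"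
  proof (induction n arbitrary: g)
    case (Suc n)
    show ?case
    proof (intro impI allI)
      fix k \<alpha>
      assume vals: "\<forall>i<Suc n. \<forall>\<alpha>. (\<Sum>j<Suc n. shift i j (g j) \<alpha>) \<in> W" and k_le: "k < Suc n"
      \<comment> \<open>The coefficients of the divided difference \<open>(g(t) - g(z\<^sub>n)) / (t - z\<^sub>n)\<close>, a polynomial in \<open>t\<close> of degree less than \<open>n\<close>.\<close>
      define q where "q k \<alpha> = (\<Sum>j=Suc k..n. shift n (j - Suc k) (g j) \<alpha>)" for k \<alpha>
      have q_n: "q n \<alpha> = 0" for \<alpha> by (simp add: q_def)
      have g_Suc: "g (Suc k) \<alpha> = q k \<alpha> - shift n 1 (q (Suc k)) \<alpha>" if "k < n" for k \<alpha>
      proof -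
        have "q k \<alpha> = g (Suc k) \<alpha> + (\<Sum>j=Suc (Suc k)..n. shift n (j - Suc k) (g j) \<alpha>)"
          unfolding q_def using that by (subst sum.atLeast_Suc_atMost) auto
        also have "(\<Sum>j=Suc (Suc k)..n. shift n (j - Suc k) (g j) \<alpha>) =
            (\<Sum>j=Suc (Suc k)..n. shift n 1 (shift n (j - Suc (Suc k)) (g j)) \<alpha>)"
          by (intro sum.cong refl) (simp add: shift_shift Suc_diff_Suc)
        also have "\<dots> = shift n 1 (q (Suc k)) \<alpha>"
          unfolding q_def shift_sum ..
        finally show ?thesis by simp
      qed
      define Q where "Q i \<alpha> = (\<Sum>k<n. shift i k (q k) \<alpha>)" for i \<alpha>
      have expand: "(\<Sum>j<Suc n. shift i j (g j) \<alpha>) =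
          g 0 \<alpha> + shift n 1 (q 0) \<alpha> + (shift i 1 (Q i) \<alpha> - shift n 1 (Q i) \<alpha>)" for i \<alpha>
      proof -
        have "shift i (Suc k) (g (Suc k)) \<alpha> =
            shift i 1 (shift i k (q k)) \<alpha> - shift n 1 (shift i (Suc k) (q (Suc k))) \<alpha>" if "k < n" for k
        proof -
          have "g (Suc k) = (\<lambda>\<alpha>. q k \<alpha> - shift n 1 (q (Suc k)) \<alpha>)" using g_Suc[OF that] by blast
          then show ?thesis by (simp only: shift_diff shift_commute[of n] shift_shift plus_1_eq_Suc)
        qed
        then have "(\<Sum>j<Suc n. shift i j (g j) \<alpha>) = g 0 \<alpha> +
            (\<Sum>k<n. shift i 1 (shift i k (q k)) \<alpha> - shift n 1 (shift i (Suc k) (q (Suc k))) \<alpha>)"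
          unfolding sum.lessThan_Suc_shift by simp
        also have "\<dots> = g 0 \<alpha> + (shift i 1 (Q i) \<alpha> - shift n 1 (\<lambda>\<alpha>. \<Sum>k<n. shift i (Suc k) (q (Suc k)) \<alpha>) \<alpha>)"
          unfolding sum_subtractf Q_def shift_sum ..
        also have "(\<lambda>\<alpha>. \<Sum>k<n. shift i (Suc k) (q (Suc k)) \<alpha>) = (\<lambda>\<alpha>. Q i \<alpha> - q 0 \<alpha>)"
        proof
          fix \<alpha>
          have "(\<Sum>k<Suc n. shift i k (q k) \<alpha>) = Q i \<alpha>"
            using q_n by (simp add: Q_def shift_def)
          then show "(\<Sum>k<n. shift i (Suc k) (q (Suc k)) \<alpha>) = Q i \<alpha> - q 0 \<alpha>"
            unfolding sum.lessThan_Suc_shift by (simp add: algebra_simps)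
        qed
        finally show ?thesis by (simp add: shift_diff algebra_simps)
      qed
      have Gn: "g 0 \<alpha> + shift n 1 (q 0) \<alpha> \<in> W" for \<alpha>
        using vals[rule_format, of n \<alpha>] unfolding expand by simp
      have Q: "Q i \<alpha> \<in> W" if "i < n" for i \<alpha>
      proof (rule divide_difference[of i n "Q i"])
        show "i \<noteq> n" using that by simp
        show "shift i 1 (Q i) \<alpha> - shift n 1 (Q i) \<alpha> \<in> W" for \<alpha>
          using diff_mem[OF vals[rule_format, of i \<alpha>] Gn[of \<alpha>]] that unfolding expand by simp
      qed
      have "q k \<alpha> \<in> W" if "k < n" for k \<alpha>
        using Suc.IH[of q] Q that by (simp add: Q_def)
      then have q: "q k \<alpha> \<in> W" if "k \<le> n" for k \<alpha>
        using that q_n zero_mem by (cases "k = n") auto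
      show "g k \<alpha> \<in> W"
      proof (cases k)
        case 0
        have "g 0 \<alpha> + shift n 1 (q 0) \<alpha> - shift n 1 (q 0) \<alpha> \<in> W"
          using q by (intro diff_mem[OF Gn] shift_mem) simp
        then show ?thesis using 0 by simp
      next
        case k: (Suc k')
        then have k': "k' < n" using k_le by simp
        have "q k' \<alpha> - shift n 1 (q (Suc k')) \<alpha> \<in> W"
          by (intro diff_mem shift_mem q) (use k' in auto)
        then show ?thesis using g_Suc[OF k'] k by simp
      qed
    qed
  qed simp
  then show ?thesis using assms by blast
qed

end

section \<open>Monomials in two families of variables\<close>

text \<open>The coefficient ring of the Grassmann algebra, in the even generators. The variables with even labels are always \<open>x\<^sub>n\<close>.
The ones with odd labels are \<open>y\<^sub>n\<close> in the superalgebra itself. The sections on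
the gradient condition use instead the coordinates \<open>x\<^sub>n\<close> and \<open>c\<^sub>n = x\<^sub>n + y\<^sub>n\<close>, and there the
odd labels stand for \<open>c\<^sub>n\<close>.\<close>

type_synonym bpoly = "(nat \<Rightarrow>\<^sub>0 nat) \<Rightarrow>\<^sub>0 complex"

definition var :: "nat \<Rightarrow> bpoly" where
  "var n = Poly_Mapping.single (Poly_Mapping.single n 1) 1"

abbreviation xvar :: "nat \<Rightarrow> bpoly" where "xvar n \<equiv> var (2 * n)"
abbreviation yvar :: "nat \<Rightarrow> bpoly" where "yvar n \<equiv> var (Suc (2 * n))"
abbreviation scalar :: "complex \<Rightarrow> bpoly" where "scalar \<equiv> Poly_Mapping.single 0"

lemma lookup_var_mult:
  "Poly_Mapping.lookup (var k * p) m =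
    (if Poly_Mapping.lookup m k = 0 then 0 else Poly_Mapping.lookup p (m - Poly_Mapping.single k 1))"
proof (induction p rule: poly_induct)
  case (3 l c)
  have "Poly_Mapping.single k 1 + l = m \<longleftrightarrow> Poly_Mapping.lookup m k \<noteq> 0 \<and> l = m - Poly_Mapping.single k 1"
  proof
    assume m: "Poly_Mapping.lookup m k \<noteq> 0 \<and> l = m - Poly_Mapping.single k 1"
    show "Poly_Mapping.single k 1 + l = m"
      by (rule poly_mapping_eqI) (use m in \<open>auto simp: lookup_add lookup_minus lookup_single when_def\<close>)
  qed (auto simp: lookup_add)
  then show ?case
    by (auto simp: var_def mult_single lookup_single when_def)
qed (simp_all add: distrib_left lookup_add)

text \<open>Exponent vectors are split into two multisets of indices because the uniqueness argument removes single
factors \<open>c\<^sub>i\<close> and shifts indices; \<open>\<mu>\<close> lists the odd-labelled factors and \<open>\<nu>\<close> the even-labelled ones.\<close>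

definition exponent :: "nat multiset \<Rightarrow> nat multiset \<Rightarrow> nat \<Rightarrow>\<^sub>0 nat" where
  "exponent \<mu> \<nu> = (\<Sum>i\<in>#\<mu>. Poly_Mapping.single (Suc (2 * i)) 1) + (\<Sum>i\<in>#\<nu>. Poly_Mapping.single (2 * i) 1)"

lemma exponent_empty [simp]: "exponent {#} {#} = 0"
  and exponent_add_odd: "exponent (add_mset i \<mu>) \<nu> = Poly_Mapping.single (Suc (2 * i)) 1 + exponent \<mu> \<nu>"
  and exponent_add_even: "exponent \<mu> (add_mset i \<nu>) = Poly_Mapping.single (2 * i) 1 + exponent \<mu> \<nu>"
  by (simp_all add: exponent_def add_ac)

lemma exponent_plus: "exponent \<mu> \<nu> + exponent \<mu>' \<nu>' = exponent (\<mu> + \<mu>') (\<nu> + \<nu>')"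
  by (simp add: exponent_def add_ac)

lemma lookup_exponent [simp]:
  "Poly_Mapping.lookup (exponent \<mu> \<nu>) (2 * i) = count \<nu> i"
  "Poly_Mapping.lookup (exponent \<mu> \<nu>) (Suc (2 * i)) = count \<mu> i"
proof -
  have odd_part: "Poly_Mapping.lookup (\<Sum>i\<in>#\<mu>. Poly_Mapping.single (Suc (2 * i)) (1::nat)) k =
      (if odd k then count \<mu> (k div 2) else 0)" for k
  proof -
    have "Suc (2 * i) = k \<longleftrightarrow> odd k \<and> i = k div 2" for i by presburger
    then show ?thesis by (induction \<mu>) (auto simp: lookup_add lookup_single when_def)
  qed
  have even_part: "Poly_Mapping.lookup (\<Sum>i\<in>#\<nu>. Poly_Mapping.single (2 * i) (1::nat)) k =
      (if even k then count \<nu> (k div 2) else 0)" for k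
  proof -
    have "2 * i = k \<longleftrightarrow> even k \<and> i = k div 2" for i by presburger
    then show ?thesis by (induction \<nu>) (auto simp: lookup_add lookup_single when_def)
  qed
  show "Poly_Mapping.lookup (exponent \<mu> \<nu>) (2 * i) = count \<nu> i"
    "Poly_Mapping.lookup (exponent \<mu> \<nu>) (Suc (2 * i)) = count \<mu> i"
    by (simp_all add: exponent_def lookup_add odd_part even_part del: One_nat_def)
qed

lemma exponent_inject [simp]: "exponent \<mu> \<nu> = exponent \<mu>' \<nu>' \<longleftrightarrow> \<mu> = \<mu>' \<and> \<nu> = \<nu>'"
  by (metis lookup_exponent multiset_eqI)

lemma exponent_cases: obtains \<mu> \<nu> where "m = exponent \<mu> \<nu>"
proof -
  have "\<exists>\<mu> \<nu>. m = exponent \<mu> \<nu>"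
  proof (induction m rule: poly_induct)
    case 1
    then show ?case by (metis exponent_empty)
  next
    case (2 p q)
    then show ?case by (metis exponent_plus)
  next
    case (3 n c)
    show ?case
    proof (induction c)
      case 0
      then show ?case by (metis exponent_empty single_zero)
    next
      case (Suc c)
      then obtain \<mu> \<nu> where "Poly_Mapping.single n c = exponent \<mu> \<nu>" by blast
      then have *: "Poly_Mapping.single n (Suc c) = Poly_Mapping.single n 1 + exponent \<mu> \<nu>"
        by (metis plus_1_eq_Suc single_add)
      show ?case
      proof (cases "even n")
        case True
        then have "Poly_Mapping.single n (Suc c) = exponent \<mu> (add_mset (n div 2) \<nu>)"
          using * by (simp add: exponent_add_even)
        then show ?thesis by blast
      next
        case False
        then have "Poly_Mapping.single n (Suc c) = exponent (add_mset (n div 2) \<mu>) \<nu>"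
          using * by (simp add: exponent_add_odd)
        then show ?thesis by blast
      qed
    qed
  qed
  then show ?thesis using that by blast
qed

lemma lookup_yvar_mult:
  "Poly_Mapping.lookup (yvar i * p) (exponent \<mu> \<nu>) = (if i \<in># \<mu> then Poly_Mapping.lookup p (exponent (\<mu> - {#i#}) \<nu>) else 0)"
proof (cases "i \<in># \<mu>")
  case True
  then obtain \<mu>' where "\<mu> = add_mset i \<mu>'" by (meson mset_add)
  then show ?thesis by (simp add: lookup_var_mult exponent_add_odd lookup_add)
next
  case False
  then have "count \<mu> i = 0" by (simp add: not_in_iff)
  then show ?thesis using False by (simp add: lookup_var_mult)
qed

section \<open>Polynomials with divisible gradient\<close>

text \<open>With \<open>R(z) = \<Sum>\<^sub>j R\<^sub>j z\<^bsup>-j-1\<^esup>\<close>, the condition says that the gradient \<open>\<Sum>\<^sub>r (\<partial>p/\<partial>x\<^sub>r) z\<^bsup>-r-1\<^esup>\<close> is the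
polar part of the multiple \<open>c(z) R(z)\<close> of \<open>c(z)\<close>. Allowing every \<open>J \<ge> J0\<close> as bound of the sum lets
two such representations be brought to a common bound.\<close>

definition divisible_gradient :: "bpoly \<Rightarrow> bool" where
  "divisible_gradient p \<longleftrightarrow> (\<exists>J0 R. (\<forall>j\<ge>J0. R j = 0) \<and>
     (\<forall>r. \<forall>J\<ge>J0. pdiff (2 * r) p = (\<Sum>i<J. yvar i * R (i + r))))"

lemma divisible_gradientI:
  "(\<And>j. j \<ge> J0 \<Longrightarrow> R j = 0) \<Longrightarrow>
   (\<And>r J. J \<ge> J0 \<Longrightarrow> pdiff (2 * r) p = (\<Sum>i<J. yvar i * R (i + r))) \<Longrightarrow> divisible_gradient p"
  unfolding divisible_gradient_def by blast

lemma divisible_gradient_diff: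
  assumes "divisible_gradient p" "divisible_gradient q"
  shows "divisible_gradient (p - q)"
proof -
  obtain J1 R1 where 1: "\<And>j. j \<ge> J1 \<Longrightarrow> R1 j = 0"
    "\<And>r J. J \<ge> J1 \<Longrightarrow> pdiff (2 * r) p = (\<Sum>i<J. yvar i * R1 (i + r))"
    using assms(1) unfolding divisible_gradient_def by blast
  obtain J2 R2 where 2: "\<And>j. j \<ge> J2 \<Longrightarrow> R2 j = 0"
    "\<And>r J. J \<ge> J2 \<Longrightarrow> pdiff (2 * r) q = (\<Sum>i<J. yvar i * R2 (i + r))"
    using assms(2) unfolding divisible_gradient_def by blast
  have d: "pdiff k (p - q) = pdiff k p - pdiff k q" for k
    using pdiff_add[of k p "- q"] by (simp add: pdiff_uminus)
  show ?thesis
    by (rule divisible_gradientI[of "max J1 J2" "\<lambda>j. R1 j - R2 j"])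
       (use 1 2 in \<open>auto simp: d sum_subtractf right_diff_distrib\<close>)
qed

lemma divisible_gradient_mult:
  assumes "divisible_gradient p" "divisible_gradient q"
  shows "divisible_gradient (p * q)"
proof -
  obtain J1 R1 where 1: "\<And>j. j \<ge> J1 \<Longrightarrow> R1 j = 0"
    "\<And>r J. J \<ge> J1 \<Longrightarrow> pdiff (2 * r) p = (\<Sum>i<J. yvar i * R1 (i + r))"
    using assms(1) unfolding divisible_gradient_def by blast
  obtain J2 R2 where 2: "\<And>j. j \<ge> J2 \<Longrightarrow> R2 j = 0"
    "\<And>r J. J \<ge> J2 \<Longrightarrow> pdiff (2 * r) q = (\<Sum>i<J. yvar i * R2 (i + r))"
    using assms(2) unfolding divisible_gradient_def by blast
  show ?thesis
  proof (rule divisible_gradientI[of "max J1 J2" "\<lambda>j. R1 j * q + p * R2 j"])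
    fix r J assume "max J1 J2 \<le> J"
    then have "pdiff (2 * r) (p * q) =
        (\<Sum>i<J. yvar i * R1 (i + r)) * q + p * (\<Sum>i<J. yvar i * R2 (i + r))"
      using 1(2)[of J r] 2(2)[of J r] by (simp add: pdiff_mult)
    then show "pdiff (2 * r) (p * q) = (\<Sum>i<J. yvar i * (R1 (i + r) * q + p * R2 (i + r)))"
      by (simp add: sum_distrib_left sum_distrib_right sum.distrib algebra_simps)
  qed (use 1 2 in simp)
qed

lemma pdiff_scalar [simp]: "pdiff k (scalar c) = 0"
  by (simp add: pdiff_single)

lemma divisible_gradient_scalar: "divisible_gradient (scalar c)"
  by (rule divisible_gradientI[of 0 "\<lambda>_. 0"]) simp_all

text \<open>The combinatorial uniqueness result applies to the coefficients of \<open>p\<close>; the weight bound \<open>K\<close> exists as \<open>p\<close> has finitely many monomials.\<close>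

lemma divisible_gradient_unique:
  assumes "divisible_gradient p"
    and low: "\<And>\<mu> \<nu>. size \<mu> = N \<Longrightarrow> (\<forall>x\<in>#\<nu>. x < N) \<Longrightarrow> Poly_Mapping.lookup p (exponent \<mu> \<nu>) = 0"
    and "size \<mu> = N"
  shows "Poly_Mapping.lookup p (exponent \<mu> \<nu>) = 0"
proof -
  obtain J R where R: "\<And>j. j \<ge> J \<Longrightarrow> R j = 0"
    "\<And>r. pdiff (2 * r) p = (\<Sum>i<J. yvar i * R (i + r))"
    using assms(1) unfolding divisible_gradient_def by blast
  define Z where "Z = (\<lambda>(\<mu>, \<nu>). exponent \<mu> \<nu>) -` Poly_Mapping.keys p"
  have "finite Z"
    unfolding Z_def by (rule finite_vimageI) (auto simp: inj_def)
  define K where "K = (\<Sum>(\<mu>, \<nu>)\<in>Z. sum_mset \<mu>)"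
  show ?thesis
  proof (rule convolution_solution_unique[where P = "\<lambda>\<mu> \<nu>. Poly_Mapping.lookup p (exponent \<mu> \<nu>)"
        and R = "\<lambda>j \<mu> \<nu>. Poly_Mapping.lookup (R j) (exponent \<mu> \<nu>)" and s = 0 and J = J and K = K and N = N])
    fix \<mu> \<nu> assume "K < sum_mset \<mu>"
    show "Poly_Mapping.lookup p (exponent \<mu> \<nu>) = 0"
    proof (rule ccontr)
      assume "Poly_Mapping.lookup p (exponent \<mu> \<nu>) \<noteq> 0"
      then have "(\<mu>, \<nu>) \<in> Z" by (simp add: Z_def in_keys_iff)
      then have "sum_mset \<mu> \<le> K"
        unfolding K_def using member_le_sum[of "(\<mu>, \<nu>)" Z "\<lambda>(\<mu>, \<nu>). sum_mset \<mu>"] \<open>finite Z\<close> by simp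
      with \<open>K < sum_mset \<mu>\<close> show False by simp
    qed
  next
    fix r :: nat and \<mu> \<nu>
    have "of_nat (Suc (count \<nu> r)) * Poly_Mapping.lookup p (exponent \<mu> (add_mset r \<nu>)) =
        Poly_Mapping.lookup (pdiff (2 * r) p) (exponent \<mu> \<nu>)"
      by (simp add: pdiff.rep_eq exponent_add_even add.commute)
    also have "\<dots> = (\<Sum>i<J. if i \<in># \<mu> then Poly_Mapping.lookup (R (i + r)) (exponent (\<mu> - {#i#}) \<nu>) else 0)"
      by (simp add: R(2) lookup_sum lookup_yvar_mult)
    also have "\<dots> = (\<Sum>i\<in>set_mset \<mu>. Poly_Mapping.lookup (R (i + r)) (exponent (\<mu> - {#i#}) \<nu>))"
      by (rule sum.mono_neutral_cong) (auto simp: R(1))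
    finally show "of_nat (Suc (count \<nu> r)) * Poly_Mapping.lookup p (exponent \<mu> (add_mset r \<nu>)) =
      (\<Sum>i\<in>set_mset \<mu>. Poly_Mapping.lookup (R (i + r)) (exponent (\<mu> - {#i#}) \<nu>))" .
  qed (use R low assms(3) in auto)
qed

definition xser :: "bpoly fps" where "xser = Abs_fps xvar"
definition yser :: "bpoly fps" where "yser = Abs_fps yvar"

definition fps_pdiff :: "nat \<Rightarrow> bpoly fps \<Rightarrow> bpoly fps" where
  "fps_pdiff k F = Abs_fps (\<lambda>n. pdiff k (fps_nth F n))"

lemma fps_pdiff_mult: "fps_pdiff k (F * G) = fps_pdiff k F * G + F * fps_pdiff k G"
  by (rule fps_ext) (simp add: fps_pdiff_def fps_mult_nth pdiff_sum pdiff_mult sum.distrib)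

lemma pdiff_1 [simp]: "pdiff k 1 = 0"
  using pdiff_scalar[of k 1] by simp

lemma fps_pdiff_1 [simp]: "fps_pdiff k 1 = 0"
  by (rule fps_ext) (simp add: fps_pdiff_def)

lemma fps_pdiff_power: "fps_pdiff k (F ^ m) = of_nat m * F ^ (m - 1) * fps_pdiff k F"
proof (induction m)
  case (Suc m)
  then show ?case by (cases m) (simp_all add: fps_pdiff_mult algebra_simps)
qed simp

lemma pdiff_var: "pdiff k (var n) = (if k = n then 1 else 0)"
  by (simp add: var_def pdiff_single lookup_single when_def)

lemma fps_pdiff_xser: "fps_pdiff (2 * r) xser = fps_X ^ r"
  by (rule fps_ext) (auto simp: fps_pdiff_def xser_def pdiff_var fps_X_power_nth)

lemma fps_pdiff_yser: "fps_pdiff (2 * r) yser = 0"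
proof (rule fps_ext)
  fix n
  have "2 * r \<noteq> Suc (2 * n)" by presburger
  then show "fps_nth (fps_pdiff (2 * r) yser) n = fps_nth 0 n"
    by (simp add: fps_pdiff_def yser_def pdiff_var)
qed

text \<open>By the chain rule \<open>\<partial>(c x\<^sup>k)/\<partial>x\<^sub>r = k z\<^sup>r c x\<^bsup>k-1\<^esup>\<close>, whose \<open>n\<close>-th coefficient is
\<open>\<Sum>\<^sub>i c\<^sub>i R\<^bsub>i+r\<^esub>\<close> with \<open>R\<^sub>m\<close> the coefficient of \<open>z\<^bsup>n-m\<^esup>\<close> in \<open>k x\<^bsup>k-1\<^esup>\<close>.\<close>

lemma divisible_gradient_coeff: "divisible_gradient (fps_nth (yser * xser ^ k) n)"
proof (rule divisible_gradientI)
  define G where "G = of_nat k * xser ^ (k - 1)"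
  define R where "R m = (if m \<le> n then fps_nth G (n - m) else 0)" for m
  show "R j = 0" if "j \<ge> Suc n" for j using that by (simp add: R_def)
  fix r J assume J: "J \<ge> Suc n"
  have "pdiff (2 * r) (fps_nth (yser * xser ^ k) n) = fps_nth (fps_pdiff (2 * r) (yser * xser ^ k)) n"
    by (simp add: fps_pdiff_def)
  also have "fps_pdiff (2 * r) (yser * xser ^ k) = fps_X ^ r * (yser * G)"
    by (simp only: fps_pdiff_mult fps_pdiff_yser fps_pdiff_power fps_pdiff_xser G_def) (simp add: mult_ac)
  also have "fps_nth \<dots> n = (\<Sum>i<J. yvar i * R (i + r))"
  proof (cases "r \<le> n")
    case True
    then have "fps_nth (fps_X ^ r * (yser * G)) n = (\<Sum>i=0..n - r. yvar i * fps_nth G (n - r - i))"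
      by (simp add: fps_X_power_mult_nth) (simp add: fps_mult_nth yser_def)
    also have "\<dots> = (\<Sum>i<J. yvar i * R (i + r))"
      by (rule sum.mono_neutral_cong_left) (use J True in \<open>auto simp: R_def add.commute\<close>)
    finally show ?thesis .
  qed (simp add: fps_X_power_mult_nth R_def)
  finally show "pdiff (2 * r) (fps_nth (yser * xser ^ k) n) = (\<Sum>i<J. yvar i * R (i + r))" .
qed

section \<open>Degrees and truncation\<close>

definition y_homogeneous :: "nat \<Rightarrow> bpoly \<Rightarrow> bool" where
  "y_homogeneous N p \<longleftrightarrow> (\<forall>m\<in>Poly_Mapping.keys p. \<exists>\<mu> \<nu>. m = exponent \<mu> \<nu> \<and> size \<mu> = N)"

lemma y_homogeneous_0 [simp]: "y_homogeneous N 0"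
  by (simp add: y_homogeneous_def)

lemma y_homogeneous_diff: "y_homogeneous N p \<Longrightarrow> y_homogeneous N q \<Longrightarrow> y_homogeneous N (p - q)"
  unfolding y_homogeneous_def using keys_diff[of p q] by blast

lemma y_homogeneous_add: "y_homogeneous N p \<Longrightarrow> y_homogeneous N q \<Longrightarrow> y_homogeneous N (p + q)"
  unfolding y_homogeneous_def using keys_add[of p q] by blast

lemma y_homogeneous_sum: "(\<And>x. x \<in> A \<Longrightarrow> y_homogeneous N (f x)) \<Longrightarrow> y_homogeneous N (sum f A)"
  by (induction A rule: infinite_finite_induct) (auto intro: y_homogeneous_add)

lemma y_homogeneous_mult: "y_homogeneous M p \<Longrightarrow> y_homogeneous N q \<Longrightarrow> y_homogeneous (M + N) (p * q)"
proof -
  assume p: "y_homogeneous M p" and q: "y_homogeneous N q"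
  have "\<exists>\<mu> \<nu>. a + b = exponent \<mu> \<nu> \<and> size \<mu> = M + N"
    if "a \<in> Poly_Mapping.keys p" "b \<in> Poly_Mapping.keys q" for a b
    using p q that unfolding y_homogeneous_def by (metis exponent_plus size_union)
  then show ?thesis unfolding y_homogeneous_def using keys_mult[of p q] by blast
qed

lemma y_homogeneous_scalar: "y_homogeneous 0 (scalar c)"
  unfolding y_homogeneous_def by (metis exponent_empty empty_iff insert_iff keys_single size_empty)

lemma y_homogeneous_xvar: "y_homogeneous 0 (xvar i)"
  unfolding y_homogeneous_def var_def using exponent_add_even[of "{#}" i "{#}"]
  by (metis add.right_neutral exponent_empty empty_iff insert_iff keys_single size_empty)

lemma y_homogeneous_yvar: "y_homogeneous 1 (yvar i)"
  unfolding y_homogeneous_def var_def using exponent_add_odd[of i "{#}" "{#}"]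
  by (metis add.right_neutral exponent_empty empty_iff insert_iff keys_single size_single)

lemma y_homogeneous_coeff: "y_homogeneous 1 (fps_nth (yser * xser ^ k) n)"
proof -
  have mult: "y_homogeneous (M + N) (fps_nth (F * G) n)"
    if "\<And>n. y_homogeneous M (fps_nth F n)" "\<And>n. y_homogeneous N (fps_nth G n)" for F G M N n
    unfolding fps_mult_nth by (intro y_homogeneous_sum y_homogeneous_mult that)
  have "y_homogeneous 0 (fps_nth (xser ^ k) n)" for n
  proof (induction k arbitrary: n)
    case 0
    then show ?case using y_homogeneous_scalar[of 1] by (cases n) auto
  next
    case (Suc k)
    then show ?case using mult[of 0 xser 0 "xser ^ k" n] by (simp add: xser_def y_homogeneous_xvar)
  qed
  then show ?thesis using mult[of 1 yser 0 "xser ^ k" n] by (simp add: yser_def y_homogeneous_yvar del: One_nat_def)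
qed

text \<open>The ideal generated by \<open>x\<^sub>N, x\<^bsub>N+1\<^esub>, \<dots>\<close>.\<close>

definition high_ideal :: "nat \<Rightarrow> bpoly set" where
  "high_ideal N = {q. \<forall>m\<in>Poly_Mapping.keys q. \<exists>j\<ge>N. Poly_Mapping.lookup m (2 * j) \<noteq> 0}"

lemma high_ideal_0 [simp]: "0 \<in> high_ideal N"
  by (simp add: high_ideal_def)

lemma high_ideal_diff: "p \<in> high_ideal N \<Longrightarrow> q \<in> high_ideal N \<Longrightarrow> p - q \<in> high_ideal N"
  unfolding high_ideal_def using keys_diff[of p q] by blast

lemma high_ideal_mult: "p \<in> high_ideal N \<Longrightarrow> p * q \<in> high_ideal N"
  unfolding high_ideal_def mem_Collect_eq
proof (intro ballI)
  fix m assume p: "\<forall>m\<in>Poly_Mapping.keys p. \<exists>j\<ge>N. Poly_Mapping.lookup m (2 * j) \<noteq> 0"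
    and "m \<in> Poly_Mapping.keys (p * q)"
  then obtain a b where "m = a + b" "a \<in> Poly_Mapping.keys p" using keys_mult[of p q] by blast
  then show "\<exists>j\<ge>N. Poly_Mapping.lookup m (2 * j) \<noteq> 0" using p by (auto simp: lookup_add)
qed

lemma high_ideal_xvar: "j \<ge> N \<Longrightarrow> xvar j \<in> high_ideal N"
  by (auto simp: high_ideal_def var_def intro!: exI[of _ j])

section \<open>Polynomials with divisible gradient are generated by the coefficients of \<open>c x\<^sup>k\<close>\<close>

locale bpoly_subalgebra =
  fixes K :: "bpoly set"
  assumes scalar_mem: "scalar c \<in> K"
    and add_mem: "p \<in> K \<Longrightarrow> q \<in> K \<Longrightarrow> p + q \<in> K"
    and mult_mem: "p \<in> K \<Longrightarrow> q \<in> K \<Longrightarrow> p * q \<in> K"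
begin

lemma zero_mem: "0 \<in> K"
  using scalar_mem[of 0] by simp

lemma diff_mem: "p \<in> K \<Longrightarrow> q \<in> K \<Longrightarrow> p - q \<in> K"
  using add_mem[of p "scalar (- 1) * q"] mult_mem[OF scalar_mem, of q "- 1"]
  by (simp add: single_uminus)

lemma sum_mem: "(\<And>x. x \<in> A \<Longrightarrow> f x \<in> K) \<Longrightarrow> sum f A \<in> K"
  by (induction A rule: infinite_finite_induct) (auto intro: zero_mem add_mem)

end

locale affine_subalgebra = bpoly_subalgebra +
  assumes coeff_mem: "fps_nth (yser * xser ^ k) n \<in> K"
begin

definition graded :: "nat \<Rightarrow> bpoly set" where
  "graded N = {p \<in> K. divisible_gradient p \<and> y_homogeneous N p}"

text \<open>Reachable polynomials are those that agree, in all monomials relevant for uniqueness in \<open>c\<close>-degree \<open>N\<close>, with an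
element of \<open>K\<close> that is homogeneous of this degree. They form a group, so divided differences apply to series of them.\<close>

definition reachable :: "nat \<Rightarrow> bpoly set" where
  "reachable N = {p. \<exists>q\<in>graded N. p - q \<in> high_ideal N}"

lemma graded_0: "0 \<in> graded N"
  using divisible_gradient_scalar[of 0] by (simp add: graded_def zero_mem)

lemma graded_diff: "p \<in> graded N \<Longrightarrow> q \<in> graded N \<Longrightarrow> p - q \<in> graded N"
  by (simp add: graded_def diff_mem divisible_gradient_diff y_homogeneous_diff)

lemma graded_mult: "p \<in> graded M \<Longrightarrow> q \<in> graded N \<Longrightarrow> p * q \<in> graded (M + N)"
  by (simp add: graded_def mult_mem divisible_gradient_mult y_homogeneous_mult)

lemma graded_scalar: "scalar c \<in> graded 0"
  by (simp add: graded_def scalar_mem divisible_gradient_scalar y_homogeneous_scalar)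

lemma graded_coeff: "fps_nth (yser * xser ^ k) n \<in> graded 1"
  by (simp only: graded_def coeff_mem divisible_gradient_coeff y_homogeneous_coeff mem_Collect_eq simp_thms)

lemma graded_reachable: "p \<in> graded N \<Longrightarrow> p \<in> reachable N"
  unfolding reachable_def by (auto intro!: bexI[of _ p])

lemma high_ideal_reachable: "p \<in> high_ideal N \<Longrightarrow> p \<in> reachable N"
  unfolding reachable_def mem_Collect_eq using graded_0 by (intro bexI[of _ 0]) simp_all

sublocale reachable: add_subgroup "reachable N" for N
proof
  show "0 \<in> reachable N" using graded_reachable graded_0 by blast
  fix p q assume "p \<in> reachable N" "q \<in> reachable N"
  then obtain p' q' where "p' \<in> graded N" "q' \<in> graded N" "p - p' \<in> high_ideal N" "q - q' \<in> high_ideal N"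
    unfolding reachable_def by blast
  then show "p - q \<in> reachable N"
    unfolding reachable_def using graded_diff[of p' N q'] high_ideal_diff[of "p - p'" N "q - q'"]
    by (auto intro!: bexI[of _ "p' - q'"] simp: algebra_simps)
qed

lemma reachable_scalar: "p \<in> reachable N \<Longrightarrow> scalar c * p \<in> reachable N"
proof -
  assume "p \<in> reachable N"
  then obtain q where "q \<in> graded N" "p - q \<in> high_ideal N" unfolding reachable_def by blast
  then have "scalar c * q \<in> graded N" "scalar c * p - scalar c * q \<in> high_ideal N"
    using graded_mult[OF graded_scalar, of q N c] high_ideal_mult[of "p - q" N "scalar c"]
    by (simp_all add: algebra_simps)
  then show ?thesis unfolding reachable_def by blast
qed

text \<open>The coefficient of \<open>z\<^sup>\<alpha>\<close> in \<open>c(z\<^sub>0) \<cdots> c(z\<^bsub>N-1\<^esub>) \<Prod>\<^bsub>i\<in>I\<^esub> x(z\<^sub>i)\<close>.\<close>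

definition gen_coeff :: "nat \<Rightarrow> nat multiset \<Rightarrow> (nat \<Rightarrow> nat) \<Rightarrow> bpoly" where
  "gen_coeff N I \<alpha> = (\<Prod>i<N. fps_nth (yser * xser ^ count I i) (\<alpha> i))"

lemma graded_gen_coeff: "gen_coeff N I \<alpha> \<in> graded N"
proof -
  have "(\<Prod>i<n. fps_nth (yser * xser ^ count I i) (\<alpha> i)) \<in> graded n" for n
  proof (induction n)
    case 0
    then show ?case using graded_scalar[of 1] by simp
  next
    case (Suc n)
    then show ?case using graded_mult[OF Suc graded_coeff] by (simp add: mult.commute)
  qed
  then show ?thesis by (simp add: gen_coeff_def)
qed

lemma gen_coeff_add:
  assumes "i < N"
  shows "gen_coeff N (add_mset i I) \<alpha> = (\<Sum>l\<le>\<alpha> i. xvar l * gen_coeff N I (\<alpha>(i := \<alpha> i - l)))"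
proof -
  let ?F = "\<lambda>I i a. fps_nth (yser * xser ^ count I i) a"
  have split: "gen_coeff N I \<alpha> = ?F I i (\<alpha> i) * (\<Prod>k\<in>{..<N} - {i}. ?F I k (\<alpha> k))" for I \<alpha>
    unfolding gen_coeff_def using assms by (subst prod.remove[of _ i]) auto
  have xser_mult: "fps_nth (xser * F) a = (\<Sum>l\<le>a. xvar l * fps_nth F (a - l))" for F a
    by (simp add: fps_mult_nth xser_def atLeast0AtMost)
  have "yser * xser ^ count (add_mset i I) i = xser * (yser * xser ^ count I i)" by (simp add: mult_ac)
  then have "?F (add_mset i I) i a = (\<Sum>l\<le>a. xvar l * ?F I i (a - l))" for a
    by (simp only: xser_mult)
  moreover have "(\<Prod>k\<in>{..<N} - {i}. ?F (add_mset i I) k (\<alpha> k)) =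
      (\<Prod>k\<in>{..<N} - {i}. ?F I k (if k = i then b else \<alpha> k))" for b
    by (intro prod.cong) auto
  ultimately show ?thesis
    by (simp add: split fun_upd_def sum_distrib_right sum_distrib_left mult_ac)
qed

text \<open>Induction over \<open>\<nu>\<close> converts values \<open>x(z\<^sub>i)\<close> into coefficients \<open>x\<^sub>j\<close> one at a time. Modulo the ideal,
\<open>x(z\<^sub>i) = \<Sum>\<^bsub>l<N\<^esub> x\<^sub>l z\<^sub>i\<^sup>l\<close>; by induction all these values, multiplied by the remaining factors, are
reachable, and interpolation through the \<open>N\<close> points makes each \<open>x\<^sub>j\<close> reachable.\<close>

lemma reachable_product:
  assumes "\<forall>j\<in>#\<nu>. j < N" "\<forall>i\<in>#I. i < N"
  shows "(\<Prod>j\<in>#\<nu>. xvar j) * gen_coeff N I \<alpha> \<in> reachable N"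
  using assms
proof (induction \<nu> arbitrary: I \<alpha>)
  case empty
  then show ?case by (simp add: graded_gen_coeff graded_reachable)
next
  case (add j \<nu>)
  let ?X = "(\<Prod>j\<in>#\<nu>. xvar j)"
  let ?g = "\<lambda>l \<alpha>. ?X * (xvar l * gen_coeff N I \<alpha>)"
  have "?g j \<alpha> \<in> reachable N"
  proof (rule reachable.interpolation[where n = N and g = ?g])
    fix i \<alpha> assume i: "i < N"
    let ?h = "\<lambda>l. ?g l (\<alpha>(i := \<alpha> i - l))"
    \<comment> \<open>The part of \<open>x(z\<^sub>i)\<close> of degree at least \<open>N\<close> is invisible modulo the ideal.\<close>
    have high: "(\<Sum>l\<in>{N..\<alpha> i}. ?h l) \<in> reachable N"
    proof (intro reachable.sum_mem high_ideal_reachable)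
      fix l assume "l \<in> {N..\<alpha> i}"
      then show "?h l \<in> high_ideal N"
        using high_ideal_mult[OF high_ideal_xvar[of N l], of "?X * gen_coeff N I (\<alpha>(i := \<alpha> i - l))"]
        by (simp add: mult_ac)
    qed
    have all: "?X * gen_coeff N (add_mset i I) \<alpha> \<in> reachable N"
      using add.prems i by (intro add.IH) auto
    have "?X * gen_coeff N (add_mset i I) \<alpha> = (\<Sum>l\<le>\<alpha> i. ?h l)"
      using i by (simp only: gen_coeff_add sum_distrib_left)
    also have "{..\<alpha> i} = ({..<N} \<inter> {..\<alpha> i}) \<union> {N..\<alpha> i}" by auto
    also have "sum ?h \<dots> = sum ?h ({..<N} \<inter> {..\<alpha> i}) + (\<Sum>l\<in>{N..\<alpha> i}. ?h l)"
      by (rule sum.union_disjoint) auto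
    also have "sum ?h ({..<N} \<inter> {..\<alpha> i}) = (\<Sum>l<N. shift i l (?g l) \<alpha>)"
      by (rule sum.mono_neutral_cong_left) (auto simp: shift_def)
    finally have "(\<Sum>l<N. shift i l (?g l) \<alpha>) =
        ?X * gen_coeff N (add_mset i I) \<alpha> - (\<Sum>l\<in>{N..\<alpha> i}. ?h l)"
      by (simp only: add_diff_cancel_right')
    also have "\<dots> \<in> reachable N" using all high by (rule reachable.diff_mem)
    finally show "(\<Sum>l<N. shift i l (?g l) \<alpha>) \<in> reachable N" .
  qed (use add.prems in simp)
  then show ?case by (simp add: mult_ac)
qed

lemma single_exponent:
  "Poly_Mapping.single (exponent \<mu> \<nu>) 1 = (\<Prod>i\<in>#\<mu>. yvar i) * (\<Prod>j\<in>#\<nu>. xvar j)"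
proof -
  have split: "Poly_Mapping.single (a + b) 1 = Poly_Mapping.single a 1 * (Poly_Mapping.single b 1 :: bpoly)" for a b
    by (simp add: mult_single)
  have "Poly_Mapping.single (\<Sum>i\<in>#\<mu>. Poly_Mapping.single (f i) 1) 1 = (\<Prod>i\<in>#\<mu>. var (f i))" for f and \<mu> :: "nat multiset"
    by (induction \<mu>) (simp_all add: var_def split)
  then show ?thesis by (simp only: exponent_def split)
qed

text \<open>Taking no values \<open>x(z\<^sub>i)\<close> at all, and for \<open>\<alpha>\<close> an enumeration of \<open>\<mu>\<close>, gives the monomial itself.\<close>

lemma reachable_single:
  assumes "size \<mu> = N" "\<forall>x\<in>#\<nu>. x < N"
  shows "Poly_Mapping.single (exponent \<mu> \<nu>) c \<in> reachable N"
proof -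
  obtain xs where xs: "mset xs = \<mu>" using ex_mset by blast
  have "(\<Prod>i\<in>#\<mu>. yvar i) = (\<Prod>i<N. yvar (xs ! i))"
    using xs assms(1) by (simp add: xs[symmetric] prod_mset_prod_list mset_map[symmetric] prod.list_conv_set_nth
        atLeast0LessThan del: mset_map)
  also have "\<dots> = gen_coeff N {#} (\<lambda>i. xs ! i)"
    by (simp add: gen_coeff_def yser_def)
  finally have "Poly_Mapping.single (exponent \<mu> \<nu>) 1 = (\<Prod>j\<in>#\<nu>. xvar j) * gen_coeff N {#} (\<lambda>i. xs ! i)"
    by (simp add: single_exponent mult.commute)
  also have "\<dots> \<in> reachable N" using reachable_product[of \<nu> N "{#}"] assms by simp
  finally have "scalar c * Poly_Mapping.single (exponent \<mu> \<nu>) 1 \<in> reachable N" by (rule reachable_scalar)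
  then show ?thesis by (simp add: mult_single)
qed

text \<open>The relevant monomials of \<open>p\<close> are matched by some \<open>q\<close> in \<open>K\<close>; since \<open>p - q\<close> again has divisible gradient,
uniqueness extends the agreement to the whole component of degree \<open>N\<close>.\<close>

lemma graded_part_exists:
  assumes "divisible_gradient p"
  shows "\<exists>q\<in>graded N. \<forall>\<mu> \<nu>. size \<mu> = N \<longrightarrow>
    Poly_Mapping.lookup p (exponent \<mu> \<nu>) = Poly_Mapping.lookup q (exponent \<mu> \<nu>)"
proof -
  define S where "S = {m \<in> Poly_Mapping.keys p. \<exists>\<mu> \<nu>. m = exponent \<mu> \<nu> \<and> size \<mu> = N \<and> (\<forall>x\<in>#\<nu>. x < N)}"
  define p0 where "p0 = (\<Sum>m\<in>S. Poly_Mapping.single m (Poly_Mapping.lookup p m))"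
  have "p0 \<in> reachable N"
    unfolding p0_def by (intro reachable.sum_mem) (auto simp: S_def intro!: reachable_single)
  then obtain q where q: "q \<in> graded N" "p0 - q \<in> high_ideal N" unfolding reachable_def by blast
  have "finite S" by (simp add: S_def)
  have "Poly_Mapping.lookup (p - q) (exponent \<mu> \<nu>) = 0" if "size \<mu> = N" "\<forall>x\<in>#\<nu>. x < N" for \<mu> \<nu>
  proof -
    have "Poly_Mapping.lookup p0 (exponent \<mu> \<nu>) = (if exponent \<mu> \<nu> \<in> S then Poly_Mapping.lookup p (exponent \<mu> \<nu>) else 0)"
      using \<open>finite S\<close> by (simp add: p0_def lookup_sum lookup_single when_def)
    also have "\<dots> = Poly_Mapping.lookup p (exponent \<mu> \<nu>)"
      using that by (auto simp: S_def in_keys_iff)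
    finally have "Poly_Mapping.lookup (p - q) (exponent \<mu> \<nu>) = Poly_Mapping.lookup (p0 - q) (exponent \<mu> \<nu>)"
      by (simp add: lookup_minus)
    also have "\<dots> = 0"
    proof (rule ccontr)
      assume "Poly_Mapping.lookup (p0 - q) (exponent \<mu> \<nu>) \<noteq> 0"
      then have "exponent \<mu> \<nu> \<in> Poly_Mapping.keys (p0 - q)" by (simp add: in_keys_iff)
      then obtain j where "j \<ge> N" "Poly_Mapping.lookup (exponent \<mu> \<nu>) (2 * j) \<noteq> 0"
        using q(2) unfolding high_ideal_def by blast
      with that(2) show False by (auto simp: count_eq_zero_iff)
    qed
    finally show ?thesis .
  qed
  moreover have "divisible_gradient (p - q)" using assms q(1) by (simp add: graded_def divisible_gradient_diff)
  ultimately have "Poly_Mapping.lookup (p - q) (exponent \<mu> \<nu>) = 0" if "size \<mu> = N" for \<mu> \<nu>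
    using divisible_gradient_unique[of "p - q" N] that by blast
  then show ?thesis using q(1) by (auto simp: lookup_minus)
qed

theorem divisible_gradient_mem:
  assumes "divisible_gradient p"
  shows "p \<in> K"
proof -
  obtain q where q: "q N \<in> graded N"
    "size \<mu> = N \<Longrightarrow> Poly_Mapping.lookup p (exponent \<mu> \<nu>) = Poly_Mapping.lookup (q N) (exponent \<mu> \<nu>)" for N \<mu> \<nu>
    using graded_part_exists[OF assms] by metis
  define Z where "Z = {N. \<exists>\<mu> \<nu>. exponent \<mu> \<nu> \<in> Poly_Mapping.keys p \<and> size \<mu> = N}"
  have "Z = (\<lambda>(\<mu>, \<nu>). size \<mu>) ` ((\<lambda>(\<mu>, \<nu>). exponent \<mu> \<nu>) -` Poly_Mapping.keys p)"
    by (auto simp: Z_def image_iff)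
  then have "finite Z"
    by (simp only:) (intro finite_imageI finite_vimageI, auto simp: inj_def)
  have "p = (\<Sum>N\<in>Z. q N)"
  proof (rule poly_mapping_eqI)
    fix m
    obtain \<mu> \<nu> where m: "m = exponent \<mu> \<nu>" by (rule exponent_cases)
    have other: "Poly_Mapping.lookup (q N) m = 0" if "N \<noteq> size \<mu>" for N
    proof (rule ccontr)
      assume "Poly_Mapping.lookup (q N) m \<noteq> 0"
      then have "m \<in> Poly_Mapping.keys (q N)" by (simp add: in_keys_iff)
      then obtain \<mu>' \<nu>' where "m = exponent \<mu>' \<nu>'" "size \<mu>' = N"
        using q(1)[of N] unfolding graded_def y_homogeneous_def by blast
      with that m show False by simp
    qed
    have "Poly_Mapping.lookup (\<Sum>N\<in>Z. q N) m = (\<Sum>N\<in>Z. if N = size \<mu> then Poly_Mapping.lookup p m else 0)"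
      unfolding lookup_sum by (intro sum.cong refl) (use other q(2) m in auto)
    also have "\<dots> = Poly_Mapping.lookup p m"
      using \<open>finite Z\<close> m by (auto simp: Z_def in_keys_iff)
    finally show "Poly_Mapping.lookup p m = Poly_Mapping.lookup (\<Sum>N\<in>Z. q N) m" ..
  qed
  also have "\<dots> \<in> K"
    using q(1) by (intro sum_mem) (simp add: graded_def)
  finally show ?thesis .
qed

end

section \<open>Change of coordinates from \<open>(x, y)\<close> to \<open>(x, c)\<close>\<close>

definition msubst :: "(nat \<Rightarrow> bpoly) \<Rightarrow> (nat \<Rightarrow>\<^sub>0 nat) \<Rightarrow> bpoly" where
  "msubst f m = (\<Prod>n\<in>Poly_Mapping.keys m. f n ^ Poly_Mapping.lookup m n)"

definition substitute :: "(nat \<Rightarrow> bpoly) \<Rightarrow> bpoly \<Rightarrow> bpoly" where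
  "substitute f p = (\<Sum>m\<in>Poly_Mapping.keys p. scalar (Poly_Mapping.lookup p m) * msubst f m)"

lemma msubst_superset:
  "finite A \<Longrightarrow> Poly_Mapping.keys m \<subseteq> A \<Longrightarrow> msubst f m = (\<Prod>n\<in>A. f n ^ Poly_Mapping.lookup m n)"
  unfolding msubst_def by (rule prod.mono_neutral_left) (auto simp: in_keys_iff)

lemma msubst_add: "msubst f (m + m') = msubst f m * msubst f m'"
proof -
  let ?A = "Poly_Mapping.keys m \<union> Poly_Mapping.keys m'"
  have "Poly_Mapping.keys (m + m') \<subseteq> ?A" by (rule keys_add)
  then show ?thesis
    by (simp add: msubst_superset[of ?A] lookup_add power_add prod.distrib)
qed

lemma substitute_superset:
  "finite A \<Longrightarrow> Poly_Mapping.keys p \<subseteq> A \<Longrightarrow>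
    substitute f p = (\<Sum>m\<in>A. scalar (Poly_Mapping.lookup p m) * msubst f m)"
  unfolding substitute_def by (rule sum.mono_neutral_left) (auto simp: in_keys_iff)

lemma substitute_add: "substitute f (p + q) = substitute f p + substitute f q"
proof -
  let ?A = "Poly_Mapping.keys p \<union> Poly_Mapping.keys q"
  have "Poly_Mapping.keys (p + q) \<subseteq> ?A" by (rule keys_add)
  then show ?thesis
    by (simp add: substitute_superset[of ?A] lookup_add single_add distrib_right sum.distrib)
qed

lemma substitute_0 [simp]: "substitute f 0 = 0"
  by (simp add: substitute_def)

lemma substitute_single: "substitute f (Poly_Mapping.single m c) = scalar c * msubst f m"
  by (subst substitute_superset[of "{m}"]) auto

lemma substitute_mult: "substitute f (p * q) = substitute f p * substitute f q"
proof (induction p rule: poly_induct)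
  case (3 m c)
  show ?case
  proof (induction q rule: poly_induct)
    case (3 m' c')
    have "scalar (c * c') = scalar c * scalar c'" by (simp add: mult_single)
    then show ?case by (simp add: mult_single substitute_single msubst_add mult_ac)
  qed (simp_all add: distrib_left substitute_add)
qed (simp_all add: distrib_right substitute_add)

lemma substitute_scalar [simp]: "substitute f (scalar c) = scalar c"
  by (simp add: substitute_single msubst_def)

lemma substitute_var [simp]: "substitute f (var n) = f n"
  by (simp add: var_def substitute_single msubst_def)

lemma substitute_diff: "substitute f (p - q) = substitute f p - substitute f q"
  using substitute_add[of f "p - q" q] by (simp add: algebra_simps)

lemma substitute_1 [simp]: "substitute f 1 = 1"
  using substitute_scalar[of f 1] by simp

lemma substitute_uminus: "substitute f (- p) = - substitute f p"
  using substitute_diff[of f 0 p] by simp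

lemma substitute_sum: "substitute f (sum g A) = (\<Sum>x\<in>A. substitute f (g x))"
  by (induction A rule: infinite_finite_induct) (simp_all add: substitute_add)

lemma bpoly_induct [case_names scalar add var]:
  assumes scalar: "\<And>c. P (scalar c)"
    and add: "\<And>p q. P p \<Longrightarrow> P q \<Longrightarrow> P (p + q)"
    and var: "\<And>n p. P p \<Longrightarrow> P (var n * p)"
  shows "P p"
proof (induction p rule: poly_induct)
  case 1
  then show ?case using scalar[of 0] by simp
next
  case (2 p q)
  then show ?case by (rule add)
next
  case (3 m c)
  have "P (Poly_Mapping.single m 1 * p)" if "P p" for p
    using that
  proof (induction m arbitrary: p rule: poly_induct)
    case 1
    then show ?case by simp
  next
    case (2 m m')
    have "Poly_Mapping.single (m + m') 1 = Poly_Mapping.single m 1 * (Poly_Mapping.single m' 1 :: bpoly)"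
      by (simp add: mult_single)
    then show ?case using 2 by (simp add: mult.assoc)
  next
    case (3 n k)
    show ?case
    proof (induction k)
      case 0
      then show ?case using 3 by simp
    next
      case (Suc k)
      have "Poly_Mapping.single (Poly_Mapping.single n (Suc k)) 1 =
          var n * Poly_Mapping.single (Poly_Mapping.single n k) 1"
        by (simp add: var_def mult_single single_add[symmetric])
      then show ?case using var[OF Suc] by (simp add: mult.assoc)
    qed
  qed
  from this[OF scalar[of c]] show ?case by (simp add: mult_single)
qed

text \<open>Expresses a polynomial in \<open>x, y\<close> through \<open>x\<close> and \<open>c = x + y\<close>, so that \<open>y\<^sub>n\<close> becomes \<open>c\<^sub>n - x\<^sub>n\<close>.
The label \<open>n - 1\<close> of an odd \<open>n\<close> is that of \<open>x\<close> with the same index.\<close>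

definition to_central :: "bpoly \<Rightarrow> bpoly" where
  "to_central = substitute (\<lambda>n. if even n then var n else var n - var (n - 1))"

definition from_central :: "bpoly \<Rightarrow> bpoly" where
  "from_central = substitute (\<lambda>n. if even n then var n else var n + var (n - 1))"

lemma from_to_central: "from_central (to_central p) = p"
  by (induction p rule: bpoly_induct)
     (auto simp: to_central_def from_central_def substitute_add substitute_mult substitute_diff)

text \<open>At constant \<open>c\<close>, an increase of \<open>x\<^sub>r\<close> is compensated by a decrease of \<open>y\<^sub>r\<close>.\<close>

lemma pdiff_to_central:
  "pdiff (2 * r) (to_central p) = to_central (pdiff (2 * r) p - pdiff (Suc (2 * r)) p)"
proof (induction p rule: bpoly_induct)
  case (scalar c)
  then show ?case by (simp add: to_central_def)
next
  case (add p q)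
  then show ?case by (simp add: to_central_def substitute_add substitute_diff pdiff_add)
next
  case (var n p)
  have d: "pdiff k (p - q) = pdiff k p - pdiff k q" for k p q
    using pdiff_add[of k p "- q"] by (simp add: pdiff_uminus)
  have "pdiff (2 * r) (to_central (var n)) = to_central (pdiff (2 * r) (var n) - pdiff (Suc (2 * r)) (var n))"
  proof (cases "even n")
    case True
    then have "n \<noteq> Suc (2 * r)" by presburger
    then show ?thesis using True by (simp add: to_central_def pdiff_var)
  next
    case False
    then have "n \<noteq> 2 * r" "2 * r = n - 1 \<longleftrightarrow> Suc (2 * r) = n" by presburger+
    then show ?thesis using False by (simp add: to_central_def pdiff_var d substitute_diff substitute_uminus)
  qed
  moreover have hom: "to_central (a * b) = to_central a * to_central b"
    "to_central (a + b) = to_central a + to_central b"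
    "to_central (a - b) = to_central a - to_central b" for a b
    by (simp_all add: to_central_def substitute_mult substitute_add substitute_diff)
  ultimately show ?case
    using var by (simp only: hom pdiff_mult) (simp add: algebra_simps)
qed

definition fps_from_central :: "bpoly fps \<Rightarrow> bpoly fps" where
  "fps_from_central F = Abs_fps (\<lambda>n. from_central (fps_nth F n))"

lemma fps_from_central_mult: "fps_from_central (F * G) = fps_from_central F * fps_from_central G"
  by (rule fps_ext) (simp add: fps_from_central_def fps_mult_nth from_central_def substitute_sum substitute_mult)

lemma fps_from_central_coeff:
  "fps_from_central (yser * xser ^ k) = (xser + yser) * xser ^ k"
proof -
  have one: "fps_from_central 1 = 1"
    by (intro fps_ext) (simp add: fps_from_central_def from_central_def)
  have x: "fps_from_central xser = xser"
    by (rule fps_ext) (simp add: fps_from_central_def from_central_def xser_def)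
  have c: "fps_from_central yser = xser + yser"
    by (rule fps_ext) (simp add: fps_from_central_def from_central_def xser_def yser_def add.commute)
  have "fps_from_central (xser ^ k) = xser ^ k"
    by (induction k) (simp_all add: one fps_from_central_mult x)
  then show ?thesis by (simp add: fps_from_central_mult c)
qed

section \<open>Generation in the original coordinates\<close>

context bpoly_subalgebra
begin

definition series :: "bpoly fps set" where
  "series = {F. \<forall>n. fps_nth F n \<in> K}"

lemma series_add: "F \<in> series \<Longrightarrow> G \<in> series \<Longrightarrow> F + G \<in> series"
  by (simp add: series_def add_mem)

lemma series_mult: "F \<in> series \<Longrightarrow> G \<in> series \<Longrightarrow> F * G \<in> series"
  by (auto simp: series_def fps_mult_nth intro!: sum_mem mult_mem)

lemma series_scale: "F \<in> series \<Longrightarrow> fps_const (scalar c) * F \<in> series"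
  by (simp add: series_def mult_mem scalar_mem)

lemma series_diff: "F \<in> series \<Longrightarrow> G \<in> series \<Longrightarrow> F - G \<in> series"
proof -
  assume F: "F \<in> series" and G: "G \<in> series"
  have "fps_const (scalar (- 1)) * G = - G" by (rule fps_ext) (simp add: single_uminus)
  then show "F - G \<in> series" using series_add[OF F series_scale[OF G, of "- 1"]] by simp
qed

lemma series_sum: "finite A \<Longrightarrow> A \<noteq> {} \<Longrightarrow> (\<And>x. x \<in> A \<Longrightarrow> f x \<in> series) \<Longrightarrow> sum f A \<in> series"
  by (induction A rule: finite_ne_induct) (auto intro: series_add)

text \<open>The gradient condition carried back to the coordinates \<open>x, y\<close>, in which bodies of invariants are given.\<close>

lemma central_divisible_gradient_mem:
  assumes gen: "\<And>k. (xser + yser) * xser ^ k \<in> series"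
    and bound: "\<And>j. j \<ge> J \<Longrightarrow> R j = 0"
    and eq: "\<And>r. pdiff (2 * r) p - pdiff (Suc (2 * r)) p = (\<Sum>i<J. (xvar i + yvar i) * R (i + r))"
  shows "p \<in> K"
proof -
  interpret K': affine_subalgebra "{q. from_central q \<in> K}"
  proof
    show "fps_nth (yser * xser ^ k) n \<in> {q. from_central q \<in> K}" for k n
      using gen[of k] unfolding fps_from_central_coeff[symmetric]
      by (simp add: series_def fps_from_central_def)
  qed (simp_all add: from_central_def substitute_add substitute_mult scalar_mem add_mem mult_mem)
  have "divisible_gradient (to_central p)"
  proof (rule divisible_gradientI[where R = "\<lambda>j. to_central (R j)"])
    show "to_central (R j) = 0" if "j \<ge> J" for j
      using bound[OF that] by (simp add: to_central_def)
    fix r J' assume "J' \<ge> J"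
    have "pdiff (2 * r) (to_central p) = to_central (\<Sum>i<J. (xvar i + yvar i) * R (i + r))"
      by (simp only: pdiff_to_central eq)
    also have "(\<Sum>i<J. (xvar i + yvar i) * R (i + r)) = (\<Sum>i<J'. (xvar i + yvar i) * R (i + r))"
      by (rule sum.mono_neutral_left) (use \<open>J' \<ge> J\<close> bound in auto)
    finally show "pdiff (2 * r) (to_central p) = (\<Sum>i<J'. yvar i * to_central (R (i + r)))"
      by (simp add: to_central_def substitute_sum substitute_mult substitute_add)
  qed
  then have "to_central p \<in> {q. from_central q \<in> K}" by (rule K'.divisible_gradient_mem)
  then show ?thesis by (simp add: from_to_central)
qed

text \<open>With \<open>c = F + G\<close> one has \<open>c F\<^bsup>k+1\<^esup> G\<^sup>j = c \<cdot> c F\<^sup>k G\<^sup>j - c F\<^sup>k G\<^bsup>j+1\<^esup>\<close>, which trades powers of \<open>G\<close> for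
powers of \<open>F\<close>.\<close>

lemma series_from_b:
  assumes "\<And>k. (F + G) * G ^ k \<in> series"
  shows "(F + G) * F ^ k \<in> series"
proof -
  have "(F + G) * F ^ k * G ^ j \<in> series" for j
  proof (induction k arbitrary: j)
    case 0
    then show ?case using assms by simp
  next
    case (Suc k)
    have eq: "(F + G) * F ^ Suc k * G ^ j =
        (F + G) * ((F + G) * F ^ k * G ^ j) - (F + G) * F ^ k * G ^ Suc j"
      by (simp add: algebra_simps)
    have "F + G \<in> series" using assms[of 0] by simp
    from series_diff[OF series_mult[OF this Suc[of j]] Suc[of "Suc j"]] show ?case
      by (simp only: eq)
  qed
  from this[of 0] show ?thesis by simp
qed

text \<open>Let \<open>c = F + G\<close> and \<open>u\<^sub>i\<^sub>j = c F\<^sup>i (-G)\<^sup>j\<close>. The hypothesis supplies the sum of the \<open>u\<^sub>i\<^sub>j\<close> with \<open>i + j = n\<close>, and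
\<open>u\<^bsub>i+1,j\<^esub> - u\<^bsub>i,j+1\<^esub> = c u\<^sub>i\<^sub>j\<close> shows by induction on \<open>n\<close> that these \<open>n + 1\<close> terms are congruent.
As \<open>n + 1\<close> is invertible, each of them is in the algebra.\<close>

lemma series_from_s:
  assumes "\<And>k. k \<ge> 1 \<Longrightarrow> F ^ k - (- G) ^ k \<in> series"
  shows "(F + G) * F ^ k \<in> series"
proof -
  define u where "u i j = (F + G) * F ^ i * (- G) ^ j" for i j
  have c: "F + G \<in> series" using assms[of 1] by simp
  have "u i j \<in> series" if "i + j = n" for i j n
    using that
  proof (induction n arbitrary: i j rule: less_induct)
    case (less n)
    have step: "u (Suc i) j - u i (Suc j) \<in> series" if "Suc (i + j) = n" for i j
    proof -
      have "u (Suc i) j - u i (Suc j) = (F + G) * u i j" by (simp add: u_def algebra_simps)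
      then show ?thesis using series_mult[OF c less.IH[of "i + j" i j]] that by simp
    qed
    have zero: "0 \<in> series" by (simp add: series_def zero_mem)
    have top: "u n 0 - u (n - l) l \<in> series" if "l \<le> n" for l
      using that
    proof (induction l)
      case 0
      then show ?case by (simp add: zero)
    next
      case (Suc l)
      have "u (n - l) l - u (n - Suc l) (Suc l) \<in> series"
        using step[of "n - Suc l" l] Suc.prems by (simp add: Suc_diff_Suc)
      moreover have "u n 0 - u (n - l) l \<in> series" using Suc by simp
      ultimately have "(u n 0 - u (n - l) l) + (u (n - l) l - u (n - Suc l) (Suc l)) \<in> series"
        by (intro series_add)
      then show ?case by simp
    qed
    have "(\<Sum>l\<le>n. u (n - l) l) = F ^ Suc n - (- G) ^ Suc n"
    proof -
      have "(- G) ^ Suc n - F ^ Suc n = (- G - F) * (\<Sum>l<Suc n. (- G) ^ l * F ^ (n - l))"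
        by (rule diff_power_eq_sum)
      then have "F ^ Suc n - (- G) ^ Suc n = (F + G) * (\<Sum>l<Suc n. F ^ (n - l) * (- G) ^ l)"
        by (simp only: mult.commute[of "_ ^ _" "_ ^ _"]) (simp add: algebra_simps)
      then show ?thesis by (simp only: u_def sum_distrib_left lessThan_Suc_atMost mult.assoc)
    qed
    then have "(\<Sum>l\<le>n. u (n - l) l) \<in> series"
      using assms[of "Suc n"] by (simp only: le_add1 plus_1_eq_Suc[symmetric])
    moreover have "(\<Sum>l\<le>n. u n 0 - u (n - l) l) \<in> series"
      using top by (intro series_sum) auto
    ultimately have "(\<Sum>l\<le>n. u (n - l) l) + (\<Sum>l\<le>n. u n 0 - u (n - l) l) \<in> series"
      by (rule series_add)
    then have "of_nat (Suc n) * u n 0 \<in> series"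
      by (simp add: sum_subtractf)
    then have "fps_const (scalar (1 / of_nat (Suc n))) * (of_nat (Suc n) * u n 0) \<in> series"
      by (rule series_scale)
    moreover have "fps_const (scalar (1 / of_nat (Suc n))) * (of_nat (Suc n)) = 1"
    proof -
      have "of_nat (Suc n) = fps_const (scalar (of_nat (Suc n)))"
        by (simp only: single_of_nat fps_of_nat)
      moreover have "scalar (1 / of_nat (Suc n)) * scalar (of_nat (Suc n)) = 1"
        by (subst mult_single) (simp del: of_nat_Suc)
      ultimately show ?thesis by (simp only: fps_const_mult fps_const_1_eq_1)
    qed
    ultimately have "u n 0 \<in> series" by (simp add: mult.assoc[symmetric])
    then have "u n 0 - (u n 0 - u (n - j) j) \<in> series"
      using less.prems by (intro series_diff top) auto
    moreover have "i = n - j" using less.prems by simp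
    ultimately show ?case by simp
  qed
  from this[of k 0] show ?thesis by (simp add: u_def)
qed

end

section \<open>The action in terms of derivatives\<close>

definition body :: "superalg \<Rightarrow> bpoly" where
  "body P = gcoeff P {}"

lemma body_add: "body (f + g) = body f + body g"
  and body_diff: "body (f - g) = body f - body g"
  and body_mult: "body (f * g) = body f * body g"
  and body_gconst: "body (gconst c) = c"
  by (simp_all add: body_def gcoeff_mult gconst_def gcoeff_gmonom)

lemma E_gens:
  "E 1 1 (- int n - 1) = gconst (xvar n)"
  "E 2 2 (- int n - 1) = gconst (yvar n)"
  "E 1 2 (- int n - 1) = theta (2 * n)"
  "E 2 1 (- int n - 1) = theta (Suc (2 * n))"
  by (simp_all add: E_def label_def par_def var_def)

lemma gcoeff_theta_mult:
  "gcoeff (theta a * g) A = (if a \<in> A then shuffle_sign {a} (A - {a}) * gcoeff g (A - {a}) else 0)"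
  for g :: "('r::comm_ring_1, 'o::linorder) grassmann"
proof (cases "finite A")
  case True
  have "gcoeff (theta a * g) A =
      (\<Sum>B\<in>Pow A. if B = {a} then shuffle_sign {a} (A - {a}) * gcoeff g (A - {a}) else 0)"
    unfolding gcoeff_mult by (intro sum.cong refl) (auto simp: theta_def gcoeff_gmonom)
  then show ?thesis using True by (simp add: sum.delta)
next
  case False
  then show ?thesis by (simp add: gcoeff_infinite)
qed

lemma act_gens:
  "act i j (int r) (gconst (xvar n)) = ad_E i j (int r) 1 1 (- int n - 1)"
  "act i j (int r) (gconst (yvar n)) = ad_E i j (int r) 2 2 (- int n - 1)"
  "act i j (int r) (theta (2 * n)) = ad_E i j (int r) 1 2 (- int n - 1)"
  "act i j (int r) (theta (Suc (2 * n))) = ad_E i j (int r) 2 1 (- int n - 1)"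
  by (simp_all only: E_gens[symmetric]) (rule act_E; simp)+

lemma even_gen_cases: obtains k m where "gconst (var n) = E k k (- int m - 1)"
proof (cases "even n")
  case True
  then show ?thesis using that[of 1 "n div 2"] by (simp add: E_gens)
next
  case False
  then show ?thesis using that[of 2 "n div 2"] by (simp add: E_gens)
qed

lemma odd_gen_cases: obtains k l m where "par k + par l = 1" "theta n = E k l (- int m - 1)"
proof (cases "even n")
  case True
  then show ?thesis using that[of 1 2 "n div 2"] by (simp add: E_gens par_def)
next
  case False
  then show ?thesis using that[of 2 1 "n div 2"] by (simp add: E_gens par_def)
qed

text \<open>Both sides are superderivations of the same parity with the same values on generators.\<close>

lemma act_eq_derivation_of:
  "act i j r = derivation_of (\<lambda>n. act i j r (gconst (var n))) (\<lambda>n. act i j r (theta n))"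
proof -
  let ?D = "derivation_of (\<lambda>n. act i j r (gconst (var n))) (\<lambda>n. act i j r (theta n))"
  have "homogeneous (par i + par j) (act i j r (gconst (var n)))" for n
  proof -
    obtain k m where "gconst (var n) = E k k (- int m - 1)" by (rule even_gen_cases)
    then have "act i j r (gconst (var n)) = ad_E i j r k k (- int m - 1)" by (simp add: act_E)
    then show ?thesis using homogeneous_cong[OF _ homogeneous_ad_E[of i j k k r "- int m - 1"]] by simp
  qed
  moreover have "homogeneous (Suc (par i + par j)) (act i j r (theta n))" for n
  proof -
    obtain k l m where kl: "par k + par l = 1" "theta n = E k l (- int m - 1)" by (rule odd_gen_cases)
    then have "act i j r (theta n) = ad_E i j r k l (- int m - 1)" by (simp add: act_E)
    then show ?thesis using homogeneous_ad_E[of i j k l r "- int m - 1"] kl(1) by simp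
  qed
  ultimately have "superderivation (par i + par j) ?D"
    by (rule superderivation_derivation_of)
  moreover have "?D (E k l s) = ad_E i j r k l s" if "s < 0" for k l s
  proof -
    have "?D (E k l s) = act i j r (E k l s)"
      using that derivation_of_even[of "\<lambda>n. act i j r (gconst (var n))"]
      by (simp add: E_def derivation_of_odd var_def)
    then show ?thesis using act_E[OF that] by simp
  qed
  ultimately show ?thesis
    using ex1_act[of i j r] superderivation_act[of i j r] act_E[of _ i j r] by blast
qed

lemma sum_even_odd: "(\<Sum>k<2 * M. F k) = (\<Sum>n<M. F (2 * n) + F (Suc (2 * n)))" for F :: "nat \<Rightarrow> 'a::comm_monoid_add"
  by (induction M) (simp_all add: add.assoc)

text \<open>After re-indexing, \<open>E\<^sub>i\<^sub>j[r]\<close> no longer shows the truncation \<open>n < r\<close>; the terms that are added at the upper end vanish.\<close>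

lemma sum_window:
  fixes T :: "nat \<Rightarrow> 'a::comm_monoid_add"
  assumes "\<And>i. i + r \<ge> M \<Longrightarrow> T i = 0"
  shows "(\<Sum>n<M. if n < r then 0 else T (n - r)) = (\<Sum>i<M. T i)"
proof -
  have "(\<Sum>n<M. if n < r then 0 else T (n - r)) = (\<Sum>n\<in>{r..<M}. T (n - r))"
    by (rule sum.mono_neutral_cong_right) auto
  also have "\<dots> = (\<Sum>i\<in>{..<M - r}. T i)"
    by (rule sum.reindex_bij_witness[where i = "\<lambda>i. i + r" and j = "\<lambda>n. n - r"]) auto
  also have "\<dots> = (\<Sum>i<M. T i)"
    by (rule sum.mono_neutral_left) (use assms in auto)
  finally show ?thesis .
qed

lemma derivs_bounded:
  "\<exists>M. \<forall>n\<ge>M. even_deriv n f = 0 \<and> odd_deriv n f = 0"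
proof -
  have "finite {n. even_deriv n f \<noteq> 0 \<or> odd_deriv n f \<noteq> 0}" by (rule finite_deriv)
  then obtain M where "{n. even_deriv n f \<noteq> 0 \<or> odd_deriv n f \<noteq> 0} \<subseteq> {..<M}"
    unfolding finite_nat_iff_bounded by blast
  then show ?thesis by (intro exI[of _ M]) auto
qed

lemma act_expand:
  assumes M: "\<And>n. n \<ge> M \<Longrightarrow> even_deriv n f = 0 \<and> odd_deriv n f = 0"
  shows "act i j (int r) f = (\<Sum>n<M.
    ad_E i j (int r) 1 1 (- int n - 1) * even_deriv (2 * n) f +
    ad_E i j (int r) 1 2 (- int n - 1) * odd_deriv (2 * n) f +
    (ad_E i j (int r) 2 2 (- int n - 1) * even_deriv (Suc (2 * n)) f +
    ad_E i j (int r) 2 1 (- int n - 1) * odd_deriv (Suc (2 * n)) f))"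
proof -
  have "{n. even_deriv n f \<noteq> 0 \<or> odd_deriv n f \<noteq> 0} \<subseteq> {..<2 * M}"
  proof
    fix n assume "n \<in> {n. even_deriv n f \<noteq> 0 \<or> odd_deriv n f \<noteq> 0}"
    then show "n \<in> {..<2 * M}" using M[of n] by (cases "n \<ge> M") auto
  qed
  then have "act i j (int r) f = (\<Sum>n<2 * M. act i j (int r) (gconst (var n)) * even_deriv n f +
      act i j (int r) (theta n) * odd_deriv n f)"
    by (subst act_eq_derivation_of) (intro derivation_of_eq, auto)
  then show ?thesis by (simp only: sum_even_odd act_gens)
qed

lemma E_shift: "E k l (int r + (- int n - 1)) = (if n < r then 0 else E k l (- int (n - r) - 1))"
  by (auto simp: E_def of_nat_diff)

text \<open>The operator \<open>E\<^sub>1\<^sub>2[r]\<close> is \<open>\<Sum>\<^sub>i \<theta>\<^sub>i (\<partial>/\<partial>y\<^bsub>i+r\<^esub> - \<partial>/\<partial>x\<^bsub>i+r\<^esub>) + c\<^sub>i \<partial>/\<partial>\<eta>\<^bsub>i+r\<^esub>\<close>.\<close>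

lemma act_12:
  assumes M: "\<And>n. n \<ge> M \<Longrightarrow> even_deriv n f = 0 \<and> odd_deriv n f = 0"
  shows "act 1 2 (int r) f = (\<Sum>i<M.
    theta (2 * i) * (even_deriv (Suc (2 * (i + r))) f - even_deriv (2 * (i + r)) f) +
    gconst (xvar i + yvar i) * odd_deriv (Suc (2 * (i + r))) f)" (is "_ = (\<Sum>i<M. ?T i)")
proof -
  have "act 1 2 (int r) f = (\<Sum>n<M. if n < r then 0 else ?T (n - r))"
    by (subst act_expand[of M, OF M], assumption, intro sum.cong refl) (unfold ad_E_def E_shift E_gens, auto simp: par_def gconst_add algebra_simps)
  also have "\<dots> = (\<Sum>i<M. ?T i)"
    by (rule sum_window) (use M in auto)
  finally show ?thesis .
qed

text \<open>The operator \<open>E\<^sub>2\<^sub>1[r]\<close> is \<open>\<Sum>\<^sub>i \<eta>\<^sub>i (\<partial>/\<partial>x\<^bsub>i+r\<^esub> - \<partial>/\<partial>y\<^bsub>i+r\<^esub>) + c\<^sub>i \<partial>/\<partial>\<theta>\<^bsub>i+r\<^esub>\<close>.\<close>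

lemma act_21:
  assumes M: "\<And>n. n \<ge> M \<Longrightarrow> even_deriv n f = 0 \<and> odd_deriv n f = 0"
  shows "act 2 1 (int r) f = (\<Sum>i<M.
    theta (Suc (2 * i)) * (even_deriv (2 * (i + r)) f - even_deriv (Suc (2 * (i + r))) f) +
    gconst (xvar i + yvar i) * odd_deriv (2 * (i + r)) f)" (is "_ = (\<Sum>i<M. ?T i)")
proof -
  have "act 2 1 (int r) f = (\<Sum>n<M. if n < r then 0 else ?T (n - r))"
    by (subst act_expand[of M, OF M], assumption, intro sum.cong refl) (unfold ad_E_def E_shift E_gens, auto simp: par_def gconst_add algebra_simps)
  also have "\<dots> = (\<Sum>i<M. ?T i)"
    by (rule sum_window) (use M in auto)
  finally show ?thesis .
qed

section \<open>Invariants and their bodies\<close>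

text \<open>The component of \<open>E\<^sub>1\<^sub>2[r] P\<close> at \<open>\<theta>\<^sub>0\<close> receives the difference of derivatives of the body from \<open>\<theta>\<^sub>0 \<cdot> (\<dots>)\<close>
and, from \<open>c\<^sub>i \<partial>/\<partial>\<eta>\<^bsub>i+r\<^esub>\<close>, the \<open>\<theta>\<^sub>0\<close>-coefficients \<open>R\<^bsub>i+r\<^esub>\<close> of \<open>\<partial>P/\<partial>\<eta>\<^bsub>i+r\<^esub>\<close>; these depend on \<open>i + r\<close> only.\<close>

lemma body_divisible_gradient:
  assumes "P \<in> invariants"
  shows "\<exists>J R. (\<forall>j\<ge>J. R j = 0) \<and> (\<forall>r. pdiff (2 * r) (body P) - pdiff (Suc (2 * r)) (body P) =
    (\<Sum>i<J. (xvar i + yvar i) * R (i + r)))"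
proof -
  obtain M where M: "\<And>n. n \<ge> M \<Longrightarrow> even_deriv n P = 0 \<and> odd_deriv n P = 0"
    using derivs_bounded by blast
  define R where "R j = gcoeff (odd_deriv (Suc (2 * j)) P) {0}" for j
  have "pdiff (2 * r) (body P) - pdiff (Suc (2 * r)) (body P) = (\<Sum>i<Suc M. (xvar i + yvar i) * R (i + r))" for r
  proof -
    have M': "even_deriv n P = 0 \<and> odd_deriv n P = 0" if "n \<ge> Suc M" for n
      using M that by simp
    have "(0::bpoly) = gcoeff (act 1 2 (int r) P) {0}"
      using assms by (simp add: invariants_def)
    also have "\<dots> = (\<Sum>i<Suc M. (if i = 0 then pdiff (Suc (2 * r)) (body P) - pdiff (2 * r) (body P) else 0) +
        (xvar i + yvar i) * R (i + r))"
      by (subst act_12[of "Suc M", OF M'], assumption, unfold gcoeff_sum, intro sum.cong refl) (simp add: gcoeff_theta_mult gcoeff_even_deriv body_def R_def)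
    also have "\<dots> = pdiff (Suc (2 * r)) (body P) - pdiff (2 * r) (body P) + (\<Sum>i<Suc M. (xvar i + yvar i) * R (i + r))"
      by (simp only: sum.distrib) (simp add: sum.delta)
    finally show ?thesis by (simp add: algebra_simps)
  qed
  moreover have "R j = 0" if "j \<ge> Suc M" for j using M[of "Suc (2 * j)"] that by (simp add: R_def)
  ultimately show ?thesis by blast
qed

text \<open>Multiplication by a series with nonzero constant term is injective; the last nonzero \<open>U\<^sub>j\<close> is isolated by taking \<open>r = j\<close>.\<close>

lemma convolution_cancel:
  fixes U :: "nat \<Rightarrow> 'a::idom"
  assumes bound: "\<And>j. j \<ge> M \<Longrightarrow> U j = 0" and "c 0 \<noteq> 0"
    and conv: "\<And>r. (\<Sum>i<M. c i * U (i + r)) = 0"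
  shows "U j = 0"
proof (induction "M - j" arbitrary: j rule: less_induct)
  case less
  show ?case
  proof (cases "j < M")
    case True
    have "(\<Sum>i<M. c i * U (i + j)) = (\<Sum>i<M. if i = 0 then c 0 * U j else 0)"
    proof (intro sum.cong refl)
      fix i show "c i * U (i + j) = (if i = 0 then c 0 * U j else 0)"
        using less[of "i + j"] True by auto
    qed
    then show ?thesis using conv[of j] True \<open>c 0 \<noteq> 0\<close> by (simp add: sum.delta)
  qed (use bound in simp)
qed

lemma central_neq_0: "xvar 0 + yvar 0 \<noteq> 0"
proof
  assume "xvar 0 + yvar 0 = 0"
  then have "pdiff 0 (xvar 0 + yvar 0) = 0" by simp
  then show False by (simp add: pdiff_add pdiff_var)
qed

text \<open>By induction on \<open>|A|\<close>, all coefficients at smaller sets vanish. In the coefficient of \<open>E\<^sub>1\<^sub>2[r] P\<close> at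
\<open>B = A - {a}\<close> the terms \<open>\<theta>\<^sub>i (\<dots>)\<close> see only coefficients of \<open>P\<close> at subsets of \<open>B\<close>, which leaves
\<open>\<Sum>\<^sub>i c\<^sub>i \<partial>P/\<partial>\<eta>\<^bsub>i+r\<^esub>\<close>, and \<open>c\<^sub>0 \<noteq> 0\<close> can be cancelled. The same with \<open>E\<^sub>2\<^sub>1[r]\<close> covers the derivatives
by \<open>\<theta>\<^sub>i\<close>.\<close>

lemma invariant_eq_0:
  assumes P: "P \<in> invariants" and "body P = 0"
  shows "P = 0"
proof (rule grassmann_eqI)
  obtain M where M: "\<And>n. n \<ge> M \<Longrightarrow> even_deriv n P = 0 \<and> odd_deriv n P = 0"
    using derivs_bounded by blast
  fix A
  show "gcoeff P A = gcoeff 0 A"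
  proof (induction "card A" arbitrary: A rule: less_induct)
    case less
    consider "infinite A" | "A = {}" | a where "finite A" "a \<in> A" by auto
    then show ?case
    proof cases
      case 1
      then show ?thesis by (simp add: gcoeff_infinite)
    next
      case 2
      then show ?thesis using \<open>body P = 0\<close> by (simp add: body_def)
    next
      case 3
      define B where "B = A - {a}"
      have small: "gcoeff (even_deriv n P) (B - {b}) = 0" for n b
      proof -
        have "card (B - {b}) \<le> card B" by (rule card_mono) (use 3 in \<open>auto simp: B_def\<close>)
        also have "card B < card A" unfolding B_def using 3 by (intro card_Diff1_less)
        finally show ?thesis using less by (simp add: gcoeff_even_deriv)
      qed
      have od: "gcoeff (odd_deriv n P) B = 0" for n
      proof -
        have "gcoeff (odd_deriv (Suc (2 * j)) P) B = 0" for j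
        proof (rule convolution_cancel[of M "\<lambda>j. gcoeff (odd_deriv (Suc (2 * j)) P) B" "\<lambda>i. xvar i + yvar i"])
          show "(\<Sum>i<M. (xvar i + yvar i) * gcoeff (odd_deriv (Suc (2 * (i + r))) P) B) = 0" for r
          proof -
            have "0 = gcoeff (act 1 2 (int r) P) B" using P by (simp add: invariants_def)
            also have "\<dots> = (\<Sum>i<M. (xvar i + yvar i) * gcoeff (odd_deriv (Suc (2 * (i + r))) P) B)"
              by (subst act_12[of M, OF M], assumption)
                 (simp add: gcoeff_sum gcoeff_theta_mult small cong: if_cong)
            finally show ?thesis by simp
          qed
        qed (use M central_neq_0 in auto)
        moreover have "gcoeff (odd_deriv (2 * j) P) B = 0" for j
        proof (rule convolution_cancel[of M "\<lambda>j. gcoeff (odd_deriv (2 * j) P) B" "\<lambda>i. xvar i + yvar i"])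
          show "(\<Sum>i<M. (xvar i + yvar i) * gcoeff (odd_deriv (2 * (i + r)) P) B) = 0" for r
          proof -
            have "0 = gcoeff (act 2 1 (int r) P) B" using P by (simp add: invariants_def)
            also have "\<dots> = (\<Sum>i<M. (xvar i + yvar i) * gcoeff (odd_deriv (2 * (i + r)) P) B)"
              by (subst act_21[of M, OF M], assumption)
                 (simp add: gcoeff_sum gcoeff_theta_mult small cong: if_cong)
            finally show ?thesis by simp
          qed
        qed (use M central_neq_0 in auto)
        ultimately show ?thesis by (cases "even n") (auto elim!: evenE oddE)
      qed
      have "shuffle_sign {a} B * gcoeff P A = 0"
        using od[of a] 3 by (simp add: odd_deriv.rep_eq B_def insert_absorb)
      then have "shuffle_sign {a} B * (shuffle_sign {a} B * gcoeff P A) = 0" by simp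
      then show ?thesis by (simp add: mult.assoc[symmetric])
    qed
  qed
qed

section \<open>Series in the superalgebra\<close>

text \<open>Series in the even generators commute with all series over the superalgebra. Working with their
preimages in a commutative ring keeps the computations below free of ordering questions.\<close>

definition embed :: "bpoly fps \<Rightarrow> superalg fps" where
  "embed F = Abs_fps (\<lambda>n. gconst (fps_nth F n))"

lemma gconst_0 [simp]: "gconst 0 = 0"
  by (rule grassmann_eqI) (simp add: gconst_def gcoeff_gmonom)

lemma gconst_sum: "gconst (sum f A :: 'r::comm_ring_1) = (\<Sum>x\<in>A. gconst (f x))"
  by (induction A rule: infinite_finite_induct) (simp_all add: gconst_add)

lemma gconst_commute: "gconst c * f = f * gconst c"
  for c :: "'r::comm_ring_1" and f :: "('r, 'o::linorder) grassmann"
proof (rule grassmann_eqI)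
  fix A
  show "gcoeff (gconst c * f) A = gcoeff (f * gconst c) A"
  proof (cases "finite A")
    case True
    have "gcoeff (f * gconst c) A = (\<Sum>B\<in>Pow A. if B = A then c * gcoeff f A else 0)"
      unfolding gcoeff_mult by (intro sum.cong refl) (auto simp: gconst_def gcoeff_gmonom)
    then show ?thesis using True by (simp add: sum.delta)
  qed (simp add: gcoeff_infinite)
qed

lemma embed_mult: "embed (F * G) = embed F * embed G"
  by (rule fps_ext) (simp add: embed_def fps_mult_nth gconst_sum gconst_mult)

lemma embed_add: "embed (F + G) = embed F + embed G"
  by (rule fps_ext) (simp add: embed_def gconst_add)

lemma embed_0 [simp]: "embed 0 = 0"
  by (rule fps_ext) (simp add: embed_def)

lemma embed_1 [simp]: "embed 1 = 1"
  by (rule fps_ext) (simp add: embed_def one_grassmann_def)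

lemma embed_uminus: "embed (- F) = - embed F"
  using embed_add[of F "- F"] by (simp add: minus_unique)

lemma embed_diff: "embed (F - G) = embed F - embed G"
  using embed_add[of F "- G"] by (simp add: embed_uminus)

lemma embed_power: "embed (F ^ n) = embed F ^ n"
  by (induction n) (simp_all add: embed_mult)

lemma embed_of_nat: "embed (of_nat n) = of_nat n"
  by (induction n) (simp_all add: embed_add)

lemma embed_commute: "A * embed F = embed F * A"
proof (rule fps_ext)
  fix n
  have "fps_nth (A * embed F) n = (\<Sum>i=0..n. gconst (fps_nth F (n - i)) * fps_nth A i)"
    by (simp add: fps_mult_nth embed_def gconst_commute)
  also have "\<dots> = (\<Sum>i=0..n. gconst (fps_nth F i) * fps_nth A (n - i))"
    by (rule sum.reindex_bij_witness[where i = "\<lambda>i. n - i" and j = "\<lambda>i. n - i"]) auto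
  finally show "fps_nth (A * embed F) n = fps_nth (embed F * A) n"
    by (simp add: fps_mult_nth embed_def)
qed

lemma Ez_even: "Ez 1 1 = embed xser" "Ez 2 2 = embed yser"
  by (rule fps_ext; simp add: Ez_def embed_def xser_def yser_def E_gens)+

definition fps_act :: "2 \<Rightarrow> 2 \<Rightarrow> nat \<Rightarrow> superalg fps \<Rightarrow> superalg fps" where
  "fps_act i j r F = Abs_fps (\<lambda>n. act i j (int r) (fps_nth F n))"

lemma act_add: "act i j r (x + y) = act i j r x + act i j r y"
  and act_cst_mult: "act i j r (cst c * x) = cst c * act i j r x"
  and act_mult: "homogeneous q x \<Longrightarrow>
    act i j r (x * y) = act i j r x * y + (- 1) ^ ((par i + par j) * q) * (x * act i j r y)"
  using superderivation_act[of i j r] unfolding superderivation_def by blast+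

lemma act_0 [simp]: "act i j r 0 = 0"
  using act_add[of i j r 0 0] by simp

lemma act_diff: "act i j r (x - y) = act i j r x - act i j r y"
  using act_add[of i j r "x - y" y] by simp

lemma act_sum: "act i j r (sum f A) = (\<Sum>x\<in>A. act i j r (f x))"
  by (induction A rule: infinite_finite_induct) (simp_all add: act_add)

lemma act_1 [simp]: "act i j r 1 = 0"
  using act_mult[of 0 1 i j r 1] homogeneous_cst[of 1] by simp

lemma act_cst: "act i j r (cst c) = 0"
  using act_cst_mult[of i j r c 1] by simp

lemma fps_act_add: "fps_act i j r (F + G) = fps_act i j r F + fps_act i j r G"
  by (rule fps_ext) (simp add: fps_act_def act_add)

lemma fps_nth_sign_mult: "fps_nth ((- 1) ^ k * F) n = (- 1) ^ k * fps_nth F n"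
  for F :: "'a::ring_1 fps"
  by (cases "even k") simp_all

lemma fps_act_mult:
  assumes "\<And>n. homogeneous q (fps_nth F n)"
  shows "fps_act i j r (F * G) = fps_act i j r F * G + (- 1) ^ ((par i + par j) * q) * (F * fps_act i j r G)"
proof (rule fps_ext)
  fix n
  show "fps_nth (fps_act i j r (F * G)) n =
      fps_nth (fps_act i j r F * G + (- 1) ^ ((par i + par j) * q) * (F * fps_act i j r G)) n"
    unfolding fps_add_nth fps_nth_sign_mult
    by (simp add: fps_act_def fps_mult_nth act_sum act_mult[OF assms] sum.distrib sum_distrib_left)
qed

lemma fps_act_Ez:
  "fps_act i j r (Ez k l) = fps_X ^ r *
    ((if k = j then Ez i l else 0) - (if i = l then (- 1) ^ ((par i + par j) * (par k + par l)) * Ez k j else 0))"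
proof (rule fps_ext)
  fix n
  have "fps_nth (fps_act i j r (Ez k l)) n = ad_E i j (int r) k l (- int n - 1)"
    by (simp add: fps_act_def Ez_def act_E)
  then show "fps_nth (fps_act i j r (Ez k l)) n = fps_nth (fps_X ^ r *
    ((if k = j then Ez i l else 0) - (if i = l then (- 1) ^ ((par i + par j) * (par k + par l)) * Ez k j else 0))) n"
    unfolding ad_E_def E_shift fps_X_power_mult_nth by (simp add: Ez_def fps_nth_sign_mult)
qed

lemma homogeneous_Ez: "homogeneous (par i + par j) (fps_nth (Ez i j) n)"
  by (simp add: Ez_def homogeneous_E)

lemma homogeneous_embed: "homogeneous 0 (fps_nth (embed F) n)"
  by (simp add: embed_def homogeneous_def gconst_def gcoeff_gmonom)

lemma fps_act_embed_mult: "fps_act i j r (embed F * G) = fps_act i j r (embed F) * G + embed F * fps_act i j r G"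
  using fps_act_mult[OF homogeneous_embed, of i j r F G] by simp

lemma homogeneous_add: "homogeneous p f \<Longrightarrow> homogeneous p g \<Longrightarrow> homogeneous p (f + g)"
  unfolding homogeneous_def by (metis add.right_neutral gcoeff_add)

lemma homogeneous_mult:
  fixes f g :: "('r::comm_ring_1, 'o::linorder) grassmann"
  assumes "homogeneous p f" "homogeneous q g"
  shows "homogeneous (p + q) (f * g)"
  unfolding homogeneous_def
proof (intro allI impI)
  fix A assume A: "gcoeff (f * g) A \<noteq> 0"
  then have "finite A" using gcoeff_infinite by blast
  from A obtain B where B: "B \<in> Pow A" "shuffle_sign B (A - B) * gcoeff f B * gcoeff g (A - B) \<noteq> 0"
    unfolding gcoeff_mult by (rule sum.not_neutral_contains_not_neutral)
  then have "gcoeff f B \<noteq> 0" "gcoeff g (A - B) \<noteq> 0" by auto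
  then have "even (card B + p)" "even (card (A - B) + q)"
    using assms unfolding homogeneous_def by blast+
  moreover have "card A = card B + card (A - B)"
    using \<open>finite A\<close> B(1) by (metis Pow_iff card_Diff_subset card_mono finite_subset le_add_diff_inverse)
  ultimately show "even (card A + (p + q))" by auto
qed

lemma homogeneous_sum: "(\<And>x. x \<in> A \<Longrightarrow> homogeneous p (f x)) \<Longrightarrow> homogeneous p (sum f A)"
  by (induction A rule: infinite_finite_induct) (auto intro: homogeneous_add)

lemma homogeneous_fps_mult:
  fixes F G :: "('r::comm_ring_1, 'o::linorder) grassmann fps"
  assumes "\<And>n. homogeneous p (fps_nth F n)" "\<And>n. homogeneous q (fps_nth G n)"
  shows "homogeneous (p + q) (fps_nth (F * G) n)"
  unfolding fps_mult_nth by (intro homogeneous_sum homogeneous_mult assms)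

lemma odd_anticommute:
  assumes "\<And>n. homogeneous 1 (fps_nth F n)" "\<And>n. homogeneous 1 (fps_nth G n)"
  shows "F * G = - (G * (F :: superalg fps))"
proof (rule fps_ext)
  fix n
  have "fps_nth (F * G) n = (\<Sum>i=0..n. - (fps_nth G (n - i) * fps_nth F i))"
    unfolding fps_mult_nth using supercommute[OF assms] by (intro sum.cong refl) simp
  also have "\<dots> = (\<Sum>i=0..n. - (fps_nth G i * fps_nth F (n - i)))"
    by (rule sum.reindex_bij_witness[where i = "\<lambda>i. n - i" and j = "\<lambda>i. n - i"]) auto
  finally show "fps_nth (F * G) n = fps_nth (- (G * F)) n"
    by (simp add: fps_mult_nth sum_negf)
qed

lemma superalg_eq_neg_self: "f = - f \<Longrightarrow> f = 0" for f :: superalg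
proof (rule grassmann_eqI)
  fix A assume "f = - f"
  then have "gcoeff f A = - gcoeff f A" by (metis gcoeff_uminus)
  then have "2 * gcoeff f A = 0" by (simp only: mult_2) simp
  then show "gcoeff f A = gcoeff 0 A" by simp
qed

lemma odd_square:
  assumes "\<And>n. homogeneous 1 (fps_nth F n)"
  shows "F * F = (0 :: superalg fps)"
proof (rule fps_ext)
  fix n
  have "fps_nth (F * F) n = - fps_nth (F * F) n"
    using odd_anticommute[OF assms assms] by (metis fps_neg_nth)
  then show "fps_nth (F * F) n = fps_nth 0 n" by (simp add: superalg_eq_neg_self)
qed

abbreviation \<theta> :: "superalg fps" where "\<theta> \<equiv> Ez 1 2"
abbreviation \<eta> :: "superalg fps" where "\<eta> \<equiv> Ez 2 1"

lemma odd_series_products: "\<theta> * \<theta> = 0" "\<eta> * \<eta> = 0" "\<theta> * \<eta> = - (\<eta> * \<theta>)"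
  using homogeneous_Ez[of 1 2] homogeneous_Ez[of 2 1]
  by (auto simp: par_def intro!: odd_square odd_anticommute)

section \<open>Invariance of the coefficients\<close>

text \<open>For \<open>F\<close> a polynomial in \<open>x(z)\<close> and \<open>y(z)\<close>, \<open>F'\<close> is \<open>(\<partial>\<^sub>x - \<partial>\<^sub>y) F\<close>. It is characterised by the action
of \<open>g[t]\<close>, so that the Leibniz rule for the action becomes the one for \<open>F'\<close>.\<close>

definition xderiv :: "bpoly fps \<Rightarrow> bpoly fps \<Rightarrow> bool" where
  "xderiv F F' \<longleftrightarrow> (\<forall>r.
     fps_act 1 2 r (embed F) = - (embed F' * fps_X ^ r * \<theta>) \<and>
     fps_act 2 1 r (embed F) = embed F' * fps_X ^ r * \<eta> \<and>
     fps_act 1 1 r (embed F) = 0 \<and> fps_act 2 2 r (embed F) = 0)"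

lemma xderiv_x: "xderiv xser 1" and xderiv_y: "xderiv yser (- 1)"
  by (simp_all add: xderiv_def Ez_even[symmetric] fps_act_Ez par_def embed_uminus)

lemma xderiv_1: "xderiv 1 0"
proof -
  have "fps_act i j r 1 = 0" for i j r
    by (rule fps_ext) (simp add: fps_act_def)
  then show ?thesis by (simp add: xderiv_def)
qed

lemma xderiv_add: "xderiv F F' \<Longrightarrow> xderiv G G' \<Longrightarrow> xderiv (F + G) (F' + G')"
  by (simp add: xderiv_def embed_add fps_act_add algebra_simps)

lemma embed_left_commute: "A * (embed F * B) = embed F * (A * B)"
  by (metis embed_commute mult.assoc)

lemma xderiv_mult: "xderiv F F' \<Longrightarrow> xderiv G G' \<Longrightarrow> xderiv (F * G) (F' * G + F * G')"
  by (simp add: xderiv_def embed_add embed_mult fps_act_embed_mult algebra_simps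
      embed_commute[of \<theta>] embed_commute[of \<eta>] embed_left_commute[of "fps_X ^ _"])

lemma xderiv_uminus: "xderiv F F' \<Longrightarrow> xderiv (- F) (- F')"
proof -
  have "fps_act i j r (- A) = - fps_act i j r A" for i j r A
    using fps_act_add[of i j r A "- A"] fps_act_add[of i j r 0 0] by (simp add: minus_unique)
  then show "xderiv F F' \<Longrightarrow> xderiv (- F) (- F')" by (simp add: xderiv_def embed_uminus)
qed

lemma xderiv_power: "xderiv F F' \<Longrightarrow> xderiv (F ^ n) (of_nat n * F ^ (n - 1) * F')"
proof (induction n)
  case 0
  then show ?case using xderiv_1 by simp
next
  case (Suc n)
  have "F' * F ^ n + F * (of_nat n * F ^ (n - 1) * F') = of_nat (Suc n) * F ^ (Suc n - 1) * F'"
    by (cases n) (simp_all add: algebra_simps)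
  then show ?case using xderiv_mult[OF Suc.prems Suc.IH[OF Suc.prems]] by simp
qed

text \<open>Under \<open>E\<^sub>1\<^sub>2[r]\<close> the summand \<open>a\<close> yields \<open>-b c z\<^sup>r \<theta>\<close> and \<open>b \<eta> \<theta>\<close> yields \<open>b z\<^sup>r c \<theta>\<close>, the term with
\<open>b'\<close> being zero as \<open>\<theta>\<^sup>2 = 0\<close>; similarly for \<open>E\<^sub>2\<^sub>1[r]\<close>. The diagonal elements kill \<open>x\<close> and \<open>y\<close> and give \<open>\<eta>\<close> and \<open>\<theta>\<close> opposite weights.\<close>

lemma invariant_series:
  assumes a: "xderiv a (b * (xser + yser))" and b: "xderiv b b'"
  shows "fps_act i j r (embed a + embed b * \<eta> * \<theta>) = 0"
proof -
  have split: "fps_act i j r (embed a + embed b * (\<eta> * \<theta>)) =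
    fps_act i j r (embed a) + fps_act i j r (embed b) * (\<eta> * \<theta>) +
    embed b * (fps_act i j r \<eta> * \<theta> + (- 1) ^ (par i + par j) * (\<eta> * fps_act i j r \<theta>))" for i j
    using fps_act_mult[OF homogeneous_Ez, of i j r 2 1 \<theta>]
    by (simp add: fps_act_add mult.assoc fps_act_embed_mult par_def algebra_simps)
  have X: "A * fps_X ^ r = fps_X ^ r * A" for A :: "superalg fps"
    by (rule fps_mult_fps_X_power_commute[symmetric])
  have c: "\<eta> * embed F = embed F * \<eta>" "\<theta> * embed F = embed F * \<theta>" for F
    by (rule embed_commute)+
  have tt: "\<theta> * (\<eta> * \<theta>) = 0" "\<eta> * (\<eta> * \<theta>) = 0"
    by (simp_all add: odd_series_products mult.assoc[symmetric]) (simp add: mult.assoc odd_series_products)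
  have Xe: "\<eta> * (fps_X ^ r * A) = fps_X ^ r * (\<eta> * A)" for A
    using arg_cong[OF X[of \<eta>], of "\<lambda>B. B * A"] by (simp only: mult.assoc)
  consider "i = 1" "j = 1" | "i = 1" "j = 2" | "i = 2" "j = 1" | "i = 2" "j = 2"
    using exhaust_2[of i] exhaust_2[of j] by blast
  then show ?thesis
  proof cases
    case 1
    then show ?thesis using a b
      by (simp add: split xderiv_def fps_act_Ez par_def Xe mult.assoc)
  next
    case 2
    have "fps_act 1 2 r (embed b) * (\<eta> * \<theta>) = 0"
      using b by (simp add: xderiv_def mult.assoc tt)
    moreover have "fps_act 1 2 r \<eta> = fps_X ^ r * embed (xser + yser)" "fps_act 1 2 r \<theta> = 0"
      by (simp_all add: fps_act_Ez par_def Ez_even embed_add)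
    moreover have "fps_act 1 2 r (embed a) = - (embed b * embed (xser + yser) * fps_X ^ r * \<theta>)"
      using a by (simp add: xderiv_def embed_mult)
    ultimately show ?thesis using 2
      by (simp add: split mult.assoc embed_left_commute[of "fps_X ^ r"])
  next
    case 3
    have "fps_act 2 1 r (embed b) * (\<eta> * \<theta>) = 0"
      using b by (simp add: xderiv_def mult.assoc tt)
    moreover have "fps_act 2 1 r \<theta> = fps_X ^ r * embed (xser + yser)" "fps_act 2 1 r \<eta> = 0"
      by (simp_all add: fps_act_Ez par_def Ez_even embed_add add.commute)
    moreover have "fps_act 2 1 r (embed a) = embed b * embed (xser + yser) * fps_X ^ r * \<eta>"
      using a by (simp add: xderiv_def embed_mult)
    moreover have "\<eta> * (fps_X ^ r * embed F) = embed F * (fps_X ^ r * \<eta>)" for F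
      by (simp only: embed_commute[of "fps_X ^ r"] embed_left_commute[of \<eta>] X[of \<eta>])
    ultimately show ?thesis using 3 by (simp add: split par_def mult.assoc)
  next
    case 4
    then show ?thesis using a b
      by (simp add: split xderiv_def fps_act_Ez par_def Xe mult.assoc)
  qed
qed

lemma coefficient_invariant:
  assumes "\<And>i j r. fps_act i j r F = 0"
  shows "fps_nth F n \<in> invariants"
proof -
  have "act i j r (fps_nth F n) = 0" if "r \<ge> 0" for i j r
    using arg_cong[OF assms[of i j "nat r"], of "\<lambda>F. fps_nth F n"] that by (simp add: fps_act_def)
  then show ?thesis by (simp add: invariants_def)
qed

text \<open>The Leibniz rule of an odd derivation involves the parity of the first factor; hence the induction carries along
that all elements are even.\<close>

lemma algebra_generated_subset_invariants:
  assumes "X \<subseteq> invariants" and "\<And>x. x \<in> X \<Longrightarrow> homogeneous 0 x"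
  shows "algebra_generated X \<subseteq> invariants"
proof
  fix x assume "x \<in> algebra_generated X"
  then have "x \<in> invariants \<and> homogeneous 0 x"
  proof (induction rule: algebra_generated.induct)
    case (const c)
    then show ?case by (simp add: invariants_def act_cst homogeneous_cst)
  next
    case (gen x)
    then show ?case using assms by blast
  next
    case (add x y)
    then show ?case by (simp add: invariants_def act_add homogeneous_add)
  next
    case (mult x y)
    have "homogeneous 0 (x * y)" using homogeneous_mult[of 0 x 0 y] mult.IH by simp
    then show ?case using mult.IH act_mult[of 0 x] by (simp add: invariants_def)
  qed
  then show "x \<in> invariants" by simp
qed

section \<open>Generators of the algebra of invariants\<close>

text \<open>This gathers the argument for a family \<open>a\<^sub>k + b\<^sub>k \<eta> \<theta>\<close>: its coefficients are invariants, the bodies of the generated algebra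
form a subalgebra \<open>K\<close>, and \<open>K\<close> contains the body of every invariant as soon as the \<open>a\<^sub>k\<close> generate the coefficients of
\<open>c x\<^sup>k\<close>. What remains specific to each family is the shape of its members and this last condition on polynomials.\<close>

lemma generates_invariants:
  assumes form: "\<And>k. k \<ge> 1 \<Longrightarrow> S k = embed (a k) + embed (b k) * \<eta> * \<theta>"
    and a: "\<And>k. k \<ge> 1 \<Longrightarrow> xderiv (a k) (b k * (xser + yser))"
    and b: "\<And>k. k \<ge> 1 \<Longrightarrow> \<exists>b'. xderiv (b k) b'"
    and gen: "\<And>K k. bpoly_subalgebra K \<Longrightarrow> (\<And>k. k \<ge> 1 \<Longrightarrow> a k \<in> bpoly_subalgebra.series K) \<Longrightarrow>
      (xser + yser) * xser ^ k \<in> bpoly_subalgebra.series K"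
  shows "algebra_generated {fps_nth (S k) n | k n. k \<ge> 1} = invariants"
proof
  let ?X = "{fps_nth (S k) n | k n. k \<ge> 1}"
  have body_S: "body (fps_nth (S k) n) = fps_nth (a k) n" if "k \<ge> 1" for k n
  proof -
    have "body (fps_nth (F * \<theta>) n) = 0" for F
      by (simp add: fps_mult_nth body_def gcoeff_sum gcoeff_mult Ez_def E_gens theta_def gcoeff_gmonom)
    then show ?thesis by (simp add: form[OF that] body_add) (simp add: embed_def body_gconst)
  qed
  have inv: "?X \<subseteq> invariants"
  proof
    fix x assume "x \<in> ?X"
    then obtain k n where k: "k \<ge> 1" and x: "x = fps_nth (S k) n" by blast
    obtain b' where "xderiv (b k) b'" using b[OF k] by blast
    then show "x \<in> invariants"
      unfolding x form[OF k] by (intro coefficient_invariant invariant_series a k)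
  qed
  have "homogeneous 0 (fps_nth (S k) n)" if "k \<ge> 1" for k n
  proof -
    have "homogeneous (0 + (par 2 + par 1) + (par 1 + par 2)) (fps_nth (embed (b k) * \<eta> * \<theta>) n)"
      by (intro homogeneous_fps_mult homogeneous_embed homogeneous_Ez)
    then have "homogeneous 0 (fps_nth (embed (b k) * \<eta> * \<theta>) n)"
      by (rule homogeneous_cong[rotated]) (simp add: par_def)
    then show ?thesis by (simp add: form[OF that] homogeneous_add homogeneous_embed)
  qed
  then have hom: "homogeneous 0 x" if "x \<in> ?X" for x
    using that by blast
  show sub: "algebra_generated ?X \<subseteq> invariants"
    using inv hom by (rule algebra_generated_subset_invariants)
  define K where "K = body ` algebra_generated ?X"
  interpret K: bpoly_subalgebra K
  proof
    show "scalar c \<in> K" for c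
      unfolding K_def by (rule image_eqI[of _ _ "cst c"]) (simp_all add: cst_def body_gconst algebra_generated.const[unfolded cst_def])
    show "p + q \<in> K" "p * q \<in> K" if "p \<in> K" "q \<in> K" for p q
      using that unfolding K_def
      by (auto simp: body_add[symmetric] body_mult[symmetric] intro: algebra_generated.add algebra_generated.mult)
  qed
  have "a k \<in> K.series" if "k \<ge> 1" for k
  proof -
    have "fps_nth (a k) n \<in> K" for n
      unfolding K_def body_S[OF that, symmetric] using that
      by (intro imageI algebra_generated.gen) blast
    then show ?thesis by (simp add: K.series_def)
  qed
  then have series: "(xser + yser) * xser ^ k \<in> K.series" for k
    by (intro gen K.bpoly_subalgebra_axioms)
  show "invariants \<subseteq> algebra_generated ?X"
  proof
    fix P assume P: "P \<in> invariants"
    obtain J R where "\<And>j. j \<ge> J \<Longrightarrow> R j = 0"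
      "\<And>r. pdiff (2 * r) (body P) - pdiff (Suc (2 * r)) (body P) = (\<Sum>i<J. (xvar i + yvar i) * R (i + r))"
      using body_divisible_gradient[OF P] by blast
    then have "body P \<in> K" by (rule K.central_divisible_gradient_mem[OF series])
    then obtain Q where Q: "Q \<in> algebra_generated ?X" "body P = body Q" unfolding K_def by blast
    have "P - Q \<in> invariants" using P Q sub by (auto simp: invariants_def act_diff)
    then have "P - Q = 0" using Q by (intro invariant_eq_0) (simp_all add: body_diff)
    then show "P \<in> algebra_generated ?X" using Q by simp
  qed
qed


lemma xderiv_cong: "xderiv F F' \<Longrightarrow> F' = G \<Longrightarrow> xderiv F G"
  by simp

lemma xderiv_sum_xy: "xderiv (xser + yser) 0"
  using xderiv_add[OF xderiv_x xderiv_y] by simp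

lemma xderiv_of_nat: "xderiv (of_nat n) 0"
proof (induction n)
  case 0
  then show ?case using xderiv_add[OF xderiv_1 xderiv_uminus[OF xderiv_1]] by simp
next
  case (Suc n)
  then show ?case using xderiv_add[OF xderiv_1] by fastforce
qed

lemma generated_h: "algebra_generated {fps_nth (series_h k) n | k n. k \<ge> 1} = invariants"
proof (rule generates_invariants)
  fix k :: nat assume k: "k \<ge> 1"
  show "series_h k = embed (xser ^ (k - 1) * (xser + yser)) + embed (of_nat (k - 1) * xser ^ (k - 2)) * \<eta> * \<theta>"
    by (simp add: series_h_def Ez_even embed_mult embed_power embed_add embed_of_nat)
  show "xderiv (xser ^ (k - 1) * (xser + yser)) (of_nat (k - 1) * xser ^ (k - 2) * (xser + yser))"
    by (rule xderiv_cong[OF xderiv_mult[OF xderiv_power[OF xderiv_x] xderiv_sum_xy]])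
       (simp add: numeral_2_eq_2)
  show "\<exists>b'. xderiv (of_nat (k - 1) * xser ^ (k - 2)) b'"
    by (rule exI, rule xderiv_mult[OF xderiv_of_nat xderiv_power[OF xderiv_x]])
next
  fix K k
  assume K: "bpoly_subalgebra K"
    and "\<And>k. 1 \<le> k \<Longrightarrow> xser ^ (k - 1) * (xser + yser) \<in> bpoly_subalgebra.series K"
  from this(2)[of "Suc k"] show "(xser + yser) * xser ^ k \<in> bpoly_subalgebra.series K"
    by (simp add: mult.commute)
qed

lemma generated_b: "algebra_generated {fps_nth (series_b k) n | k n. k \<ge> 1} = invariants"
proof (rule generates_invariants)
  fix k :: nat assume k: "k \<ge> 1"
  show "series_b k = embed (yser ^ (k - 1) * (xser + yser)) + embed (- (of_nat (k - 1) * yser ^ (k - 2))) * \<eta> * \<theta>"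
    by (simp add: series_b_def Ez_even embed_mult embed_power embed_add embed_of_nat embed_uminus)
  show "xderiv (yser ^ (k - 1) * (xser + yser)) (- (of_nat (k - 1) * yser ^ (k - 2)) * (xser + yser))"
    by (rule xderiv_cong[OF xderiv_mult[OF xderiv_power[OF xderiv_y] xderiv_sum_xy]])
       (simp add: numeral_2_eq_2)
  show "\<exists>b'. xderiv (- (of_nat (k - 1) * yser ^ (k - 2))) b'"
    by (rule exI, rule xderiv_uminus[OF xderiv_mult[OF xderiv_of_nat xderiv_power[OF xderiv_y]]])
next
  fix K k
  assume K: "bpoly_subalgebra K"
    and "\<And>k. 1 \<le> k \<Longrightarrow> yser ^ (k - 1) * (xser + yser) \<in> bpoly_subalgebra.series K"
  from this(2)[of "Suc _"] show "(xser + yser) * xser ^ k \<in> bpoly_subalgebra.series K"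
    by (intro bpoly_subalgebra.series_from_b[OF K]) (simp add: mult.commute)
qed

section \<open>Powers of the supermatrix\<close>

text \<open>The complete homogeneous polynomial of degree \<open>k - 1\<close> in \<open>x\<close> and \<open>-y\<close>: the sum over all walks of length \<open>k\<close> on two states
that cross once from the first state to the second, with weights \<open>x\<close> and \<open>-y\<close> for staying.\<close>

fun hsum :: "nat \<Rightarrow> bpoly fps" where
  "hsum 0 = 0"
| "hsum (Suc k) = xser * hsum k + (- yser) ^ k"

text \<open>For \<open>z = x\<close> this is the sum over walks of length \<open>k\<close> that start and end in the first state and leave it once; the two crossings
contribute \<open>\<eta> \<theta>\<close> and are not counted. The other state is covered by \<open>z = -y\<close>. Walks with more excursions vanish
as \<open>\<theta>\<^sup>2 = \<eta>\<^sup>2 = 0\<close>.\<close>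

fun excursion :: "bpoly fps \<Rightarrow> nat \<Rightarrow> bpoly fps" where
  "excursion z 0 = 0"
| "excursion z (Suc k) = z * excursion z k + hsum k"

lemma hsum_mult: "(xser + yser) * hsum k = xser ^ k - (- yser) ^ k"
proof (induction k)
  case (Suc k)
  have "(xser + yser) * hsum (Suc k) = xser * ((xser + yser) * hsum k) + (xser + yser) * (- yser) ^ k"
    by (simp add: algebra_simps)
  also have "\<dots> = xser ^ Suc k - (- yser) ^ Suc k"
    unfolding Suc by (simp add: algebra_simps)
  finally show ?case .
qed simp

lemma hsum_Suc: "hsum (Suc k) = xser ^ k + (- yser) * hsum k"
  using hsum_mult[of k] by (simp add: algebra_simps)

text \<open>Together with the companion for \<open>-y\<close> this is the identity \<open>b c = (\<partial>\<^sub>x - \<partial>\<^sub>y) a\<close> for \<open>a = x\<^sup>k - (-y)\<^sup>k\<close>: in the sum of the two the terms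
\<open>hsum k\<close> cancel.\<close>

lemma excursion_x: "(xser + yser) * excursion xser k = of_nat k * xser ^ (k - 1) - hsum k"
proof (induction k)
  case (Suc k)
  have "(xser + yser) * excursion xser (Suc k) =
      xser * ((xser + yser) * excursion xser k) + (xser + yser) * hsum k"
    by (simp add: algebra_simps)
  also have "\<dots> = of_nat k * (xser * xser ^ (k - 1)) + xser ^ k - hsum (Suc k)"
    unfolding Suc hsum_mult by (simp add: algebra_simps)
  also have "\<dots> = of_nat (Suc k) * xser ^ (Suc k - 1) - hsum (Suc k)"
    by (cases k) (simp_all add: algebra_simps)
  finally show ?case .
qed simp

lemma excursion_y: "(xser + yser) * excursion (- yser) k = hsum k - of_nat k * (- yser) ^ (k - 1)"
proof (induction k)
  case (Suc k)
  have "(xser + yser) * excursion (- yser) (Suc k) =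
      (- yser) * ((xser + yser) * excursion (- yser) k) + (xser + yser) * hsum k"
    by (simp add: algebra_simps)
  also have "\<dots> = hsum (Suc k) - (of_nat k * ((- yser) * (- yser) ^ (k - 1)) + (- yser) ^ k)"
    unfolding Suc hsum_mult hsum_Suc by (simp add: algebra_simps)
  also have "\<dots> = hsum (Suc k) - of_nat (Suc k) * (- yser) ^ (Suc k - 1)"
    by (cases k) (simp_all add: algebra_simps)
  finally show ?case .
qed simp

text \<open>The signs come from moving \<open>\<theta>\<close> past \<open>\<eta>\<close>: the excursion from the first state contributes \<open>\<theta> (-\<eta>) = \<eta> \<theta>\<close>, the one from the second
\<open>(-\<eta>) \<theta>\<close>. In the supertrace both therefore count with the same sign.\<close>

lemma matrix_power:
  "(((**) (vector [vector [Ez 1 1, Ez 1 2], vector [- Ez 2 1, - Ez 2 2]]) ^^ k) (mat 1)) =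
   (vector [vector [embed (xser ^ k) + embed (excursion xser k) * \<eta> * \<theta>, embed (hsum k) * \<theta>],
            vector [- (embed (hsum k) * \<eta>), embed ((- yser) ^ k) - embed (excursion (- yser) k) * \<eta> * \<theta>]] :: superalg fps ^ 2 ^ 2)"
proof (induction k)
  case 0
  show ?case by (simp add: vec_eq_iff forall_2 mat_def)
next
  case (Suc k)
  have zero: "\<theta> * (\<eta> * \<theta>) = 0" "\<eta> * (\<eta> * \<theta>) = 0"
    by (simp_all add: odd_series_products mult.assoc[symmetric]) (simp add: mult.assoc odd_series_products)
  note expand = embed_mult embed_add embed_diff embed_uminus Ez_even algebra_simps
    embed_commute[of \<theta>] embed_left_commute[of \<theta>] embed_commute[of \<eta>] embed_left_commute[of \<eta>] odd_series_products zero
  let ?A = "embed (xser ^ k) + embed (excursion xser k) * \<eta> * \<theta>"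
    and ?D = "embed ((- yser) ^ k) - embed (excursion (- yser) k) * \<eta> * \<theta>"
  have "Ez 1 1 * ?A + \<theta> * - (embed (hsum k) * \<eta>) =
      embed (xser ^ Suc k) + embed (excursion xser (Suc k)) * \<eta> * \<theta>"
    by (simp add: expand)
  moreover have "Ez 1 1 * (embed (hsum k) * \<theta>) + \<theta> * ?D = embed (hsum (Suc k)) * \<theta>"
    by (simp add: expand)
  moreover have "- \<eta> * ?A + - Ez 2 2 * - (embed (hsum k) * \<eta>) = - (embed (hsum (Suc k)) * \<eta>)"
    unfolding hsum_Suc by (simp add: expand)
  moreover have "- \<eta> * (embed (hsum k) * \<theta>) + - Ez 2 2 * ?D =
      embed ((- yser) ^ Suc k) - embed (excursion (- yser) (Suc k)) * \<eta> * \<theta>"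
    by (simp add: expand)
  ultimately show ?case
    unfolding funpow.simps o_apply Suc
    by (simp add: vec_eq_iff forall_2 matrix_matrix_mult_def sum_2 vector_2 del: hsum.simps excursion.simps power_Suc)
qed

lemma generated_s: "algebra_generated {fps_nth (series_s k) n | k n. k \<ge> 1} = invariants"
proof (rule generates_invariants)
  fix k :: nat assume k: "k \<ge> 1"
  show "series_s k = embed (xser ^ k - (- yser) ^ k) + embed (excursion xser k + excursion (- yser) k) * \<eta> * \<theta>"
    unfolding series_s_def matrix_power str_def by (simp add: vector_2 embed_diff embed_add algebra_simps)
  have "of_nat k * xser ^ (k - 1) * 1 - of_nat k * (- yser) ^ (k - 1) * - (- 1) =
      (excursion xser k + excursion (- yser) k) * (xser + yser)"
    using excursion_x[of k] excursion_y[of k] by (simp add: algebra_simps)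
  then show "xderiv (xser ^ k - (- yser) ^ k) ((excursion xser k + excursion (- yser) k) * (xser + yser))"
    using xderiv_add[OF xderiv_power[OF xderiv_x, of k] xderiv_uminus[OF xderiv_power[OF xderiv_uminus[OF xderiv_y], of k]]]
    by simp
  have hsum: "\<exists>F. xderiv (hsum k) F" for k
  proof (induction k)
    case 0
    then show ?case using xderiv_of_nat[of 0] by auto
  next
    case (Suc k)
    then obtain F where "xderiv (hsum k) F" by blast
    from xderiv_add[OF xderiv_mult[OF xderiv_x this] xderiv_power[OF xderiv_uminus[OF xderiv_y], of k]]
    show ?case by auto
  qed
  have "\<exists>F. xderiv (excursion z k) F" if z: "xderiv z z'" for z z' k
  proof (induction k)
    case 0
    then show ?case using xderiv_of_nat[of 0] by auto
  next
    case (Suc k)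
    then obtain F where F: "xderiv (excursion z k) F" by blast
    obtain G where G: "xderiv (hsum k) G" using hsum by blast
    from xderiv_add[OF xderiv_mult[OF z F] G] show ?case by auto
  qed
  from this[OF xderiv_x] this[OF xderiv_uminus[OF xderiv_y]]
  show "\<exists>b'. xderiv (excursion xser k + excursion (- yser) k) b'"
    using xderiv_add by blast
next
  fix K k
  assume K: "bpoly_subalgebra K"
    and "\<And>k. 1 \<le> k \<Longrightarrow> xser ^ k - (- yser) ^ k \<in> bpoly_subalgebra.series K"
  then show "(xser + yser) * xser ^ k \<in> bpoly_subalgebra.series K"
    by (intro bpoly_subalgebra.series_from_s)
qed

theorem theorem2p1:
  shows "algebra_generated {fps_nth (series_h k) n | k n. k \<ge> 1} = invariants \<and>
    algebra_generated {fps_nth (series_b k) n | k n. k \<ge> 1} = invariants \<and>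
    algebra_generated {fps_nth (series_s k) n | k n. k \<ge> 1} = invariants"
  using generated_h generated_b generated_s by (intro conjI)

end
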